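(* Let $m$ be a positive even integer, $p$ a prime, and $B\in\mathcal L^{(1)}_{m-1,p}$. Let $B^{(1)}=\begin{pmatrix}1&r_B/2\\{}^tr_B/2&(B+{}^tr_Br_B)/4\end{pmatrix}$ with $r_B\in\mathbb Z_p^{m-1}$ such that $B\equiv-{}^tr_Br_B\bmod4\mathcal L_{m-1,p}$. Then there is a bijection $$\psi:GL_{m-1}(\mathbb Z_p)\backslash\widetilde\Omega^{(1)}(B)\ \longrightarrow\ GL_m(\mathbb Z_p)\backslash\widetilde\Omega^{(0)}(2B^{(1)})$$ with $\nu_p(\det\psi(W))=\nu_p(\det W)$ for all $W$; in particular it restricts, for each $i=0,\dots,m-1$, to a bijection $GL_{m-1}(\mathbb Z_p)\backslash\widetilde\Omega^{(1)}(B,i)\to GL_m(\mathbb Z_p)\backslash\widetilde\Omega^{(0)}(2B^{(1)},i)$.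
   Context: $\mathcal L_{r,p}$ denotes half-integral symmetric $r\times r$ matrices over $\mathbb Z_p$ (diagonal in $\mathbb Z_p$, off-diagonal in $\frac12\mathbb Z_p$); $S_r(\mathbb Z_p)_e=2\mathcal L_{r,p}$; $\mathcal L'_{r,p}=\{A\in\mathcal L_{r,p}:A\equiv-{}^trr\bmod4\mathcal L_{r,p}$ for some $r\in\mathbb Z_p^{r}\}$. For $m$ even, $\mathcal L^{(0)}_{m,p}$ is the set of nondegenerate elements of $S_m(\mathbb Z_p)_e$ and $\mathcal L^{(1)}_{m-1,p}$ the set of nondegenerate elements of $\mathcal L'_{m-1,p}$. For $B\in\mathcal L^{(j)}_{m-j,p}$, $\widetilde\Omega^{(j)}(B)=\{W\in M_{m-j}(\mathbb Z_p)\cap GL_{m-j}(\mathbb Q_p):{}^tW^{-1}BW^{-1}\in\mathcal L^{(j)}_{m-j,p}\}$, and $\widetilde\Omega^{(j)}(B,i)=\widetilde\Omega^{(j)}(B)\cap\mathcal D_{m-j,i}$ with $\mathcal D_{r,i}=GL_r(\mathbb Z_p)\begin{pmatrix}1_{r-i}&0\\0&p1_i\end{pmatrix}GL_r(\mathbb Z_p)$. $GL$ acts on $\widetilde\Omega$ by left multiplication. *)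

theory Defs
  imports "HOL-Combinatorics.Permutations" "HOL-Computational_Algebra.Primes"
begin

text \<open>p-adic integers, realised concretely as compatible sequences of residues:
  an element x of Z_p is given by x k = (x mod p^k) in the range 0..p^k-1, so
  x k = x (Suc k) mod p^k for all k.\<close>

type_synonym zp = "nat \<Rightarrow> int"

definition Zp :: "int \<Rightarrow> zp set" where
  "Zp p = {x. \<forall>k. x k = x (Suc k) mod p ^ k}"

definition zp_zero :: zp where "zp_zero = (\<lambda>k. 0)"

text \<open>p-adic valuation of a nonzero p-adic integer: the largest k with x \<equiv> 0 mod p^k.\<close>
definition zp_val :: "zp \<Rightarrow> nat" where
  "zp_val x = (LEAST k. x (Suc k) \<noteq> 0)"

text \<open>Vectors in Z_p^n (entries outside 0..n-1 are zero) and n x n matrices over Z_p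
  (entries outside the n x n block are zero).\<close>

type_synonym zvec = "nat \<Rightarrow> zp"
type_synonym zmat = "nat \<Rightarrow> nat \<Rightarrow> zp"

definition vecZp :: "int \<Rightarrow> nat \<Rightarrow> zvec set" where
  "vecZp p n = {r. (\<forall>i. r i \<in> Zp p) \<and> (\<forall>i. n \<le> i \<longrightarrow> r i = zp_zero)}"

definition matZp :: "int \<Rightarrow> nat \<Rightarrow> zmat set" where
  "matZp p n = {A. (\<forall>i j. A i j \<in> Zp p) \<and>
                   (\<forall>i j. (n \<le> i \<or> n \<le> j) \<longrightarrow> A i j = zp_zero)}"

definition madd :: "int \<Rightarrow> zmat \<Rightarrow> zmat \<Rightarrow> zmat" where
  "madd p A B = (\<lambda>i j k. (A i j k + B i j k) mod p ^ k)"

definition msmul :: "int \<Rightarrow> int \<Rightarrow> zmat \<Rightarrow> zmat" where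
  "msmul p c A = (\<lambda>i j k. (c * A i j k) mod p ^ k)"

definition mmul :: "int \<Rightarrow> nat \<Rightarrow> zmat \<Rightarrow> zmat \<Rightarrow> zmat" where
  "mmul p n A B = (\<lambda>i j k. if i < n \<and> j < n then (\<Sum>l<n. A i l k * B l j k) mod p ^ k else 0)"

definition mtrans :: "zmat \<Rightarrow> zmat" where
  "mtrans A = (\<lambda>i j. A j i)"

definition mid :: "int \<Rightarrow> nat \<Rightarrow> zmat" where
  "mid p n = (\<lambda>i j k. if i < n \<and> i = j then 1 mod p ^ k else 0)"

definition outer :: "int \<Rightarrow> nat \<Rightarrow> zvec \<Rightarrow> zmat" where
  "outer p n r = (\<lambda>i j k. if i < n \<and> j < n then (r i k * r j k) mod p ^ k else 0)"

definition mdet :: "int \<Rightarrow> nat \<Rightarrow> zmat \<Rightarrow> zp" where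
  "mdet p n A = (\<lambda>k. (\<Sum>\<sigma> \<in> {\<sigma>. \<sigma> permutes {..<n}}. sign \<sigma> * (\<Prod>i<n. A i (\<sigma> i) k)) mod p ^ k)"

definition GLZp :: "int \<Rightarrow> nat \<Rightarrow> zmat set" where
  "GLZp p n = {U \<in> matZp p n. \<exists>V \<in> matZp p n. mmul p n U V = mid p n \<and> mmul p n V U = mid p n}"

definition dmat :: "int \<Rightarrow> nat \<Rightarrow> nat \<Rightarrow> zmat" where
  "dmat p r i = (\<lambda>a b k. if a < r \<and> a = b then (if a < r - i then 1 else p) mod p ^ k else 0)"

definition Dcoset :: "int \<Rightarrow> nat \<Rightarrow> nat \<Rightarrow> zmat set" where
  "Dcoset p r i = {mmul p r (mmul p r U (dmat p r i)) V | U V. U \<in> GLZp p r \<and> V \<in> GLZp p r}"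

definition Se :: "int \<Rightarrow> nat \<Rightarrow> zmat set" where
  "Se p n = {A \<in> matZp p n. (\<forall>i j. A i j = A j i) \<and>
               (\<forall>i<n. \<exists>y \<in> Zp p. A i i = (\<lambda>k. (2 * y k) mod p ^ k))}"

text \<open>CONVENTION: a half-integral matrix A in L_{n,p} is represented by its double 2A,
  which ranges exactly over S_n(Z_p)_e = 2 L_{n,p}. Under this representation
  A \<equiv> -r^t r mod 4 L_{n,p}  iff  2A + 2 r^t r = 4 D for some D in S_n(Z_p)_e
  (namely D = 2 (A + r^t r)/4).
  Lprime_dbl p n is thus the set of doubles of elements of L'_{n,p}.\<close>
definition Lprime_dbl :: "int \<Rightarrow> nat \<Rightarrow> zmat set" where
  "Lprime_dbl p n = {A \<in> Se p n. \<exists>r \<in> vecZp p n. \<exists>D \<in> Se p n.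
                       madd p A (msmul p 2 (outer p n r)) = msmul p 4 D}"

definition L0 :: "int \<Rightarrow> nat \<Rightarrow> zmat set" where
  "L0 p n = {A \<in> Se p n. mdet p n A \<noteq> zp_zero}"

text \<open>Doubles of elements of L^{(1)}_{n,p} (nondegenerate elements of L'_{n,p}).\<close>
definition L1_dbl :: "int \<Rightarrow> nat \<Rightarrow> zmat set" where
  "L1_dbl p n = {A \<in> Lprime_dbl p n. mdet p n A \<noteq> zp_zero}"

text \<open>For W in M_n(Z_p) with det W \<noteq> 0 (i.e. W in GL_n(Q_p)),
  the condition  ^tW^{-1} B W^{-1} \<in> X  is written equivalently as
  B = ^tW C W for some C \<in> X (C is then ^tW^{-1} B W^{-1}).\<close>
definition Omega0 :: "int \<Rightarrow> nat \<Rightarrow> zmat \<Rightarrow> zmat set" where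
  "Omega0 p n B = {W \<in> matZp p n. mdet p n W \<noteq> zp_zero \<and>
       (\<exists>C \<in> L0 p n. B = mmul p n (mmul p n (mtrans W) C) W)}"

text \<open>Omega1 p n B2 with B2 = 2B is Omega-tilde^{(1)}(B) (scaling by 2 commutes with
  B \<mapsto> ^tW^{-1} B W^{-1}).\<close>
definition Omega1 :: "int \<Rightarrow> nat \<Rightarrow> zmat \<Rightarrow> zmat set" where
  "Omega1 p n B2 = {W \<in> matZp p n. mdet p n W \<noteq> zp_zero \<and>
       (\<exists>C \<in> L1_dbl p n. B2 = mmul p n (mmul p n (mtrans W) C) W)}"

definition GLorbit :: "int \<Rightarrow> nat \<Rightarrow> zmat \<Rightarrow> zmat set" where
  "GLorbit p n W = {mmul p n U W | U. U \<in> GLZp p n}"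

definition GLquot :: "int \<Rightarrow> nat \<Rightarrow> zmat set \<Rightarrow> zmat set set" where
  "GLquot p n S = GLorbit p n ` S"

text \<open>2 B^{(1)} for B2 = 2B (size n = m-1), given r_B and D = 2 (B + ^t r_B r_B)/4:
  2B^{(1)} = [[2, r_B], [^t r_B, D]] of size n+1.\<close>
definition twoB1 :: "int \<Rightarrow> nat \<Rightarrow> zvec \<Rightarrow> zmat \<Rightarrow> zmat" where
  "twoB1 p n r D = (\<lambda>i j k.
     if i = 0 \<and> j = 0 then 2 mod p ^ k
     else if i = 0 \<and> j \<le> n then r (j - 1) k
     else if j = 0 \<and> i \<le> n then r (i - 1) k
     else if i \<le> n \<and> j \<le> n then D (i - 1) (j - 1) k
     else 0)"

end

theory Submission
  imports Defs "HOL-Library.Function_Algebras" "Jordan_Normal_Form.Determinant"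
begin

text \<open>
  Write n = m - 1.  Let W be in Omega^(1)(B), so B = ^t W C W with C in
  L^(1), C + 2 ^t s s = 4E for a vector s and an even symmetric E.  The bordered
  matrix [[1, x], [0, W]] carries the nondegenerate even matrix [[2, s], [^t s, E]]
  to 2B^(1) exactly when r_B = 2x + ^t s W, and such an x in Z_p^n exists:
  comparing diagonals shows that r_B - ^t s W is divisible by 2 (for p = 2 via
  squares modulo 4).  The bordering is unique up to a unipotent matrix
  [[1, t], [0, 1]], and every element of Omega^(0)(2B^(1)) is GL_{n+1}-equivalent
  to such a bordering (its first column contains a unit, since otherwise p^2 would
  divide the corner entry 2).  Hence W |-> orbit of [[1, x], [0, W]] induces the
  required bijection of orbit spaces; it preserves det, hence nu_p(det), and the
  double cosets D_{.,i}, since bordering by 1 preserves elementary divisors.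
\<close>

type_synonym R = "nat \<Rightarrow> int"
type_synonym fm = "nat \<Rightarrow> nat \<Rightarrow> R"

lemma of_int_fun_apply[simp]: "(of_int c :: 'a \<Rightarrow> 'b::ring_1) x = of_int c"
  by (cases c rule: int_cases) (auto simp: of_nat_fun)

lemma sum_fun_apply: "(sum f A :: 'a \<Rightarrow> 'b::comm_monoid_add) x = sum (\<lambda>a. f a x) A"
  by (induction A rule: infinite_finite_induct) auto

lemma prod_fun_apply: "(prod f A :: 'a \<Rightarrow> 'b::comm_monoid_mult) x = prod (\<lambda>a. f a x) A"
  by (induction A rule: infinite_finite_induct) auto

lemma power_fun_apply: "((f :: 'a \<Rightarrow> 'b::monoid_mult) ^ n) x = f x ^ n"
  by (induction n) auto

section \<open>Z_p as coherent integer sequences modulo null sequences\<close>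

text \<open>Fix a prime p.  A sequence f is coherent (f in Coh) if f (k+1) = f k mod p^k;
  it then represents a p-adic integer.  Sequences in the ideal I (f k = 0 mod p^k for
  all k) represent 0, so Coh/I is Z_p, and reduce picks the canonical representative
  used by the concrete type Zp p.\<close>

locale padic =
  fixes p :: int
  assumes pr: "prime p"
begin

lemma p_gt1: "p > 1" using pr prime_gt_1_int by blast
lemma p_pos: "p > 0" using p_gt1 by simp
lemma pk_pos: "p ^ k > 0" using p_pos by simp

definition I :: "R set" where "I = {f. \<forall>k. p ^ k dvd f k}"
definition Coh :: "R set" where "Coh = {f. \<forall>k. p ^ k dvd f (Suc k) - f k}"
definition reduce :: "R \<Rightarrow> R" where "reduce f = (\<lambda>k. f k mod p ^ k)"

lemma I_0[simp]: "0 \<in> I" by (simp add: I_def)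
lemma I_add[intro]: "f \<in> I \<Longrightarrow> g \<in> I \<Longrightarrow> f + g \<in> I" by (auto simp: I_def)
lemma I_diff[intro]: "f \<in> I \<Longrightarrow> g \<in> I \<Longrightarrow> f - g \<in> I" by (auto simp: I_def)
lemma I_uminus[intro]: "f \<in> I \<Longrightarrow> - f \<in> I" by (auto simp: I_def)
lemma I_multl[intro]: "f \<in> I \<Longrightarrow> g * f \<in> I" by (auto simp: I_def)
lemma I_multr[intro]: "f \<in> I \<Longrightarrow> f * g \<in> I" by (auto simp: I_def)
lemma I_sum[intro]: "(\<And>x. x \<in> A \<Longrightarrow> f x \<in> I) \<Longrightarrow> sum f A \<in> I"
  by (induction A rule: infinite_finite_induct) auto

lemma I_cong_sum: "(\<And>x. x \<in> A \<Longrightarrow> f x - g x \<in> I) \<Longrightarrow> sum f A - sum g A \<in> I"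
  using I_sum[of A "\<lambda>x. f x - g x"] by (simp add: sum_subtractf)
lemma I_cong_prod: "(\<And>x. x \<in> A \<Longrightarrow> f x - g x \<in> I) \<Longrightarrow> prod f A - prod g A \<in> I"
proof (induction A rule: infinite_finite_induct)
  case (insert x F)
  have "prod f (insert x F) - prod g (insert x F) = f x * (prod f F - prod g F) + (f x - g x) * prod g F"
    using insert by (simp add: algebra_simps)
  moreover have "f x - g x \<in> I" "prod f F - prod g F \<in> I" using insert.prems insert.IH by blast+
  ultimately show ?case by (metis I_add I_multl I_multr)
qed auto

lemma I_trans: "f - g \<in> I \<Longrightarrow> g - h \<in> I \<Longrightarrow> f - h \<in> I"
  using I_add[of "f - g" "g - h"] by simp
lemma I_sym: "f - g \<in> I \<Longrightarrow> g - f \<in> I"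
  using I_uminus[of "f - g"] by simp

lemma Coh_0[simp]: "0 \<in> Coh" by (simp add: Coh_def)
lemma Coh_1[simp]: "1 \<in> Coh" by (simp add: Coh_def)
lemma Coh_of_int[simp]: "of_int c \<in> Coh" by (simp add: Coh_def)
lemma Coh_numeral[simp]: "numeral c \<in> Coh" by (simp add: Coh_def)
lemma Coh_add[intro,simp]: "f \<in> Coh \<Longrightarrow> g \<in> Coh \<Longrightarrow> f + g \<in> Coh"
proof -
  assume a: "f \<in> Coh" "g \<in> Coh"
  show ?thesis unfolding Coh_def mem_Collect_eq
  proof
    fix k
    have "p^k dvd (f (Suc k) - f k) + (g (Suc k) - g k)" using a by (auto simp: Coh_def)
    then show "p ^ k dvd (f + g) (Suc k) - (f + g) k" by (simp add: algebra_simps)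
  qed
qed
lemma Coh_uminus[intro,simp]: "f \<in> Coh \<Longrightarrow> - f \<in> Coh"
proof -
  assume a: "f \<in> Coh"
  show ?thesis unfolding Coh_def mem_Collect_eq
  proof
    fix k
    have "p^k dvd (f (Suc k) - f k)" using a unfolding Coh_def by blast
    then show "p ^ k dvd (- f) (Suc k) - (- f) k" by (simp add: dvd_diff_commute)
  qed
qed
lemma Coh_diff[intro,simp]: "f \<in> Coh \<Longrightarrow> g \<in> Coh \<Longrightarrow> f - g \<in> Coh"
  using Coh_add[of f "-g"] by simp
lemma Coh_mult[intro,simp]: "f \<in> Coh \<Longrightarrow> g \<in> Coh \<Longrightarrow> f * g \<in> Coh"
proof -
  assume a: "f \<in> Coh" "g \<in> Coh"
  show ?thesis unfolding Coh_def mem_Collect_eq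
  proof
    fix k
    have "p^k dvd f (Suc k) * (g (Suc k) - g k) + (f (Suc k) - f k) * g k" using a by (auto simp: Coh_def)
    then show "p ^ k dvd (f * g) (Suc k) - (f * g) k" by (simp add: algebra_simps)
  qed
qed
lemma Coh_sum[intro]: "(\<And>x. x \<in> A \<Longrightarrow> f x \<in> Coh) \<Longrightarrow> sum f A \<in> Coh"
  by (induction A rule: infinite_finite_induct) auto
lemma Coh_prod[intro]: "(\<And>x. x \<in> A \<Longrightarrow> f x \<in> Coh) \<Longrightarrow> prod f A \<in> Coh"
  by (induction A rule: infinite_finite_induct) auto
lemma Coh_power[intro,simp]: "f \<in> Coh \<Longrightarrow> f ^ n \<in> Coh"
  by (induction n) auto

lemma Coh_le: assumes "f \<in> Coh" "j \<le> k" shows "p ^ j dvd f k - f j"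
  using assms(2)
proof (induction k)
  case 0 then show ?case by simp
next
  case (Suc k)
  show ?case
  proof (cases "j = Suc k")
    case False
    then have "j \<le> k" using Suc by simp
    then have 1: "p^j dvd f k - f j" using Suc by simp
    have "p^k dvd f (Suc k) - f k" using assms(1) by (simp add: Coh_def)
    then have "p^j dvd f (Suc k) - f k" using \<open>j \<le> k\<close> by (meson dvd_trans le_imp_power_dvd)
    then have "p^j dvd (f (Suc k) - f k) + (f k - f j)" using 1 by (rule dvd_add)
    then show ?thesis by simp
  qed simp
qed

lemma reduce_eq_iff: "reduce f = reduce g \<longleftrightarrow> f - g \<in> I"
proof
  assume "reduce f = reduce g"
  then have "\<forall>k. f k mod p^k = g k mod p^k" unfolding reduce_def by meson
  then show "f - g \<in> I" unfolding I_def by (simp add: mod_eq_dvd_iff)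
next
  assume "f - g \<in> I"
  then show "reduce f = reduce g" unfolding I_def reduce_def by (auto simp: mod_eq_dvd_iff)
qed

lemma reduce_I: "reduce f - f \<in> I"
  unfolding I_def reduce_def by (auto simp: mod_eq_dvd_iff[symmetric])

lemma reduce_Coh: "f \<in> Coh \<Longrightarrow> reduce f \<in> Zp p"
  unfolding Zp_def reduce_def
proof (intro CollectI allI)
  fix k assume "f \<in> Coh"
  then have "p^k dvd f (Suc k) - f k" by (simp add: Coh_def)
  then have "f (Suc k) mod p^k = f k mod p^k" by (simp add: mod_eq_dvd_iff)
  moreover have "f (Suc k) mod p ^ Suc k mod p ^ k = f (Suc k) mod p^k"
    by (simp add: mod_mod_cancel)
  ultimately show "f k mod p ^ k = f (Suc k) mod p ^ Suc k mod p ^ k" by simp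
qed

lemma Zp_D: "x \<in> Zp p \<Longrightarrow> x k = x (Suc k) mod p^k"
  unfolding Zp_def by blast

lemma Zp_reduce: "x \<in> Zp p \<Longrightarrow> reduce x = x"
proof
  fix k assume "x \<in> Zp p"
  then have "x k = x (Suc k) mod p^k" by (rule Zp_D)
  then show "reduce x k = x k" by (simp add: reduce_def)
qed

lemma Zp_Coh: "x \<in> Zp p \<Longrightarrow> x \<in> Coh"
proof -
  assume a: "x \<in> Zp p"
  show ?thesis unfolding Coh_def mem_Collect_eq
  proof
    fix k
    have "x k = x (Suc k) mod p^k" using a by (rule Zp_D)
    then show "p ^ k dvd x (Suc k) - x k" by (metis mod_mod_trivial mod_eq_dvd_iff)
  qed
qed

lemma reduce_zero_iff: "reduce f = zp_zero \<longleftrightarrow> f \<in> I"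
  using reduce_eq_iff[of f 0] by (simp add: reduce_def zp_zero_def fun_eq_iff)

lemma Zp_eq_iff: "x \<in> Zp p \<Longrightarrow> y \<in> Zp p \<Longrightarrow> x = y \<longleftrightarrow> x - y \<in> I"
  using reduce_eq_iff[of x y] Zp_reduce by auto

end

lemma dvd_diffD1: "(c::int) dvd a - b \<Longrightarrow> c dvd b \<Longrightarrow> c dvd a"
  using dvd_add[of c "a - b" b] by simp
lemma dvd_diffD2: "(c::int) dvd a - b \<Longrightarrow> c dvd a \<Longrightarrow> c dvd b"
  using dvd_diff[of c a "a - b"] by simp

context padic
begin

definition unit :: "R \<Rightarrow> bool" where "unit u \<longleftrightarrow> u \<in> Coh \<and> \<not> p dvd u 1"

lemma unit_lvl: assumes "unit u" "k \<ge> 1" shows "\<not> p dvd u k"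
proof
  assume a: "p dvd u k"
  have "p^1 dvd u k - u 1" using Coh_le[of u 1 k] assms unfolding unit_def by auto
  then have "p dvd u k - u 1" by simp
  then have "p dvd u 1" using a by (rule dvd_diffD2)
  then show False using assms unfolding unit_def by simp
qed

lemma unit_coprime: assumes "unit u" shows "coprime (u k) (p^k)"
proof (cases "k = 0")
  case True then show ?thesis by simp
next
  case False
  then have "\<not> p dvd u k" using unit_lvl[OF assms] by simp
  then have "coprime p (u k)" using pr prime_imp_coprime by blast
  then show ?thesis by (simp add: coprime_commute)
qed

definition uinv :: "R \<Rightarrow> R" where "uinv u = (\<lambda>k. fst (bezout_coefficients (u k) (p^k)))"

lemma uinv_lvl: assumes "unit u" shows "p^k dvd uinv u k * u k - 1"
proof -
  have "fst (bezout_coefficients (u k) (p^k)) * u k + snd (bezout_coefficients (u k) (p^k)) * p^k = 1"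
    using bezout_coefficients_fst_snd[of "u k" "p^k"] unit_coprime[OF assms, of k] by simp
  then have "uinv u k * u k - 1 = - (snd (bezout_coefficients (u k) (p^k)) * p^k)"
    unfolding uinv_def by (simp add: algebra_simps)
  then show ?thesis by simp
qed

lemma unit_inv: assumes "unit u" shows "u * uinv u - 1 \<in> I"
  unfolding I_def using uinv_lvl[OF assms] by (simp add: mult.commute)

lemma unit_Coh: "unit u \<Longrightarrow> u \<in> Coh" by (simp add: unit_def)

lemma uinv_Coh: assumes "unit u" shows "uinv u \<in> Coh"
  unfolding Coh_def mem_Collect_eq
proof
  fix k
  let ?y = "uinv u"
  have a: "p^k dvd ?y k * u k - 1" using uinv_lvl[OF assms] .
  have "p^(Suc k) dvd ?y (Suc k) * u (Suc k) - 1" using uinv_lvl[OF assms] .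
  then have b: "p^k dvd ?y (Suc k) * u (Suc k) - 1" by (metis dvd_mult_right power_Suc)
  have c: "p^k dvd u (Suc k) - u k" using unit_Coh[OF assms] unfolding Coh_def by blast
  have "p^k dvd (?y (Suc k) * u (Suc k) - 1) - (?y k * u k - 1) - ?y (Suc k) * (u (Suc k) - u k)"
    using dvd_diff[OF dvd_diff[OF b a] dvd_mult[OF c]] .
  moreover have "(?y (Suc k) * u (Suc k) - 1) - (?y k * u k - 1) - ?y (Suc k) * (u (Suc k) - u k)
     = (?y (Suc k) - ?y k) * u k" by (simp add: algebra_simps)
  ultimately have "p^k dvd (?y (Suc k) - ?y k) * u k" by simp
  moreover have "coprime (p^k) (u k)" using unit_coprime[OF assms] by (simp add: coprime_commute)
  ultimately show "p ^ k dvd ?y (Suc k) - ?y k" using coprime_dvd_mult_left_iff by blast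
qed

lemma unit_cancel: assumes "unit u" "u * f \<in> I" shows "f \<in> I"
proof -
  have "f = uinv u * (u * f) - (u * uinv u - 1) * f" by (simp add: algebra_simps)
  moreover have "uinv u * (u * f) \<in> I" using assms by auto
  moreover have "(u * uinv u - 1) * f \<in> I" using unit_inv[OF assms(1)] by auto
  ultimately show ?thesis by (metis I_diff)
qed

lemma unit_of_inv: assumes "u \<in> Coh" "w \<in> Coh" "u * w - 1 \<in> I" shows "unit u"
  unfolding unit_def
proof (intro conjI notI)
  show "u \<in> Coh" by fact
  assume "p dvd u 1"
  moreover have "p^1 dvd (u * w - 1) 1" using assms(3) unfolding I_def by blast
  then have "p^1 dvd u 1 * w 1 - 1" by simp
  ultimately have "p dvd 1" using dvd_diffD2[of p "u 1 * w 1" 1] by simp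
  then show False using pr by (simp add: prime_int_iff)
qed

lemma divp: assumes "f \<in> Coh" "p dvd f 1" shows "\<exists>h\<in>Coh. f - of_int p * h \<in> I"
proof -
  have d: "p dvd f (Suc k)" for k
  proof -
    have "p^1 dvd f (Suc k) - f 1" using Coh_le[OF assms(1), of 1 "Suc k"] by simp
    then have "p dvd f (Suc k) - f 1" by simp
    then show ?thesis using assms(2) by (rule dvd_diffD1)
  qed
  define h where "h = (\<lambda>k. f (Suc k) div p)"
  have fh: "f (Suc k) = p * h k" for k unfolding h_def using d by simp
  have "h \<in> Coh" unfolding Coh_def mem_Collect_eq
  proof
    fix k
    have "p^(Suc k) dvd f (Suc (Suc k)) - f (Suc k)" using assms(1) unfolding Coh_def by blast
    then have "p * p^k dvd p * (h (Suc k) - h k)" by (simp add: fh algebra_simps)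
    then show "p ^ k dvd h (Suc k) - h k" using p_pos by simp
  qed
  moreover have "f - of_int p * h \<in> I" unfolding I_def
  proof (intro CollectI allI)
    fix k
    have "p^k dvd f (Suc k) - f k" using assms(1) unfolding Coh_def by blast
    then have "p^k dvd f k - f (Suc k)" by (subst dvd_diff_commute)
    moreover have "(f - of_int p * h) k = f k - f (Suc k)" by (simp add: fh)
    ultimately show "p ^ k dvd (f - of_int p * h) k" by simp
  qed
  ultimately show ?thesis by blast
qed

lemma cancel_p: assumes "f \<in> Coh" "of_int p * f \<in> I" shows "f \<in> I"
  unfolding I_def
proof (intro CollectI allI)
  fix k
  have "p^(Suc k) dvd (of_int p * f) (Suc k)" using assms(2) unfolding I_def by blast
  then have "p^(Suc k) dvd p * f (Suc k)" by simp
  then have a: "p^k dvd f (Suc k)" using p_pos by simp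
  have "p^k dvd f (Suc k) - f k" using assms(1) unfolding Coh_def by blast
  then show "p^k dvd f k" using a by (rule dvd_diffD2)
qed

text \<open>For odd p, 2 is a unit; together with cancel_p this makes 2 and 4 cancellable for every p.\<close>
lemma two_unit: "p \<noteq> 2 \<Longrightarrow> unit 2"
proof -
  assume a: "p \<noteq> 2"
  have "\<not> p dvd 2"
  proof
    assume "p dvd 2"
    then have "p \<le> 2" by (simp add: zdvd_imp_le)
    then show False using a p_gt1 by simp
  qed
  then show ?thesis unfolding unit_def by simp
qed

lemma cancel2: assumes "f \<in> Coh" "2 * f \<in> I" shows "f \<in> I"
proof (cases "p = 2")
  case True
  then show ?thesis using cancel_p[OF assms(1)] assms(2) by simp
next
  case False
  then show ?thesis using unit_cancel[OF two_unit] assms by blast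
qed

lemma cancel4: assumes "f \<in> Coh" "4 * f \<in> I" shows "f \<in> I"
proof -
  have "2 * (2 * f) \<in> I" using assms(2) by (simp add: mult.assoc[symmetric])
  then have "2 * f \<in> I" using cancel2 assms(1) by auto
  then show ?thesis using cancel2 assms(1) by auto
qed

lemma half: assumes "f \<in> Coh" "p = 2 \<Longrightarrow> 2 dvd f 1" shows "\<exists>h\<in>Coh. f - 2 * h \<in> I"
proof (cases "p = 2")
  case True
  then show ?thesis using divp[OF assms(1)] assms(2) by simp
next
  case False
  have u: "unit 2" using two_unit[OF False] .
  have "f - 2 * (uinv 2 * f) = - ((2 * uinv 2 - 1) * f)" by (simp add: algebra_simps)
  moreover have "(2 * uinv 2 - 1) * f \<in> I" using unit_inv[OF u] by auto
  ultimately have "f - 2 * (uinv 2 * f) \<in> I" by auto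
  moreover have "uinv 2 * f \<in> Coh" using uinv_Coh[OF u] assms(1) by auto
  ultimately show ?thesis by blast
qed

text \<open>The valuation of a non-null coherent sequence: the largest v such that p^v divides it,
  read off at level v+1.\<close>
definition val :: "R \<Rightarrow> nat" where "val f = (LEAST k. \<not> p^(Suc k) dvd f (Suc k))"

lemma zp_val_reduce: "zp_val (reduce f) = val f"
  unfolding zp_val_def val_def reduce_def using pk_pos
  by (simp add: dvd_eq_mod_eq_0)

lemma val_cong: assumes "f - g \<in> I" shows "val f = val g"
  using reduce_eq_iff[of f g] assms zp_val_reduce by metis

lemma val_eq: assumes "\<not> p^(Suc v) dvd f (Suc v)" "\<And>j. j < v \<Longrightarrow> p^(Suc j) dvd f (Suc j)"
  shows "val f = v"
  unfolding val_def
  by (rule Least_equality) (use assms in \<open>auto simp: not_less[symmetric]\<close>)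

lemma notI_ex: assumes "f \<notin> I" shows "\<exists>k. \<not> p^(Suc k) dvd f (Suc k)"
proof -
  obtain k where k: "\<not> p^k dvd f k" using assms unfolding I_def by auto
  then have "k \<noteq> 0" by (cases k) auto
  then obtain j where "k = Suc j" using not0_implies_Suc by blast
  then show ?thesis using k by blast
qed

lemma val_props: assumes "f \<in> Coh" "f \<notin> I"
  shows "\<not> p^(Suc (val f)) dvd f (Suc (val f))"
    "\<And>k. k \<le> val f \<Longrightarrow> p^k dvd f k"
    "\<And>k. k > val f \<Longrightarrow> p^(val f) dvd f k \<and> \<not> p^(Suc (val f)) dvd f k"
proof -
  let ?v = "val f"
  show a: "\<not> p^(Suc ?v) dvd f (Suc ?v)" unfolding val_def using notI_ex[OF assms(2)] by (rule LeastI_ex)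
  have b: "p^(Suc j) dvd f (Suc j)" if "j < ?v" for j
    using not_less_Least[of j "\<lambda>k. \<not> p^(Suc k) dvd f (Suc k)"] that unfolding val_def by blast
  show c: "p^k dvd f k" if "k \<le> ?v" for k
  proof (cases k)
    case (Suc j) then show ?thesis using b[of j] that by simp
  qed simp
  fix k assume k: "k > ?v"
  have "p^(Suc ?v) dvd f k - f (Suc ?v)" using Coh_le[OF assms(1), of "Suc ?v" k] k by simp
  then have 1: "\<not> p^(Suc ?v) dvd f k" using a dvd_diffD2 by blast
  have "p^?v dvd f k - f ?v" using Coh_le[OF assms(1), of ?v k] k by simp
  moreover have "p^?v dvd f ?v" using c by simp
  ultimately have "p^?v dvd f k" by (rule dvd_diffD1)
  then show "p^?v dvd f k \<and> \<not> p^(Suc ?v) dvd f k" using 1 by simp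
qed

lemma val_mult_top: assumes "f \<in> Coh" "f \<notin> I" "g \<in> Coh" "g \<notin> I"
  shows "\<not> p^(Suc (val f + val g)) dvd (f * g) (Suc (val f + val g))"
proof
  let ?a = "val f" and ?b = "val g"
  let ?K = "Suc (?a + ?b)"
  have fK: "p^?a dvd f ?K" "\<not> p^(Suc ?a) dvd f ?K" using val_props(3)[OF assms(1,2), of ?K] by auto
  have gK: "p^?b dvd g ?K" "\<not> p^(Suc ?b) dvd g ?K" using val_props(3)[OF assms(3,4), of ?K] by auto
  obtain x where x: "f ?K = p^?a * x" using fK(1) by blast
  obtain y where y: "g ?K = p^?b * y" using gK(1) by blast
  have nx: "\<not> p dvd x" using fK(2) x p_pos by (auto simp: mult_dvd_mono)
  have ny: "\<not> p dvd y" using gK(2) y p_pos by (auto simp: mult_dvd_mono)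
  have nxy: "\<not> p dvd x * y" using nx ny pr by (simp add: prime_dvd_mult_iff)
  have fgK: "(f * g) ?K = p^(?a + ?b) * (x * y)" using x y by (simp add: power_add algebra_simps)
  assume "p^?K dvd (f * g) ?K"
  then have "p^(?a+?b) * p dvd p^(?a + ?b) * (x * y)" using fgK by (simp add: mult.commute)
  then show False using nxy p_pos by simp
qed

lemma val_mult: assumes "f \<in> Coh" "f \<notin> I" "g \<in> Coh" "g \<notin> I"
  shows "f * g \<notin> I" "val (f * g) = val f + val g"
proof -
  let ?a = "val f" and ?b = "val g"
  note K = val_mult_top[OF assms]
  then show "f * g \<notin> I" unfolding I_def by blast
  have lv: "p^(min l ?a) dvd f l" for l
  proof (cases "l \<le> ?a")
    case True then show ?thesis using val_props(2)[OF assms(1,2)] by simp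
  next
    case False then show ?thesis using val_props(3)[OF assms(1,2), of l] by simp
  qed
  have lw: "p^(min l ?b) dvd g l" for l
  proof (cases "l \<le> ?b")
    case True then show ?thesis using val_props(2)[OF assms(3,4)] by simp
  next
    case False then show ?thesis using val_props(3)[OF assms(3,4), of l] by simp
  qed
  show "val (f * g) = ?a + ?b"
  proof (rule val_eq)
    show "\<not> p ^ Suc (?a + ?b) dvd (f * g) (Suc (?a + ?b))" using K .
    fix j assume j: "j < ?a + ?b"
    have "p^(min (Suc j) ?a) * p^(min (Suc j) ?b) dvd f (Suc j) * g (Suc j)"
      using lv lw by (rule mult_dvd_mono)
    then have A: "p^(min (Suc j) ?a + min (Suc j) ?b) dvd (f * g) (Suc j)"
      by (simp add: power_add)
    have "Suc j \<le> min (Suc j) ?a + min (Suc j) ?b" using j by simp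
    then have "p^(Suc j) dvd p^(min (Suc j) ?a + min (Suc j) ?b)" by (rule le_imp_power_dvd)
    then show "p^(Suc j) dvd (f * g) (Suc j)" using A by (rule dvd_trans)
  qed
qed

lemma unit_notI: assumes "unit u" shows "u \<notin> I"
proof
  assume "u \<in> I"
  then have "p^1 dvd u 1" unfolding I_def by blast
  then show False using assms unfolding unit_def by simp
qed

lemma val_unit: "unit u \<Longrightarrow> val u = 0"
  by (rule val_eq) (auto simp: unit_def)

lemma val_unit_mult: assumes "unit u" "f \<in> Coh" "f \<notin> I" shows "val (u * f) = val f" "u * f \<notin> I"
  using val_mult[of u f] assms unit_notI val_unit unit_Coh by auto

lemma not_psuc_dvd: "\<not> p^(Suc i) dvd p^i"
proof
  assume "p^(Suc i) dvd p^i"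
  then have "p^i * p dvd p^i * 1" by (simp add: power_Suc2)
  then have "p dvd 1" using p_pos by (subst (asm) dvd_mult_cancel_left) auto
  then show False using p_gt1 by (simp add: zdvd_imp_le)
qed

lemma ppow_apply: "(of_int p ^ i :: R) k = p ^ i" by (simp add: power_fun_apply)

lemma val_ppow: "val (of_int p ^ i) = i"
proof (rule val_eq)
  show "\<not> p ^ Suc i dvd (of_int p ^ i :: R) (Suc i)" using not_psuc_dvd unfolding ppow_apply .
  fix j assume "j < i"
  then have "Suc j \<le> i" by simp
  then show "p ^ Suc j dvd (of_int p ^ i :: R) (Suc j)" unfolding ppow_apply by (rule le_imp_power_dvd)
qed

lemma ppow_Coh: "(of_int p ^ i :: R) \<in> Coh" by auto
lemma ppow_notI: "(of_int p ^ i :: R) \<notin> I"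
proof
  assume "(of_int p ^ i :: R) \<in> I"
  then have "p^(Suc i) dvd (of_int p ^ i :: R) (Suc i)" unfolding I_def by blast
  then show False using not_psuc_dvd unfolding ppow_apply by blast
qed

lemma domain: "f \<in> Coh \<Longrightarrow> g \<in> Coh \<Longrightarrow> f * g \<in> I \<Longrightarrow> f \<notin> I \<Longrightarrow> g \<in> I"
  using val_mult by blast

end

section \<open>Matrices over sequences\<close>

text \<open>Matrices are functions nat => nat => R, only their n x n block matters.  The
  operations below are the exact (unreduced) ring operations: product mm over the
  index range below n, transpose tr, identity idm, scalar multiple sm, the rank-one
  matrix out v w = ^t v w, row-times-matrix vm and matrix-times-column mv, and the
  bordered matrix bk a v w X = [[a, v], [^t w, X]] of size n+1.\<close>
definition mm :: "nat \<Rightarrow> fm \<Rightarrow> fm \<Rightarrow> fm" where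
  "mm n A B = (\<lambda>i j. \<Sum>l<n. A i l * B l j)"
definition tr :: "fm \<Rightarrow> fm" where "tr A = (\<lambda>i j. A j i)"
definition idm :: fm where "idm = (\<lambda>i j. if i = j then 1 else 0)"
definition sm :: "R \<Rightarrow> fm \<Rightarrow> fm" where "sm c A = (\<lambda>i j. c * A i j)"
definition out :: "(nat \<Rightarrow> R) \<Rightarrow> (nat \<Rightarrow> R) \<Rightarrow> fm" where "out v w = (\<lambda>i j. v i * w j)"
definition vm :: "nat \<Rightarrow> (nat \<Rightarrow> R) \<Rightarrow> fm \<Rightarrow> nat \<Rightarrow> R" where
  "vm n v A = (\<lambda>j. \<Sum>l<n. v l * A l j)"
definition mv :: "nat \<Rightarrow> fm \<Rightarrow> (nat \<Rightarrow> R) \<Rightarrow> nat \<Rightarrow> R" where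
  "mv n A w = (\<lambda>i. \<Sum>l<n. A i l * w l)"
definition bk :: "R \<Rightarrow> (nat \<Rightarrow> R) \<Rightarrow> (nat \<Rightarrow> R) \<Rightarrow> fm \<Rightarrow> fm" where
  "bk a v w X = (\<lambda>i j. if i = 0 then (if j = 0 then a else v (j - 1))
                       else (if j = 0 then w (i - 1) else X (i - 1) (j - 1)))"
definition zv :: "nat \<Rightarrow> R" where "zv = (\<lambda>_. 0)"

lemma fm_plus_apply[simp]: "((A::fm) + B) i j = A i j + B i j" by simp
lemma fm_minus_apply[simp]: "((A::fm) - B) i j = A i j - B i j" by simp
lemma R_eta_plus[simp]: "(\<lambda>a. (f::R) a + g a) = f + g" by (simp add: plus_fun_def)
lemma R_eta_minus[simp]: "(\<lambda>a. (f::R) a - g a) = f - g" by (simp add: fun_diff_def)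
lemma R_eta_times[simp]: "(\<lambda>a. (f::R) a * g a) = f * g" by (simp add: times_fun_def)

lemma fmext: "(\<And>i j. A i j = B i j) \<Longrightarrow> (A::fm) = B"
  by (rule ext, rule ext) simp

lemma bk_00[simp]: "bk a v w X 0 0 = a" by (simp add: bk_def)
lemma bk_0S[simp]: "bk a v w X 0 (Suc j) = v j" by (simp add: bk_def)
lemma bk_S0[simp]: "bk a v w X (Suc i) 0 = w i" by (simp add: bk_def)
lemma bk_SS[simp]: "bk a v w X (Suc i) (Suc j) = X i j" by (simp add: bk_def)
lemma zv_apply[simp]: "zv i = 0" by (simp add: zv_def)
lemma tr_apply[simp]: "tr A i j = A j i" by (simp add: tr_def)
lemma sm_apply[simp]: "sm c A i j = c * A i j" by (simp add: sm_def)
lemma out_apply[simp]: "out v w i j = v i * w j" by (simp add: out_def)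

lemma bk_decomp: "A = bk (A 0 0) (\<lambda>j. A 0 (Suc j)) (\<lambda>i. A (Suc i) 0) (\<lambda>i j. A (Suc i) (Suc j))"
  by (rule fmext) (auto simp: bk_def)

lemma mm_assoc: "mm n (mm n A B) C = mm n A (mm n B C)"
  unfolding mm_def
  by (rule fmext) (auto simp: sum_distrib_left sum_distrib_right mult.assoc intro: sum.swap)

lemma mm_add_l: "mm n (A + B) C = mm n A C + mm n B C"
  unfolding mm_def by (rule fmext) (auto simp: algebra_simps sum.distrib)
lemma mm_add_r: "mm n A (B + C) = mm n A B + mm n A C"
  unfolding mm_def by (rule fmext) (auto simp: algebra_simps sum.distrib)
lemma mm_diff_l: "mm n (A - B) C = mm n A C - mm n B C"
  unfolding mm_def by (rule fmext) (auto simp: algebra_simps sum_subtractf)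
lemma mm_diff_r: "mm n A (B - C) = mm n A B - mm n A C"
  unfolding mm_def by (rule fmext) (auto simp: algebra_simps sum_subtractf)
lemma mm_sm_l: "mm n (sm c A) B = sm c (mm n A B)"
  unfolding mm_def by (rule fmext) (auto simp: sum_distrib_left mult.assoc)
lemma mm_sm_r: "mm n A (sm c B) = sm c (mm n A B)"
  unfolding mm_def by (rule fmext) (auto simp: sum_distrib_left mult.assoc mult.left_commute)
lemma tr_mm: "tr (mm n A B) = mm n (tr B) (tr A)"
  unfolding mm_def by (rule fmext) (auto simp: mult.commute)
lemma tr_tr[simp]: "tr (tr A) = A" by (simp add: tr_def)
lemma tr_diff: "tr (A - B) = tr A - tr B" by (rule fmext) simp
lemma tr_sm: "tr (sm c A) = sm c (tr A)" by (rule fmext) simp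
lemma tr_out: "tr (out v w) = out w v" by (rule fmext) simp
lemma tr_bk: "tr (bk a v w X) = bk a w v (tr X)" by (rule fmext) (simp add: bk_def)
lemma tr_idm[simp]: "tr idm = idm" by (rule fmext) (auto simp: idm_def)

lemma mm_out_l: "mm n (out v w) A = out v (vm n w A)"
  unfolding mm_def vm_def by (rule fmext) (auto simp: sum_distrib_left mult.assoc)
lemma mm_out_r: "mm n A (out v w) = out (mv n A v) w"
  unfolding mm_def mv_def by (rule fmext) (auto simp: sum_distrib_right mult.assoc)

lemma mm_idm_l: "i < n \<Longrightarrow> mm n idm A i j = A i j"
  unfolding mm_def idm_def by (simp add: if_distrib[of "\<lambda>x. x * _"] cong: if_cong)
lemma mm_idm_r: "j < n \<Longrightarrow> mm n A idm i j = A i j"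
  unfolding mm_def idm_def by (simp add: if_distrib[of "\<lambda>x. _ * x"] cong: if_cong)

lemma mm_bk: "mm (Suc n) (bk a v w X) (bk a' v' w' X') =
  bk (a * a' + (\<Sum>l<n. v l * w' l)) (\<lambda>j. a * v' j + vm n v X' j)
     (\<lambda>i. w i * a' + mv n X w' i) (\<lambda>i j. w i * v' j + mm n X X' i j)"
proof (rule fmext)
  fix i j
  show "mm (Suc n) (bk a v w X) (bk a' v' w' X') i j = bk (a * a' + (\<Sum>l<n. v l * w' l)) (\<lambda>j. a * v' j + vm n v X' j)
     (\<lambda>i. w i * a' + mv n X w' i) (\<lambda>i j. w i * v' j + mm n X X' i j) i j"
  proof (cases i)
    case 0
    then show ?thesis
    proof (cases j)
      case 0
      then show ?thesis using \<open>i = 0\<close> by (simp only: mm_def sum.lessThan_Suc_shift bk_00 bk_0S bk_S0)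
    next
      case (Suc j')
      then show ?thesis using \<open>i = 0\<close> by (simp only: mm_def sum.lessThan_Suc_shift bk_00 bk_0S bk_SS vm_def)
    qed
  next
    case (Suc i')
    then show ?thesis
    proof (cases j)
      case 0
      then show ?thesis using \<open>i = Suc i'\<close> by (simp only: mm_def sum.lessThan_Suc_shift bk_00 bk_S0 bk_SS mv_def)
    next
      case (Suc j')
      then show ?thesis using \<open>i = Suc i'\<close> by (simp only: mm_def sum.lessThan_Suc_shift bk_S0 bk_0S bk_SS)
    qed
  qed
qed

context padic
begin

definition eqm :: "nat \<Rightarrow> fm \<Rightarrow> fm \<Rightarrow> bool" where
  "eqm n A B \<longleftrightarrow> (\<forall>i<n. \<forall>j<n. A i j - B i j \<in> I)"
definition cm :: "nat \<Rightarrow> fm \<Rightarrow> bool" where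
  "cm n A \<longleftrightarrow> (\<forall>i<n. \<forall>j<n. A i j \<in> Coh)"
definition cv :: "nat \<Rightarrow> (nat \<Rightarrow> R) \<Rightarrow> bool" where
  "cv n v \<longleftrightarrow> (\<forall>i<n. v i \<in> Coh)"
definition eqv :: "nat \<Rightarrow> (nat \<Rightarrow> R) \<Rightarrow> (nat \<Rightarrow> R) \<Rightarrow> bool" where
  "eqv n v w \<longleftrightarrow> (\<forall>i<n. v i - w i \<in> I)"

lemma eqmI: "(\<And>i j. i < n \<Longrightarrow> j < n \<Longrightarrow> A i j - B i j \<in> I) \<Longrightarrow> eqm n A B"
  unfolding eqm_def by blast
lemma eqmD: "eqm n A B \<Longrightarrow> i < n \<Longrightarrow> j < n \<Longrightarrow> A i j - B i j \<in> I"
  unfolding eqm_def by blast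
lemma eqm_exact: "(\<And>i j. i < n \<Longrightarrow> j < n \<Longrightarrow> A i j = B i j) \<Longrightarrow> eqm n A B"
  unfolding eqm_def by simp
lemma eqm_refl[simp]: "eqm n A A" unfolding eqm_def by simp
lemma eqm_sym: "eqm n A B \<Longrightarrow> eqm n B A" unfolding eqm_def using I_sym by blast
lemma eqm_trans[trans]: "eqm n A B \<Longrightarrow> eqm n B C \<Longrightarrow> eqm n A C" unfolding eqm_def using I_trans by blast

lemma eqm_add: assumes "eqm n A A'" "eqm n B B'" shows "eqm n (A + B) (A' + B')"
proof (rule eqmI)
  fix i j assume "i < n" "j < n"
  then have "(A i j - A' i j) + (B i j - B' i j) \<in> I" using assms by (auto dest: eqmD)
  then show "(A + B) i j - (A' + B') i j \<in> I" by (simp add: algebra_simps)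
qed
lemma eqm_diff: assumes "eqm n A A'" "eqm n B B'" shows "eqm n (A - B) (A' - B')"
proof (rule eqmI)
  fix i j assume "i < n" "j < n"
  then have "(A i j - A' i j) - (B i j - B' i j) \<in> I" using assms by (auto dest: eqmD)
  then show "(A - B) i j - (A' - B') i j \<in> I" by (simp add: algebra_simps)
qed
lemma eqm_sm: assumes "eqm n A A'" shows "eqm n (sm c A) (sm c A')"
proof (rule eqmI)
  fix i j assume "i < n" "j < n"
  then have "c * (A i j - A' i j) \<in> I" using assms by (auto dest: eqmD)
  then show "sm c A i j - sm c A' i j \<in> I" by (simp add: algebra_simps)
qed
lemma eqm_sm2: assumes "c - c' \<in> I" shows "eqm n (sm c A) (sm c' A)"
proof (rule eqmI)
  fix i j
  have "(c - c') * A i j \<in> I" using assms by auto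
  then show "sm c A i j - sm c' A i j \<in> I" by (simp add: algebra_simps)
qed
lemma eqm_tr: "eqm n A A' \<Longrightarrow> eqm n (tr A) (tr A')"
  unfolding eqm_def by simp
lemma eqm_mm: assumes "eqm n A A'" "eqm n B B'" shows "eqm n (mm n A B) (mm n A' B')"
proof (rule eqmI)
  fix i j assume ij: "i < n" "j < n"
  have "mm n A B i j - mm n A' B' i j = (\<Sum>l<n. A i l * (B l j - B' l j) + (A i l - A' i l) * B' l j)"
    unfolding mm_def by (simp add: sum_subtractf[symmetric] algebra_simps)
  also have "\<dots> \<in> I" using assms ij by (intro I_sum) (auto dest: eqmD)
  finally show "mm n A B i j - mm n A' B' i j \<in> I" .
qed

lemma cmI: "(\<And>i j. i < n \<Longrightarrow> j < n \<Longrightarrow> A i j \<in> Coh) \<Longrightarrow> cm n A" unfolding cm_def by blast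
lemma cmD: "cm n A \<Longrightarrow> i < n \<Longrightarrow> j < n \<Longrightarrow> A i j \<in> Coh" unfolding cm_def by blast
lemma cvD: "cv n v \<Longrightarrow> i < n \<Longrightarrow> v i \<in> Coh" unfolding cv_def by blast
lemma cm_add[intro]: "cm n A \<Longrightarrow> cm n B \<Longrightarrow> cm n (A + B)" unfolding cm_def by auto
lemma cm_diff[intro]: "cm n A \<Longrightarrow> cm n B \<Longrightarrow> cm n (A - B)" unfolding cm_def by auto
lemma cm_sm[intro]: "c \<in> Coh \<Longrightarrow> cm n A \<Longrightarrow> cm n (sm c A)" unfolding cm_def by auto
lemma cm_tr[intro]: "cm n A \<Longrightarrow> cm n (tr A)" unfolding cm_def by auto
lemma cm_idm[intro,simp]: "cm n idm" unfolding cm_def idm_def by auto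
lemma cm_out[intro]: "cv n v \<Longrightarrow> cv n w \<Longrightarrow> cm n (out v w)" unfolding cm_def cv_def by auto
lemma cm_mm[intro]: "cm n A \<Longrightarrow> cm n B \<Longrightarrow> cm n (mm n A B)"
  unfolding cm_def mm_def by (auto intro!: Coh_sum)
lemma cv_vm[intro]: "cv n v \<Longrightarrow> cm n A \<Longrightarrow> cv n (vm n v A)"
  unfolding cm_def cv_def vm_def by (auto intro!: Coh_sum)
lemma cv_uminus[intro]: "cv n v \<Longrightarrow> cv n (- v)" unfolding cv_def by auto
lemma cv_zv[intro,simp]: "cv n zv" unfolding cv_def by auto
lemma cm_bk[intro]: "a \<in> Coh \<Longrightarrow> cv n v \<Longrightarrow> cv n w \<Longrightarrow> cm n X \<Longrightarrow> cm (Suc n) (bk a v w X)"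
  unfolding cm_def cv_def bk_def by (auto split: nat.splits)
lemma cm_bk_parts: assumes "cm (Suc n) A"
  shows "A 0 0 \<in> Coh" "cv n (\<lambda>j. A 0 (Suc j))" "cv n (\<lambda>i. A (Suc i) 0)" "cm n (\<lambda>i j. A (Suc i) (Suc j))"
  using assms unfolding cm_def cv_def by auto

lemma eqm_bk: assumes "a - a' \<in> I" "eqv n v v'" "eqv n w w'" "eqm n X X'"
  shows "eqm (Suc n) (bk a v w X) (bk a' v' w' X')"
proof (rule eqmI)
  fix i j assume "i < Suc n" "j < Suc n"
  then show "bk a v w X i j - bk a' v' w' X' i j \<in> I"
    using assms unfolding eqv_def eqm_def by (cases i; cases j) auto
qed

lemma eqm_bkD: assumes "eqm (Suc n) (bk a v w X) (bk a' v' w' X')"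
  shows "a - a' \<in> I" "eqv n v v'" "eqv n w w'" "eqm n X X'"
proof -
  show "a - a' \<in> I" using eqmD[OF assms, of 0 0] by simp
  show "eqv n v v'" unfolding eqv_def using eqmD[OF assms, of 0 "Suc _"] by simp
  show "eqv n w w'" unfolding eqv_def using eqmD[OF assms, of "Suc _" 0] by simp
  show "eqm n X X'" unfolding eqm_def using eqmD[OF assms, of "Suc _" "Suc _"] by simp
qed

lemma eqv_refl[simp]: "eqv n v v" unfolding eqv_def by simp

end

section \<open>Determinants\<close>

definition fmat :: "nat \<Rightarrow> fm \<Rightarrow> R mat" where "fmat n A = mat n n (\<lambda>(i,j). A i j)"
definition detm :: "nat \<Rightarrow> fm \<Rightarrow> R" where "detm n A = det (fmat n A)"

lemma fmat_carrier[simp]: "fmat n A \<in> carrier_mat n n" by (simp add: fmat_def)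
lemma fmat_index[simp]: "i < n \<Longrightarrow> j < n \<Longrightarrow> fmat n A $$ (i,j) = A i j" by (simp add: fmat_def)

lemma fmat_mm: "fmat n (mm n A B) = fmat n A * fmat n B"
  by (rule eq_matI) (auto simp: fmat_def mm_def scalar_prod_def lessThan_atLeast0)

lemma detm_mm: "detm n (mm n A B) = detm n A * detm n B"
  unfolding detm_def fmat_mm by (rule det_mult[OF fmat_carrier fmat_carrier])

lemma fmat_tr: "fmat n (tr A) = transpose_mat (fmat n A)"
  by (rule eq_matI) (auto simp: fmat_def)

lemma detm_tr: "detm n (tr A) = detm n A"
  unfolding detm_def fmat_tr by (rule det_transpose[OF fmat_carrier])

lemma detm_leibniz: "detm n A = (\<Sum>\<sigma> \<in> {\<sigma>. \<sigma> permutes {0..<n}}. signof \<sigma> * (\<Prod>i=0..<n. A i (\<sigma> i)))"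
proof -
  have "detm n A = (\<Sum>\<sigma> \<in> {\<sigma>. \<sigma> permutes {0..<n}}. signof \<sigma> * (\<Prod>i=0..<n. fmat n A $$ (i, \<sigma> i)))"
    unfolding detm_def by (rule det_def') simp
  also have "\<dots> = (\<Sum>\<sigma> \<in> {\<sigma>. \<sigma> permutes {0..<n}}. signof \<sigma> * (\<Prod>i=0..<n. A i (\<sigma> i)))"
  proof (rule sum.cong[OF refl])
    fix \<sigma> assume "\<sigma> \<in> {\<sigma>. \<sigma> permutes {0..<n}}"
    then have "\<sigma> i < n" if "i < n" for i using that permutes_in_image by fastforce
    then show "signof \<sigma> * (\<Prod>i=0..<n. fmat n A $$ (i, \<sigma> i)) = signof \<sigma> * (\<Prod>i=0..<n. A i (\<sigma> i))"
      by (auto intro!: prod.cong)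
  qed
  finally show ?thesis .
qed

lemma detm_exact: "(\<And>i j. i < n \<Longrightarrow> j < n \<Longrightarrow> A i j = B i j) \<Longrightarrow> detm n A = detm n B"
  unfolding detm_def by (rule arg_cong[where f = det]) (rule eq_matI, auto simp: fmat_def)

lemma fmat_idm: "fmat n idm = 1\<^sub>m n" by (rule eq_matI) (auto simp: fmat_def idm_def)
lemma detm_idm[simp]: "detm n idm = 1" unfolding detm_def fmat_idm by simp

lemma fmat_bk: "fmat (Suc n) (bk a v zv X) =
  four_block_mat (mat 1 1 (\<lambda>_. a)) (mat 1 n (\<lambda>(_,j). v j)) (0\<^sub>m n 1) (fmat n X)"
  by (rule eq_matI) (auto simp: fmat_def bk_def four_block_mat_def Let_def)

lemma detm_bk: "detm (Suc n) (bk a v zv X) = a * detm n X"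
proof -
  have "detm (Suc n) (bk a v zv X) = det (mat 1 1 (\<lambda>_. a)) * det (fmat n X)"
    unfolding detm_def fmat_bk by (rule det_four_block_mat_lower_left_zero_col) auto
  moreover have "det (mat 1 1 (\<lambda>_. a)) = a" by (simp add: det_single)
  ultimately show ?thesis by (simp add: detm_def)
qed

lemma detm_diag: "detm n (\<lambda>i j. if i = j then d i else 0) = (\<Prod>i<n. d i)"
proof -
  have "detm n (\<lambda>i j. if i = j then d i else 0) = prod_list (diag_mat (fmat n (\<lambda>i j. if i = j then d i else 0)))"
    unfolding detm_def by (rule det_upper_triangular) (auto simp: upper_triangular_def fmat_def)
  also have "\<dots> = (\<Prod>i<n. d i)" unfolding prod_list_diag_prod by (simp add: fmat_def lessThan_atLeast0)
  finally show ?thesis .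
qed

definition sw :: "nat \<Rightarrow> nat \<Rightarrow> nat" where "sw a i = (if i = 0 then a else if i = a then 0 else i)"
definition swp :: "nat \<Rightarrow> fm" where "swp a = (\<lambda>i j. if j = sw a i then 1 else 0)"

lemma sw_sw[simp]: "sw a (sw a i) = i" by (simp add: sw_def)
lemma sw_lt: "a < n \<Longrightarrow> i < n \<Longrightarrow> sw a i < n" by (simp add: sw_def)
lemma sw_eq_iff: "(j = sw a l) = (l = sw a j)" by (auto simp: sw_def)

lemma mm_swp_l: assumes "a < n" "i < n" shows "mm n (swp a) A i j = A (sw a i) j"
proof -
  have "mm n (swp a) A i j = (\<Sum>l<n. if l = sw a i then A l j else 0)"
    unfolding mm_def swp_def by (intro sum.cong) auto
  also have "\<dots> = A (sw a i) j" using sw_lt[OF assms] by simp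
  finally show ?thesis .
qed

lemma mm_swp_r: assumes "a < n" "j < n" shows "mm n A (swp a) i j = A i (sw a j)"
proof -
  have "mm n A (swp a) i j = (\<Sum>l<n. if l = sw a j then A i l else 0)"
    unfolding mm_def swp_def by (intro sum.cong) (auto simp: sw_eq_iff)
  also have "\<dots> = A i (sw a j)" using sw_lt[OF assms] by simp
  finally show ?thesis .
qed

lemma vm_zv[simp]: "vm n zv A = zv" by (simp add: vm_def zv_def)
lemma mv_zv[simp]: "mv n A zv = zv" by (simp add: mv_def zv_def)
lemma vm_idm: "j < n \<Longrightarrow> vm n v idm j = v j"
  unfolding vm_def idm_def by (simp add: if_distrib[of "\<lambda>x. _ * x"] cong: if_cong)
lemma mv_idm: "i < n \<Longrightarrow> mv n idm v i = v i"
  unfolding mv_def idm_def by (simp add: if_distrib[of "\<lambda>x. x * _"] cong: if_cong)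

lemma idm_bk: "idm = bk 1 zv zv idm" by (rule fmext) (auto simp: bk_def idm_def)

context padic
begin

lemma eqm_mm_idm_l: "eqm n (mm n idm A) A" by (rule eqm_exact) (simp add: mm_idm_l)
lemma eqm_mm_idm_r: "eqm n (mm n A idm) A" by (rule eqm_exact) (simp add: mm_idm_r)

lemma detm_cong: assumes "eqm n A B" shows "detm n A - detm n B \<in> I"
  unfolding detm_leibniz
proof (rule I_cong_sum)
  fix \<sigma> assume "\<sigma> \<in> {\<sigma>. \<sigma> permutes {0..<n}}"
  then have s: "\<sigma> i < n" if "i < n" for i using that permutes_in_image by fastforce
  have "(\<Prod>i=0..<n. A i (\<sigma> i)) - (\<Prod>i=0..<n. B i (\<sigma> i)) \<in> I"
    by (rule I_cong_prod) (use assms s in \<open>auto dest: eqmD\<close>)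
  then have "signof \<sigma> * ((\<Prod>i=0..<n. A i (\<sigma> i)) - (\<Prod>i=0..<n. B i (\<sigma> i))) \<in> I" by auto
  then show "signof \<sigma> * (\<Prod>i=0..<n. A i (\<sigma> i)) - signof \<sigma> * (\<Prod>i=0..<n. B i (\<sigma> i)) \<in> I"
    by (simp add: right_diff_distrib)
qed

lemma detm_Coh: assumes "cm n A" shows "detm n A \<in> Coh"
  unfolding detm_leibniz
proof (intro Coh_sum Coh_mult Coh_prod)
  fix \<sigma> i assume "\<sigma> \<in> {\<sigma>. \<sigma> permutes {0..<n}}" "i \<in> {0..<n}"
  then show "A i (\<sigma> i) \<in> Coh" using assms permutes_in_image by (fastforce dest: cmD)
qed simp

lemma adj_ex: "\<exists>Adj. eqm n (mm n A Adj) (sm (detm n A) idm) \<and> eqm n (mm n Adj A) (sm (detm n A) idm)"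
proof -
  define M where "M = fmat n A"
  define Adj where "Adj = (\<lambda>i j. adj_mat M $$ (i,j))"
  have M: "M \<in> carrier_mat n n" unfolding M_def by simp
  have aM: "adj_mat M \<in> carrier_mat n n" using adj_mat(1)[OF M] .
  have fA: "fmat n Adj = adj_mat M" using aM by (intro eq_matI) (auto simp: fmat_def Adj_def)
  have 1: "fmat n (mm n A Adj) = detm n A \<cdot>\<^sub>m 1\<^sub>m n"
    unfolding fmat_mm fA using adj_mat(2)[OF M] by (simp add: M_def detm_def)
  have 2: "fmat n (mm n Adj A) = detm n A \<cdot>\<^sub>m 1\<^sub>m n"
    unfolding fmat_mm fA using adj_mat(3)[OF M] by (simp add: M_def detm_def)
  have "eqm n (mm n A Adj) (sm (detm n A) idm)"
  proof (rule eqm_exact)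
    fix i j assume "i < n" "j < n"
    then show "mm n A Adj i j = sm (detm n A) idm i j"
      using arg_cong[OF 1, of "\<lambda>M. M $$ (i,j)"] by (simp add: idm_def)
  qed
  moreover have "eqm n (mm n Adj A) (sm (detm n A) idm)"
  proof (rule eqm_exact)
    fix i j assume "i < n" "j < n"
    then show "mm n Adj A i j = sm (detm n A) idm i j"
      using arg_cong[OF 2, of "\<lambda>M. M $$ (i,j)"] by (simp add: idm_def)
  qed
  ultimately show ?thesis by blast
qed

lemma sm_sm: "sm c (sm d A) = sm (c * d) A" by (rule fmext) (simp add: mult.assoc)
lemma sm_one: "sm 1 A = A" by (rule fmext) simp

lemma eqm_sm_one: "c - 1 \<in> I \<Longrightarrow> eqm n (sm c A) A"
  using eqm_sm2[of c 1 n A] by (simp add: sm_one)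

section \<open>Invertible matrices\<close>

definition GL_seq :: "nat \<Rightarrow> fm \<Rightarrow> bool" where
  "GL_seq n U \<longleftrightarrow> cm n U \<and> (\<exists>V. cm n V \<and> eqm n (mm n U V) idm \<and> eqm n (mm n V U) idm)"

lemma GL_seq_cm: "GL_seq n U \<Longrightarrow> cm n U" by (simp add: GL_seq_def)

lemma GL_seq_idm[simp,intro]: "GL_seq n idm"
  unfolding GL_seq_def using eqm_mm_idm_l by blast

lemma GL_seq_mm: assumes "GL_seq n U1" "GL_seq n U2" shows "GL_seq n (mm n U1 U2)"
proof -
  obtain V1 where V1: "cm n V1" "eqm n (mm n U1 V1) idm" "eqm n (mm n V1 U1) idm" using assms(1) unfolding GL_seq_def by blast
  obtain V2 where V2: "cm n V2" "eqm n (mm n U2 V2) idm" "eqm n (mm n V2 U2) idm" using assms(2) unfolding GL_seq_def by blast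
  have "eqm n (mm n (mm n U1 U2) (mm n V2 V1)) (mm n U1 (mm n (mm n U2 V2) V1))" by (simp add: mm_assoc)
  also have "eqm n \<dots> (mm n U1 (mm n idm V1))" by (intro eqm_mm eqm_refl V2)
  also have "eqm n \<dots> (mm n U1 V1)" by (intro eqm_mm eqm_refl eqm_mm_idm_l)
  finally have 1: "eqm n (mm n (mm n U1 U2) (mm n V2 V1)) idm" using V1 eqm_trans by blast
  have "eqm n (mm n (mm n V2 V1) (mm n U1 U2)) (mm n V2 (mm n (mm n V1 U1) U2))" by (simp add: mm_assoc)
  also have "eqm n \<dots> (mm n V2 (mm n idm U2))" by (intro eqm_mm eqm_refl V1)
  also have "eqm n \<dots> (mm n V2 U2)" by (intro eqm_mm eqm_refl eqm_mm_idm_l)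
  finally have 2: "eqm n (mm n (mm n V2 V1) (mm n U1 U2)) idm" using V2 eqm_trans by blast
  show ?thesis unfolding GL_seq_def using 1 2 assms V1 V2 by (auto simp: GL_seq_def)
qed

lemma GL_seq_inv: assumes "GL_seq n U" shows "\<exists>V. GL_seq n V \<and> eqm n (mm n U V) idm \<and> eqm n (mm n V U) idm"
  using assms unfolding GL_seq_def by blast

lemma GL_seq_cong: assumes "GL_seq n U" "eqm n U U'" "cm n U'" shows "GL_seq n U'"
proof -
  obtain V where V: "cm n V" "eqm n (mm n U V) idm" "eqm n (mm n V U) idm" using assms unfolding GL_seq_def by blast
  have "eqm n (mm n U' V) idm" using eqm_trans[OF eqm_mm[OF eqm_sym[OF assms(2)] eqm_refl] V(2)] .
  moreover have "eqm n (mm n V U') idm" using eqm_trans[OF eqm_mm[OF eqm_refl eqm_sym[OF assms(2)]] V(3)] .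
  ultimately show ?thesis using V assms(3) unfolding GL_seq_def by blast
qed

lemma GL_seq_det_unit: assumes "GL_seq n U" shows "unit (detm n U)"
proof -
  obtain V where V: "cm n V" "eqm n (mm n U V) idm" using assms unfolding GL_seq_def by blast
  have "detm n (mm n U V) - detm n idm \<in> I" using detm_cong[OF V(2)] .
  then have "detm n U * detm n V - 1 \<in> I" by (simp add: detm_mm)
  then show ?thesis using unit_of_inv detm_Coh GL_seq_cm[OF assms] V(1) by blast
qed

text \<open>A one-sided inverse is two-sided (via the adjugate).\<close>
lemma one_sided: assumes "cm n U" "cm n V" "eqm n (mm n U V) idm" shows "GL_seq n U"
proof -
  let ?d = "detm n U" and ?e = "detm n V"
  have de: "?d * ?e - 1 \<in> I" using detm_cong[OF assms(3)] by (simp add: detm_mm)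
  obtain Adj where Adj: "eqm n (mm n Adj U) (sm ?d idm)" using adj_ex by blast
  have "eqm n (mm n Adj (mm n U V)) (mm n Adj idm)" by (intro eqm_mm eqm_refl assms(3))
  then have "eqm n (mm n (mm n Adj U) V) (mm n Adj idm)" by (simp add: mm_assoc)
  then have "eqm n (mm n (mm n Adj U) V) Adj" using eqm_mm_idm_r eqm_trans by blast
  moreover have "eqm n (mm n (mm n Adj U) V) (mm n (sm ?d idm) V)" by (intro eqm_mm eqm_refl Adj)
  moreover have "eqm n (mm n (sm ?d idm) V) (sm ?d V)"
    unfolding mm_sm_l using eqm_sm[OF eqm_mm_idm_l] .
  ultimately have A: "eqm n (sm ?d V) Adj" using eqm_trans eqm_sym by blast
  have "eqm n (sm (?e * ?d) (mm n V U)) (sm ?e (mm n (sm ?d V) U))"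
    by (simp add: mm_sm_l sm_sm)
  also have "eqm n \<dots> (sm ?e (mm n Adj U))" by (intro eqm_sm eqm_mm A eqm_refl)
  also have "eqm n \<dots> (sm ?e (sm ?d idm))" by (intro eqm_sm Adj)
  also have "eqm n \<dots> idm" unfolding sm_sm using eqm_sm_one de by (simp add: mult.commute)
  finally have B: "eqm n (sm (?e * ?d) (mm n V U)) idm" .
  have "eqm n (mm n V U) (sm (?e * ?d) (mm n V U))"
    using eqm_sym[OF eqm_sm_one] de by (simp add: mult.commute)
  then have "eqm n (mm n V U) idm" using B eqm_trans by blast
  then show ?thesis using assms unfolding GL_seq_def by blast
qed

lemma mm_zero_r: "mm n A 0 = 0" by (rule fmext) (simp add: mm_def)
lemma mm_zero_l: "mm n 0 A = 0" by (rule fmext) (simp add: mm_def)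

lemma cancel_mat: assumes "cm n W" "detm n W \<notin> I" "cm n Y" "eqm n (mm n (mm n (tr W) Y) W) 0"
  shows "eqm n Y 0"
proof -
  let ?d = "detm n W"
  obtain Adj where Adj: "eqm n (mm n W Adj) (sm ?d idm)" using adj_ex by blast
  have At: "eqm n (mm n (tr Adj) (tr W)) (sm ?d idm)" using eqm_tr[OF Adj] by (simp add: tr_mm tr_sm)
  have "eqm n (mm n (tr Adj) (mm n (mm n (mm n (tr W) Y) W) Adj)) (mm n (tr Adj) (mm n 0 Adj))"
    by (intro eqm_mm eqm_refl assms(4))
  then have Z: "eqm n (mm n (mm n (tr Adj) (tr W)) (mm n Y (mm n W Adj))) 0"
    by (simp add: mm_assoc mm_zero_l mm_zero_r)
  have "eqm n (mm n (mm n (tr Adj) (tr W)) (mm n Y (mm n W Adj))) (mm n (sm ?d idm) (mm n Y (sm ?d idm)))"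
    by (intro eqm_mm At Adj eqm_refl)
  also have "eqm n \<dots> (sm ?d (sm ?d (mm n idm (mm n Y idm))))" by (simp add: mm_sm_l mm_sm_r)
  also have "eqm n \<dots> (sm ?d (sm ?d Y))"
    by (intro eqm_sm eqm_trans[OF eqm_mm_idm_l eqm_mm_idm_r])
  finally have "eqm n (sm ?d (sm ?d Y)) 0" using Z eqm_trans eqm_sym by blast
  then have X: "eqm n (sm (?d * ?d) Y) 0" by (simp add: sm_sm)
  have dC: "?d \<in> Coh" using detm_Coh[OF assms(1)] .
  have dd: "?d * ?d \<notin> I" using val_mult(1)[OF dC assms(2) dC assms(2)] .
  show ?thesis
  proof (rule eqmI)
    fix i j assume ij: "i < n" "j < n"
    have "?d * ?d * Y i j \<in> I" using eqmD[OF X ij] by simp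
    then have "Y i j \<in> I" using domain[of "?d * ?d" "Y i j"] dd dC cmD[OF assms(3) ij] by auto
    then show "Y i j - 0 i j \<in> I" by simp
  qed
qed

end

lemma bk1_mm: "mm (Suc n) (bk 1 zv zv A) (bk 1 zv zv B) = bk 1 zv zv (mm n A B)"
  unfolding mm_bk by (simp add: zv_def vm_def mv_def)

context padic
begin

lemma eqv_exact: "(\<And>i. i < n \<Longrightarrow> v i = w i) \<Longrightarrow> eqv n v w" unfolding eqv_def by simp

lemma eqm_idm_bkI: "eqm (Suc n) X (bk 1 zv zv idm) \<Longrightarrow> eqm (Suc n) X idm"
  by (simp add: idm_bk[symmetric])

lemma GL_seq_swp: assumes "a < n" shows "GL_seq n (swp a)"
proof -
  have c: "cm n (swp a)" unfolding cm_def swp_def by auto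
  have "eqm n (mm n (swp a) (swp a)) idm"
  proof (rule eqm_exact)
    fix i j assume "i < n" "j < n"
    then show "mm n (swp a) (swp a) i j = idm i j"
      using mm_swp_l[OF assms] by (auto simp: swp_def idm_def sw_eq_iff)
  qed
  then show ?thesis using c unfolding GL_seq_def by blast
qed

lemma GL_seq_bk1: assumes "GL_seq n U" shows "GL_seq (Suc n) (bk 1 zv zv U)"
proof -
  obtain V where V: "cm n V" "eqm n (mm n U V) idm" "eqm n (mm n V U) idm" using assms unfolding GL_seq_def by blast
  have "eqm (Suc n) (mm (Suc n) (bk 1 zv zv U) (bk 1 zv zv V)) idm"
    unfolding bk1_mm by (rule eqm_idm_bkI, intro eqm_bk) (auto simp: V)
  moreover have "eqm (Suc n) (mm (Suc n) (bk 1 zv zv V) (bk 1 zv zv U)) idm"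
    unfolding bk1_mm by (rule eqm_idm_bkI, intro eqm_bk) (auto simp: V)
  ultimately show ?thesis using V(1) GL_seq_cm[OF assms] unfolding GL_seq_def
    by (intro conjI exI[where x="bk 1 zv zv V"]) (auto intro!: cm_bk)
qed

lemma GL_seq_unip: assumes "cv n x" shows "GL_seq (Suc n) (bk 1 x zv idm)"
proof -
  have "eqm (Suc n) (mm (Suc n) (bk 1 x zv idm) (bk 1 (- x) zv idm)) idm"
    unfolding mm_bk by (rule eqm_idm_bkI, intro eqm_bk eqv_exact eqm_exact) (auto simp: vm_idm mm_idm_l)
  moreover have "eqm (Suc n) (mm (Suc n) (bk 1 (- x) zv idm) (bk 1 x zv idm)) idm"
    unfolding mm_bk by (rule eqm_idm_bkI, intro eqm_bk eqv_exact eqm_exact) (auto simp: vm_idm mm_idm_l)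
  ultimately show ?thesis using assms unfolding GL_seq_def
    by (intro conjI exI[where x="bk 1 (- x) zv idm"]) (auto intro!: cm_bk)
qed

lemma GL_seq_low: assumes "unit u" "cv n c" shows "GL_seq (Suc n) (bk u zv c idm)"
proof -
  let ?u' = "uinv u"
  let ?c' = "\<lambda>i. - c i * ?u'"
  have uu: "u * ?u' - 1 \<in> I" using unit_inv[OF assms(1)] .
  have "eqm (Suc n) (mm (Suc n) (bk u zv c idm) (bk ?u' zv ?c' idm)) idm"
    unfolding mm_bk
  proof (rule eqm_idm_bkI, intro eqm_bk eqm_exact)
    show "u * ?u' + (\<Sum>l<n. zv l * ?c' l) - 1 \<in> I" using uu by simp
    show "eqv n (\<lambda>j. u * zv j + vm n zv idm j) zv" by (rule eqv_exact) simp
    show "eqv n (\<lambda>i. c i * ?u' + mv n idm ?c' i) zv"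
      by (rule eqv_exact) (simp add: mv_idm fun_eq_iff)
  qed (simp add: mm_idm_l)
  moreover have "eqm (Suc n) (mm (Suc n) (bk ?u' zv ?c' idm) (bk u zv c idm)) idm"
    unfolding mm_bk
  proof (rule eqm_idm_bkI, intro eqm_bk eqm_exact)
    show "?u' * u + (\<Sum>l<n. zv l * c l) - 1 \<in> I" using uu by (simp add: mult.commute)
    show "eqv n (\<lambda>j. ?u' * zv j + vm n zv idm j) zv" by (rule eqv_exact) simp
    show "eqv n (\<lambda>i. ?c' i * u + mv n idm c i) zv"
      unfolding eqv_def
    proof (intro allI impI)
      fix i assume "i < n"
      then have "?c' i * u + mv n idm c i - zv i = - (c i * (u * ?u' - 1))" by (simp add: mv_idm algebra_simps)
      moreover have "c i * (u * ?u' - 1) \<in> I" using uu by auto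
      ultimately show "?c' i * u + mv n idm c i - zv i \<in> I" by auto
    qed
  qed (simp add: mm_idm_l)
  moreover have "cv n ?c'" using assms uinv_Coh unfolding cv_def by auto
  ultimately show ?thesis using assms unit_Coh uinv_Coh unfolding GL_seq_def
    by (intro conjI exI[where x="bk ?u' zv ?c' idm"]) (auto intro!: cm_bk)
qed

definition dmat_seq :: "nat \<Rightarrow> nat \<Rightarrow> fm" where
  "dmat_seq n i = (\<lambda>a b. if a = b then (if a < n - i then 1 else of_int p) else 0)"

definition Dcoset_seq :: "nat \<Rightarrow> nat \<Rightarrow> fm \<Rightarrow> bool" where
  "Dcoset_seq n i X \<longleftrightarrow> (\<exists>U V. GL_seq n U \<and> GL_seq n V \<and> eqm n X (mm n (mm n U (dmat_seq n i)) V))"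

lemma Dcoset_seq_cong: "Dcoset_seq n i X \<Longrightarrow> eqm n X X' \<Longrightarrow> Dcoset_seq n i X'"
  unfolding Dcoset_seq_def using eqm_trans eqm_sym by blast

lemma Dcoset_seq_left: assumes "GL_seq n U'" "Dcoset_seq n i X" shows "Dcoset_seq n i (mm n U' X)"
proof -
  obtain U V where UV: "GL_seq n U" "GL_seq n V" "eqm n X (mm n (mm n U (dmat_seq n i)) V)" using assms(2) unfolding Dcoset_seq_def by blast
  have "eqm n (mm n U' X) (mm n (mm n (mm n U' U) (dmat_seq n i)) V)"
    using eqm_mm[OF eqm_refl UV(3), of U'] by (simp add: mm_assoc)
  then show ?thesis unfolding Dcoset_seq_def using GL_seq_mm[OF assms(1) UV(1)] UV(2) by blast
qed

lemma Dcoset_seq_right: assumes "GL_seq n V'" "Dcoset_seq n i X" shows "Dcoset_seq n i (mm n X V')"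
proof -
  obtain U V where UV: "GL_seq n U" "GL_seq n V" "eqm n X (mm n (mm n U (dmat_seq n i)) V)" using assms(2) unfolding Dcoset_seq_def by blast
  have "eqm n (mm n X V') (mm n (mm n U (dmat_seq n i)) (mm n V V'))"
    using eqm_mm[OF UV(3) eqm_refl, of V'] by (simp add: mm_assoc)
  then show ?thesis unfolding Dcoset_seq_def using GL_seq_mm[OF UV(2) assms(1)] UV(1) by blast
qed

lemma dmat_seq_bk: assumes "i \<le> n" shows "eqm (Suc n) (bk 1 zv zv (dmat_seq n i)) (dmat_seq (Suc n) i)"
proof (rule eqm_exact)
  fix a b assume "a < Suc n" "b < Suc n"
  then show "bk 1 zv zv (dmat_seq n i) a b = dmat_seq (Suc n) i a b"
    using assms by (cases a; cases b) (auto simp: dmat_seq_def Suc_diff_le)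
qed

lemma Dcoset_seq_bk1: assumes "Dcoset_seq n i X" "i \<le> n" shows "Dcoset_seq (Suc n) i (bk 1 zv zv X)"
proof -
  obtain U V where UV: "GL_seq n U" "GL_seq n V" "eqm n X (mm n (mm n U (dmat_seq n i)) V)" using assms(1) unfolding Dcoset_seq_def by blast
  have "eqm (Suc n) (bk 1 zv zv X) (bk 1 zv zv (mm n (mm n U (dmat_seq n i)) V))"
    by (intro eqm_bk UV) auto
  also have "bk 1 zv zv (mm n (mm n U (dmat_seq n i)) V) =
     mm (Suc n) (mm (Suc n) (bk 1 zv zv U) (bk 1 zv zv (dmat_seq n i))) (bk 1 zv zv V)"
    by (simp add: bk1_mm)
  also have "eqm (Suc n) \<dots> (mm (Suc n) (mm (Suc n) (bk 1 zv zv U) (dmat_seq (Suc n) i)) (bk 1 zv zv V))"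
    by (intro eqm_mm eqm_refl dmat_seq_bk assms(2))
  finally show ?thesis unfolding Dcoset_seq_def using GL_seq_bk1 UV by blast
qed

text \<open>The index i is read off from the valuation of the determinant, hence is unique.\<close>
lemma detm_dmat_seq: assumes "i \<le> n" shows "detm n (dmat_seq n i) = of_int p ^ i"
proof -
  have "detm n (dmat_seq n i) = (\<Prod>a<n. if a < n - i then 1 else of_int p)"
    unfolding dmat_seq_def using detm_diag[of n "\<lambda>a. if a < n - i then 1 else of_int p"]
    by (simp add: if_distrib cong: if_cong)
  also have "\<dots> = (\<Prod>a\<in>{..<n-i} \<union> {n-i..<n}. if a < n - i then 1 else of_int p)"
    by (rule prod.cong) auto
  also have "\<dots> = (\<Prod>a\<in>{..<n-i}. if a < n - i then 1 else of_int p) * (\<Prod>a\<in>{n-i..<n}. if a < n - i then 1 else of_int p)"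
    by (rule prod.union_disjoint) auto
  also have "\<dots> = (\<Prod>a\<in>{n-i..<n}. (of_int p :: R))" by simp
  also have "\<dots> = of_int p ^ i" using assms by simp
  finally show ?thesis .
qed

lemma Dcoset_seq_val: assumes "Dcoset_seq n i X" "i \<le> n" shows "detm n X \<notin> I" "val (detm n X) = i"
proof -
  obtain U V where UV: "GL_seq n U" "GL_seq n V" "eqm n X (mm n (mm n U (dmat_seq n i)) V)" using assms(1) unfolding Dcoset_seq_def by blast
  have dX: "detm n X - detm n U * (of_int p ^ i * detm n V) \<in> I"
    using detm_cong[OF UV(3)] by (simp add: detm_mm detm_dmat_seq[OF assms(2)] mult.assoc)
  have uU: "unit (detm n U)" "unit (detm n V)" using GL_seq_det_unit UV by auto
  have 1: "of_int p ^ i * detm n V \<notin> I" "val (of_int p ^ i * detm n V) = i"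
    using val_unit_mult[OF uU(2) ppow_Coh ppow_notI] val_ppow by (auto simp: mult.commute)
  have C: "of_int p ^ i * detm n V \<in> Coh" using unit_Coh[OF uU(2)] by auto
  have 2: "detm n U * (of_int p ^ i * detm n V) \<notin> I" "val (detm n U * (of_int p ^ i * detm n V)) = i"
    using val_unit_mult[OF uU(1) C 1(1)] 1(2) by auto
  show "detm n X \<notin> I"
  proof
    assume "detm n X \<in> I"
    then have "detm n X - (detm n X - detm n U * (of_int p ^ i * detm n V)) \<in> I" using dX by (rule I_diff)
    then show False using 2(1) by simp
  qed
  show "val (detm n X) = i" using val_cong[OF dX] 2(2) by simp
qed

lemma Dcoset_seq_unique: "Dcoset_seq n i X \<Longrightarrow> Dcoset_seq n j X \<Longrightarrow> i \<le> n \<Longrightarrow> j \<le> n \<Longrightarrow> i = j"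
proof -
  assume a: "Dcoset_seq n i X" "Dcoset_seq n j X" "i \<le> n" "j \<le> n"
  have "val (detm n X) = i" using Dcoset_seq_val(2)[OF a(1) a(3)] .
  moreover have "val (detm n X) = j" using Dcoset_seq_val(2)[OF a(2) a(4)] .
  ultimately show "i = j" by simp
qed

subsection \<open>Elimination and the Smith normal form\<close>

lemma unit_uinv: assumes "unit u" shows "unit (uinv u)"
  using unit_of_inv[OF uinv_Coh[OF assms] unit_Coh[OF assms]] unit_inv[OF assms] by (simp add: mult.commute)

lemma elim_left:
  assumes "cm (Suc n) X1" "unit (X1 0 0)"
  defines "u \<equiv> X1 0 0" and "v \<equiv> (\<lambda>j. X1 0 (Suc j))" and "c \<equiv> (\<lambda>i. X1 (Suc i) 0)"
    and "Z \<equiv> (\<lambda>i j. X1 (Suc i) (Suc j))"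
  shows "GL_seq (Suc n) (bk (uinv u) zv (\<lambda>i. - c i * uinv u) idm)"
    "eqm (Suc n) (mm (Suc n) (bk (uinv u) zv (\<lambda>i. - c i * uinv u) idm) X1)
                 (bk 1 (\<lambda>j. uinv u * v j) zv (\<lambda>i j. Z i j - c i * uinv u * v j))"
    "cv n (\<lambda>j. uinv u * v j)" "cm n (\<lambda>i j. Z i j - c i * uinv u * v j)"
proof -
  have uu: "uinv u * u - 1 \<in> I" using unit_inv[OF assms(2)] unfolding u_def by (simp add: mult.commute)
  have cc: "cv n c" "cv n v" "cm n Z" "u \<in> Coh" using cm_bk_parts[OF assms(1)] unfolding c_def v_def Z_def u_def by auto
  have ui: "uinv u \<in> Coh" using uinv_Coh assms(2) unfolding u_def by blast
  show "GL_seq (Suc n) (bk (uinv u) zv (\<lambda>i. - c i * uinv u) idm)"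
    using GL_seq_low[OF unit_uinv] assms(2) cc ui unfolding u_def cv_def by auto
  have X1: "X1 = bk u v c Z" unfolding u_def v_def c_def Z_def by (rule bk_decomp)
  show "eqm (Suc n) (mm (Suc n) (bk (uinv u) zv (\<lambda>i. - c i * uinv u) idm) X1)
                 (bk 1 (\<lambda>j. uinv u * v j) zv (\<lambda>i j. Z i j - c i * uinv u * v j))"
    unfolding X1 mm_bk
  proof (intro eqm_bk)
    show "uinv u * u + (\<Sum>l<n. zv l * c l) - 1 \<in> I" using uu by simp
    show "eqv n (\<lambda>j. uinv u * v j + vm n zv Z j) (\<lambda>j. uinv u * v j)" by (rule eqv_exact) simp
    show "eqm n (\<lambda>i j. - c i * uinv u * v j + mm n idm Z i j) (\<lambda>i j. Z i j - c i * uinv u * v j)"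
      by (rule eqm_exact) (simp add: mm_idm_l algebra_simps)
    show "eqv n (\<lambda>i. - c i * uinv u * u + mv n idm c i) zv"
      unfolding eqv_def
    proof (intro allI impI)
      fix i assume "i < n"
      then have "- c i * uinv u * u + mv n idm c i - zv i = - (c i * (uinv u * u - 1))"
        by (simp add: mv_idm algebra_simps)
      moreover have "c i * (uinv u * u - 1) \<in> I" using uu by auto
      ultimately show "- c i * uinv u * u + mv n idm c i - zv i \<in> I" by auto
    qed
  qed
  show "cv n (\<lambda>j. uinv u * v j)" using cc ui unfolding cv_def by auto
  show "cm n (\<lambda>i j. Z i j - c i * uinv u * v j)" using cc ui unfolding cv_def cm_def by auto
qed

lemma elim_right: "eqm (Suc n) (mm (Suc n) (bk 1 w zv Z) (bk 1 (- w) zv idm)) (bk 1 zv zv Z)"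
  unfolding mm_bk by (intro eqm_bk eqv_exact eqm_exact) (auto simp: vm_idm mm_idm_r)

lemma conj_p: assumes "eqm n (mm n P Pv) idm" "eqm n (mm n Q Qv) idm" "eqm n (mm n X Y) (sm c idm)"
  shows "eqm n (mm n (mm n (mm n P X) Q) (mm n (mm n Qv Y) Pv)) (sm c idm)"
proof -
  have "eqm n (mm n (mm n (mm n P X) Q) (mm n (mm n Qv Y) Pv)) (mm n P (mm n X (mm n (mm n Q Qv) (mm n Y Pv))))"
    by (simp add: mm_assoc)
  also have "eqm n \<dots> (mm n P (mm n X (mm n idm (mm n Y Pv))))" by (intro eqm_mm eqm_refl assms(2))
  also have "eqm n \<dots> (mm n P (mm n X (mm n Y Pv)))" by (intro eqm_mm eqm_refl eqm_mm_idm_l)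
  also have "eqm n (mm n P (mm n X (mm n Y Pv))) (mm n P (mm n (mm n X Y) Pv))" by (simp add: mm_assoc)
  also have "eqm n \<dots> (mm n P (mm n (sm c idm) Pv))" by (intro eqm_mm eqm_refl assms(3))
  also have "eqm n \<dots> (sm c (mm n P (mm n idm Pv)))" by (simp add: mm_sm_l mm_sm_r)
  also have "eqm n \<dots> (sm c (mm n P Pv))" by (intro eqm_sm eqm_mm eqm_refl eqm_mm_idm_l)
  also have "eqm n \<dots> (sm c idm)" by (intro eqm_sm assms(1))
  finally show ?thesis .
qed

lemma unconj: assumes "eqm n K (mm n (mm n P X) Q)" "eqm n (mm n Pv P) idm" "eqm n (mm n Q Qv) idm"
  shows "eqm n X (mm n (mm n Pv K) Qv)"
proof -
  have "eqm n (mm n (mm n Pv K) Qv) (mm n (mm n Pv (mm n (mm n P X) Q)) Qv)" by (intro eqm_mm eqm_refl assms(1))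
  also have "eqm n (mm n (mm n Pv (mm n (mm n P X) Q)) Qv) (mm n (mm n Pv P) (mm n X (mm n Q Qv)))" by (simp add: mm_assoc)
  also have "eqm n \<dots> (mm n idm (mm n X idm))" by (intro eqm_mm assms(2,3) eqm_refl)
  also have "eqm n \<dots> X" using eqm_trans[OF eqm_mm_idm_l eqm_mm_idm_r] .
  finally show ?thesis using eqm_sym by blast
qed

lemma block_p: assumes "eqm (Suc n) (mm (Suc n) (bk 1 zv zv Z) Y) (sm c idm)"
  shows "eqm n (mm n Z (\<lambda>i j. Y (Suc i) (Suc j))) (sm c idm)"
proof (rule eqmI)
  fix i j assume ij: "i < n" "j < n"
  have "mm (Suc n) (bk 1 zv zv Z) Y (Suc i) (Suc j) = mm n Z (\<lambda>i j. Y (Suc i) (Suc j)) i j"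
    unfolding mm_def sum.lessThan_Suc_shift by (simp add: zero_fun_def[symmetric])
  moreover have "sm c idm (Suc i) (Suc j) = sm c idm i j" by (simp add: idm_def)
  ultimately show "mm n Z (\<lambda>i j. Y (Suc i) (Suc j)) i j - sm c idm i j \<in> I"
    using eqmD[OF assms, of "Suc i" "Suc j"] ij by simp
qed

lemma dmat_seq_full: "eqm n (dmat_seq n n) (sm (of_int p) idm)"
  by (rule eqm_exact) (simp add: dmat_seq_def idm_def)

lemma Dcoset_seq_inv_p: assumes "Dcoset_seq n i X" shows "\<exists>Y. cm n Y \<and> eqm n (mm n X Y) (sm (of_int p) idm)"
proof -
  obtain U V where UV: "GL_seq n U" "GL_seq n V" "eqm n X (mm n (mm n U (dmat_seq n i)) V)" using assms unfolding Dcoset_seq_def by blast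
  obtain Uv where Uv: "GL_seq n Uv" "eqm n (mm n U Uv) idm" using GL_seq_inv[OF UV(1)] by blast
  obtain Vv where Vv: "GL_seq n Vv" "eqm n (mm n V Vv) idm" using GL_seq_inv[OF UV(2)] by blast
  define d' where "d' = (\<lambda>a b. if a = b then (if a < n - i then of_int p else 1) else (0::R))"
  have dd: "eqm n (mm n (dmat_seq n i) d') (sm (of_int p) idm)"
  proof (rule eqm_exact)
    fix a b assume ab: "a < n" "b < n"
    have "mm n (dmat_seq n i) d' a b = (\<Sum>l<n. if l = a then dmat_seq n i a a * d' a b else 0)"
      unfolding mm_def by (intro sum.cong) (auto simp: dmat_seq_def)
    also have "\<dots> = dmat_seq n i a a * d' a b" using ab by simp
    also have "\<dots> = sm (of_int p) idm a b" by (simp add: dmat_seq_def d'_def idm_def)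
    finally show "mm n (dmat_seq n i) d' a b = sm (of_int p) idm a b" .
  qed
  have cd: "cm n d'" unfolding d'_def by (intro cmI) auto
  have "eqm n (mm n (mm n (mm n U (dmat_seq n i)) V) (mm n (mm n Vv d') Uv)) (sm (of_int p) idm)"
    by (rule conj_p[OF Uv(2) Vv(2) dd])
  then have "eqm n (mm n X (mm n (mm n Vv d') Uv)) (sm (of_int p) idm)"
    using eqm_trans[OF eqm_mm[OF UV(3) eqm_refl]] by blast
  moreover have "cm n (mm n (mm n Vv d') Uv)" using cm_mm[OF cm_mm[OF GL_seq_cm[OF Vv(1)] cd] GL_seq_cm[OF Uv(1)]] .
  ultimately show ?thesis by blast
qed

lemma pivot_column:
  assumes "cm (Suc n) W" "a < Suc n" "\<not> p dvd W a 0 1"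
  obtains P w Z where "GL_seq (Suc n) P" "cv n w" "cm n Z" "eqm (Suc n) (mm (Suc n) P W) (bk 1 w zv Z)"
proof -
  define X1 where "X1 = mm (Suc n) (swp a) W"
  have X100: "X1 0 0 = W a 0" unfolding X1_def using assms(2) by (simp add: mm_swp_l sw_def)
  have cX1: "cm (Suc n) X1" unfolding X1_def using cm_mm[OF GL_seq_cm[OF GL_seq_swp[OF assms(2)]] assms(1)] .
  have u: "unit (X1 0 0)" unfolding unit_def using X100 assms(3) cmD[OF cX1, of 0 0] by auto
  note el = elim_left[OF cX1 u]
  let ?E = "bk (uinv (X1 0 0)) zv (\<lambda>i. - X1 (Suc i) 0 * uinv (X1 0 0)) idm"
  have "eqm (Suc n) (mm (Suc n) (mm (Suc n) ?E (swp a)) W) (mm (Suc n) ?E X1)"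
    unfolding X1_def by (simp add: mm_assoc)
  then have "eqm (Suc n) (mm (Suc n) (mm (Suc n) ?E (swp a)) W)
     (bk 1 (\<lambda>j. uinv (X1 0 0) * X1 0 (Suc j)) zv (\<lambda>i j. X1 (Suc i) (Suc j) - X1 (Suc i) 0 * uinv (X1 0 0) * X1 0 (Suc j)))"
    using el(2) eqm_trans by blast
  moreover have "GL_seq (Suc n) (mm (Suc n) ?E (swp a))" using GL_seq_mm[OF el(1) GL_seq_swp[OF assms(2)]] .
  ultimately show ?thesis using that el(3,4) by blast
qed

text \<open>Smith normal form, in the only form needed here: a matrix X dividing p (that
  is, X Y = p 1 for some Y) lies in one of the double cosets D_{n,i}.  First the
  case where p divides every entry: then X/p is invertible and X lies in D_{n,n}.\<close>
lemma smith_divisible: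
  assumes "cm n X" "cm n Y" "eqm n (mm n X Y) (sm (of_int p) idm)" "\<forall>a<n. \<forall>b<n. p dvd X a b 1"
  shows "Dcoset_seq n n X"
proof -
  define X' where "X' = (\<lambda>a b. SOME h. h \<in> Coh \<and> X a b - of_int p * h \<in> I)"
  have X': "X' a b \<in> Coh \<and> X a b - of_int p * X' a b \<in> I" if "a < n" "b < n" for a b
  proof -
    have "\<exists>h\<in>Coh. X a b - of_int p * h \<in> I" using divp cmD[OF assms(1) that] assms(4) that by blast
    then show ?thesis unfolding X'_def by (metis (mono_tags, lifting) someI_ex)
  qed
  have cX': "cm n X'" using X' by (auto intro: cmI)
  have XX': "eqm n X (sm (of_int p) X')" using X' by (auto intro!: eqmI)
  have "eqm n (sm (of_int p) (mm n X' Y)) (mm n X Y)"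
    using eqm_mm[OF eqm_sym[OF XX'] eqm_refl, of Y] by (simp add: mm_sm_l)
  then have pE: "eqm n (sm (of_int p) (mm n X' Y)) (sm (of_int p) idm)" using assms(3) eqm_trans by blast
  have "eqm n (mm n X' Y) idm"
  proof (rule eqmI)
    fix i j assume ij: "i < n" "j < n"
    have "of_int p * (mm n X' Y i j - idm i j) \<in> I" using eqmD[OF pE ij] by (simp add: algebra_simps)
    moreover have "mm n X' Y i j - idm i j \<in> Coh"
      using cmD[OF cm_mm[OF cX' assms(2)] ij] cmD[OF cm_idm ij] by (rule Coh_diff)
    ultimately show "mm n X' Y i j - idm i j \<in> I" using cancel_p by blast
  qed
  then have G: "GL_seq n X'" using one_sided[OF cX' assms(2)] by blast
  have "eqm n (mm n (mm n X' (dmat_seq n n)) idm) (mm n X' (dmat_seq n n))" by (rule eqm_mm_idm_r)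
  also have "eqm n \<dots> (mm n X' (sm (of_int p) idm))" by (intro eqm_mm eqm_refl dmat_seq_full)
  also have "eqm n \<dots> (sm (of_int p) (mm n X' idm))" by (simp add: mm_sm_r)
  also have "eqm n \<dots> (sm (of_int p) X')" by (intro eqm_sm eqm_mm_idm_r)
  finally have "eqm n X (mm n (mm n X' (dmat_seq n n)) idm)" using XX' eqm_trans eqm_sym by blast
  then show ?thesis unfolding Dcoset_seq_def using G GL_seq_idm by blast
qed

text \<open>Otherwise some entry is a unit; moving it to the corner and clearing its row
  and column splits off a 1 x 1 block, and the remaining block again divides p.\<close>
lemma smith_pivot:
  assumes X: "cm (Suc n) X" and Y: "cm (Suc n) Y" and XY: "eqm (Suc n) (mm (Suc n) X Y) (sm (of_int p) idm)"
    and ab: "a < Suc n" "b < Suc n" "\<not> p dvd X a b 1"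
    and IH: "\<And>X Y. cm n X \<Longrightarrow> cm n Y \<Longrightarrow> eqm n (mm n X Y) (sm (of_int p) idm) \<Longrightarrow> \<exists>i\<le>n. Dcoset_seq n i X"
  shows "\<exists>i\<le>Suc n. Dcoset_seq (Suc n) i X"
proof -
  define X' where "X' = mm (Suc n) X (swp b)"
  have cX': "cm (Suc n) X'" unfolding X'_def using cm_mm[OF X GL_seq_cm[OF GL_seq_swp[OF ab(2)]]] .
  have "X' a 0 = X a b" unfolding X'_def using ab by (simp add: mm_swp_r sw_def)
  then obtain P w Z where P: "GL_seq (Suc n) P" "cv n w" "cm n Z"
    "eqm (Suc n) (mm (Suc n) P X') (bk 1 w zv Z)"
    using pivot_column[OF cX' ab(1)] ab(3) by metis
  define Q where "Q = mm (Suc n) (swp b) (bk 1 (- w) zv idm)"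
  have GQ: "GL_seq (Suc n) Q" unfolding Q_def using GL_seq_mm GL_seq_unip P(2) GL_seq_swp ab by blast
  define K where "K = bk 1 zv zv Z"
  have "eqm (Suc n) (mm (Suc n) (mm (Suc n) P X) Q) (mm (Suc n) (mm (Suc n) P X') (bk 1 (- w) zv idm))"
    unfolding Q_def X'_def by (simp add: mm_assoc)
  also have "eqm (Suc n) \<dots> (mm (Suc n) (bk 1 w zv Z) (bk 1 (- w) zv idm))" by (intro eqm_mm P(4) eqm_refl)
  also have "eqm (Suc n) \<dots> K" unfolding K_def by (rule elim_right)
  finally have KPXQ: "eqm (Suc n) K (mm (Suc n) (mm (Suc n) P X) Q)" using eqm_sym by blast
  obtain Pv where Pv: "GL_seq (Suc n) Pv" "eqm (Suc n) (mm (Suc n) P Pv) idm" "eqm (Suc n) (mm (Suc n) Pv P) idm"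
    using GL_seq_inv[OF P(1)] by blast
  obtain Qv where Qv: "GL_seq (Suc n) Qv" "eqm (Suc n) (mm (Suc n) Q Qv) idm" "eqm (Suc n) (mm (Suc n) Qv Q) idm"
    using GL_seq_inv[OF GQ] by blast
  define Y2 where "Y2 = mm (Suc n) (mm (Suc n) Qv Y) Pv"
  have "eqm (Suc n) (mm (Suc n) (mm (Suc n) (mm (Suc n) P X) Q) Y2) (sm (of_int p) idm)"
    unfolding Y2_def by (rule conj_p[OF Pv(2) Qv(2) XY])
  then have "eqm (Suc n) (mm (Suc n) K Y2) (sm (of_int p) idm)"
    using eqm_trans[OF eqm_mm[OF KPXQ eqm_refl]] by blast
  then have ZY: "eqm n (mm n Z (\<lambda>i j. Y2 (Suc i) (Suc j))) (sm (of_int p) idm)"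
    unfolding K_def by (rule block_p)
  have "cm (Suc n) Y2" unfolding Y2_def using cm_mm[OF cm_mm[OF GL_seq_cm[OF Qv(1)] Y] GL_seq_cm[OF Pv(1)]] .
  then obtain i where i: "i \<le> n" "Dcoset_seq n i Z" using IH[OF P(3) cm_bk_parts(4) ZY] by blast
  have "Dcoset_seq (Suc n) i K" unfolding K_def using Dcoset_seq_bk1[OF i(2) i(1)] .
  then have "Dcoset_seq (Suc n) i (mm (Suc n) (mm (Suc n) Pv K) Qv)"
    using Dcoset_seq_left Dcoset_seq_right Pv(1) Qv(1) by blast
  then have "Dcoset_seq (Suc n) i X" using Dcoset_seq_cong unconj[OF KPXQ Pv(3) Qv(2)] eqm_sym by blast
  then show ?thesis using i(1) by (intro exI[of _ i]) auto
qed

lemma smith: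
  "cm n X \<Longrightarrow> cm n Y \<Longrightarrow> eqm n (mm n X Y) (sm (of_int p) idm) \<Longrightarrow> \<exists>i\<le>n. Dcoset_seq n i X"
proof (induction n arbitrary: X Y)
  case 0
  have "Dcoset_seq 0 0 X" unfolding Dcoset_seq_def eqm_def by auto
  then show ?case by auto
next
  case (Suc n)
  show ?case
  proof (cases "\<forall>a<Suc n. \<forall>b<Suc n. p dvd X a b 1")
    case True
    then show ?thesis using smith_divisible[OF Suc.prems] by blast
  next
    case False
    then obtain a b where "a < Suc n" "b < Suc n" "\<not> p dvd X a b 1" by blast
    then show ?thesis using smith_pivot[OF Suc.prems] Suc.IH by blast
  qed
qed

end

section \<open>The lattice and Omega conditions at sequence level\<close>

context padic
begin

lemma lam0[simp]: "(\<lambda>_::nat. (0::int)) = 0" by (simp add: zero_fun_def)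

definition cg :: "R \<Rightarrow> R \<Rightarrow> bool" where "cg a b \<longleftrightarrow> a - b \<in> I"

lemma cg_refl[simp,intro]: "cg a a" by (simp add: cg_def)
lemma cg_eq: "a = b \<Longrightarrow> cg a b" by simp
lemma cg_sym: "cg a b \<Longrightarrow> cg b a" unfolding cg_def using I_sym by blast
lemma cg_trans[trans]: "cg a b \<Longrightarrow> cg b c \<Longrightarrow> cg a c" unfolding cg_def using I_trans by blast
lemma cg_add[intro]: "cg a a' \<Longrightarrow> cg b b' \<Longrightarrow> cg (a + b) (a' + b')"
  unfolding cg_def by (metis I_add add_diff_add)
lemma cg_diff[intro]: "cg a a' \<Longrightarrow> cg b b' \<Longrightarrow> cg (a - b) (a' - b')"
proof -
  assume "cg a a'" "cg b b'"
  then have "(a - a') - (b - b') \<in> I" unfolding cg_def by (rule I_diff)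
  then show ?thesis unfolding cg_def by (simp add: algebra_simps)
qed
lemma cg_mult[intro]: "cg a a' \<Longrightarrow> cg b b' \<Longrightarrow> cg (a * b) (a' * b')"
proof -
  assume "cg a a'" "cg b b'"
  then have "a * (b - b') + (a - a') * b' \<in> I" unfolding cg_def by auto
  then show ?thesis unfolding cg_def by (simp add: algebra_simps)
qed
lemma cg_sum: "(\<And>x. x \<in> A \<Longrightarrow> cg (f x) (g x)) \<Longrightarrow> cg (sum f A) (sum g A)"
  unfolding cg_def by (rule I_cong_sum)
lemma cg_I0: "cg a 0 \<longleftrightarrow> a \<in> I" by (simp add: cg_def)

lemma eqm_cg: "eqm n A B \<Longrightarrow> i < n \<Longrightarrow> j < n \<Longrightarrow> cg (A i j) (B i j)" unfolding cg_def by (rule eqmD)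
lemma eqm_cgI: "(\<And>i j. i < n \<Longrightarrow> j < n \<Longrightarrow> cg (A i j) (B i j)) \<Longrightarrow> eqm n A B" unfolding cg_def by (rule eqmI)
lemma eqv_cg: "eqv n v w \<Longrightarrow> i < n \<Longrightarrow> cg (v i) (w i)" unfolding cg_def eqv_def by blast
lemma eqv_cgI: "(\<And>i. i < n \<Longrightarrow> cg (v i) (w i)) \<Longrightarrow> eqv n v w" unfolding cg_def eqv_def by blast

text \<open>The sequence-level versions of the sets of the statement, all for doubled
  (hence integral) matrices: Se_seq is S_n(Z_p)_e (symmetric, even diagonal),
  Lprime_seq consists of the C with C + 2 ^t s s = 4 E for some vector s and some E in
  Se_seq (the doubles of L'_n), and L0_seq, L1_seq are their nondegenerate parts.\<close>
definition Se_seq :: "nat \<Rightarrow> fm \<Rightarrow> bool" where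
  "Se_seq n C \<longleftrightarrow> cm n C \<and> eqm n (tr C) C \<and> (\<forall>i<n. \<exists>y\<in>Coh. cg (C i i) (2 * y))"
definition Lprime_seq :: "nat \<Rightarrow> fm \<Rightarrow> bool" where
  "Lprime_seq n C \<longleftrightarrow> Se_seq n C \<and> (\<exists>s E. cv n s \<and> Se_seq n E \<and> eqm n (C + sm 2 (out s s)) (sm 4 E))"
definition L0_seq :: "nat \<Rightarrow> fm \<Rightarrow> bool" where
  "L0_seq n C \<longleftrightarrow> Se_seq n C \<and> detm n C \<notin> I"
definition L1_seq :: "nat \<Rightarrow> fm \<Rightarrow> bool" where
  "L1_seq n C \<longleftrightarrow> Lprime_seq n C \<and> detm n C \<notin> I"

definition Omega_seq :: "nat \<Rightarrow> (fm \<Rightarrow> bool) \<Rightarrow> fm \<Rightarrow> fm \<Rightarrow> bool" where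
  "Omega_seq n P T W \<longleftrightarrow> cm n W \<and> detm n W \<notin> I \<and> (\<exists>C. P C \<and> eqm n T (mm n (mm n (tr W) C) W))"

abbreviation Omega0_seq :: "nat \<Rightarrow> fm \<Rightarrow> fm \<Rightarrow> bool" where "Omega0_seq n \<equiv> Omega_seq n (L0_seq n)"
abbreviation Omega1_seq :: "nat \<Rightarrow> fm \<Rightarrow> fm \<Rightarrow> bool" where "Omega1_seq n \<equiv> Omega_seq n (L1_seq n)"

lemma Omega_seq_cm: "Omega_seq n P T W \<Longrightarrow> cm n W \<and> detm n W \<notin> I"
  unfolding Omega_seq_def by auto

text \<open>An even symmetric matrix has the form F + ^t F; this is how evenness of the
  diagonal is seen to be kept under W |-> ^t W E W.\<close>
lemma Se_seq_split: assumes "Se_seq n E" obtains F where "cm n F" "eqm n E (F + tr F)"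
proof -
  have cE: "cm n E" and sE: "eqm n (tr E) E" and dE: "\<forall>i<n. \<exists>y\<in>Coh. cg (E i i) (2 * y)"
    using assms(1) unfolding Se_seq_def by auto
  define y where "y = (\<lambda>i. SOME y. y \<in> Coh \<and> cg (E i i) (2 * y))"
  have y: "y i \<in> Coh \<and> cg (E i i) (2 * y i)" if "i < n" for i
    using dE that unfolding y_def by (metis (mono_tags, lifting) someI_ex)
  define F where "F = (\<lambda>a b. if a < b then E a b else if a = b then y a else 0)"
  have cF: "cm n F" unfolding F_def using cE y by (auto intro!: cmI dest: cmD)
  have EF: "eqm n E (F + tr F)"
  proof (rule eqm_cgI)
    fix a b assume ab: "a < n" "b < n"
    consider "a < b" | "a = b" | "b < a" by linarith
    then show "cg (E a b) ((F + tr F) a b)"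
    proof cases
      case 1 then show ?thesis by (simp add: F_def)
    next
      case 2
      have e0: "(F + tr F) a b = y a + y a" using 2 unfolding F_def fm_plus_apply tr_apply by simp
      have e: "(F + tr F) a b = 2 * y a" unfolding e0 by (rule mult_2[symmetric])
      show ?thesis unfolding e using y[OF ab(1)] 2 by simp
    next
      case 3
      have "cg (E a b) (E b a)" using eqm_cg[OF sE ab] by (simp add: cg_sym)
      then show ?thesis using 3 by (simp add: F_def)
    qed
  qed
  show ?thesis using that cF EF by blast
qed

lemma Se_seq_cong: assumes "Se_seq n E" "cm n W" shows "Se_seq n (mm n (mm n (tr W) E) W)"
proof -
  have cE: "cm n E" and sE: "eqm n (tr E) E" using assms(1) unfolding Se_seq_def by auto
  obtain F where cF: "cm n F" and EF: "eqm n E (F + tr F)" using Se_seq_split[OF assms(1)] by blast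
  let ?G = "mm n (mm n (tr W) F) W"
  have "eqm n (mm n (mm n (tr W) E) W) (mm n (mm n (tr W) (F + tr F)) W)" by (intro eqm_mm eqm_refl EF)
  also have "eqm n (mm n (mm n (tr W) (F + tr F)) W) (?G + tr ?G)"
    by (simp add: mm_add_r mm_add_l tr_mm mm_assoc)
  finally have G: "eqm n (mm n (mm n (tr W) E) W) (?G + tr ?G)" .
  have cG: "cm n ?G" using cF assms(2) by auto
  show ?thesis unfolding Se_seq_def
  proof (intro conjI allI impI)
    show "cm n (mm n (mm n (tr W) E) W)" using cE assms(2) by auto
    have "eqm n (tr (mm n (mm n (tr W) E) W)) (mm n (mm n (tr W) (tr E)) W)" by (simp add: tr_mm mm_assoc)
    also have "eqm n \<dots> (mm n (mm n (tr W) E) W)" by (intro eqm_mm eqm_refl sE)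
    finally show "eqm n (tr (mm n (mm n (tr W) E) W)) (mm n (mm n (tr W) E) W)" .
    fix i assume i: "i < n"
    have "(?G + tr ?G) i i = 2 * ?G i i" unfolding mult_2 by simp
    then have "cg (mm n (mm n (tr W) E) W i i) (2 * ?G i i)" using eqm_cg[OF G i i] by metis
    then show "\<exists>y\<in>Coh. cg (mm n (mm n (tr W) E) W i i) (2 * y)" using cmD[OF cG i i] by blast
  qed
qed

lemma Se_seq_eqm: assumes "Se_seq n C" "eqm n C C'" "cm n C'" shows "Se_seq n C'"
  unfolding Se_seq_def
proof (intro conjI allI impI)
  show "cm n C'" by fact
  have "eqm n (tr C') (tr C)" using eqm_tr[OF eqm_sym[OF assms(2)]] .
  also have "eqm n (tr C) C" using assms(1) unfolding Se_seq_def by blast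
  also have "eqm n C C'" by fact
  finally show "eqm n (tr C') C'" .
  fix i assume i: "i < n"
  obtain y where "y \<in> Coh" "cg (C i i) (2 * y)" using assms(1) i unfolding Se_seq_def by blast
  moreover have "cg (C' i i) (C i i)" using eqm_cg[OF eqm_sym[OF assms(2)] i i] .
  ultimately show "\<exists>y\<in>Coh. cg (C' i i) (2 * y)" using cg_trans by blast
qed

lemma out_vm: "mm n (mm n (tr W) (out s s)) W = out (vm n s W) (vm n s W)"
proof -
  have "mv n (tr W) s = vm n s W" unfolding mv_def vm_def by (rule ext) (simp add: mult.commute)
  then show ?thesis by (simp add: mm_out_r mm_out_l)
qed

lemma Lprime_seq_cong: assumes "Lprime_seq n C" "cm n W" shows "Lprime_seq n (mm n (mm n (tr W) C) W)"
proof -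
  obtain s E where sE: "cv n s" "Se_seq n E" "eqm n (C + sm 2 (out s s)) (sm 4 E)"
    using assms(1) unfolding Lprime_seq_def by blast
  let ?u = "vm n s W"
  have "eqm n (mm n (mm n (tr W) C) W + sm 2 (out ?u ?u)) (mm n (mm n (tr W) (C + sm 2 (out s s))) W)"
    by (simp add: mm_add_r mm_add_l mm_sm_l mm_sm_r out_vm)
  also have "eqm n \<dots> (mm n (mm n (tr W) (sm 4 E)) W)" by (intro eqm_mm eqm_refl sE(3))
  also have "eqm n \<dots> (sm 4 (mm n (mm n (tr W) E) W))" by (simp add: mm_sm_l mm_sm_r)
  finally have "eqm n (mm n (mm n (tr W) C) W + sm 2 (out ?u ?u)) (sm 4 (mm n (mm n (tr W) E) W))" .
  moreover have "cv n ?u" using sE(1) assms(2) by auto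
  moreover have "Se_seq n (mm n (mm n (tr W) C) W)" using Se_seq_cong assms Lprime_seq_def by blast
  ultimately show ?thesis unfolding Lprime_seq_def using Se_seq_cong[OF sE(2) assms(2)] by blast
qed

lemma Lprime_seq_eqm: assumes "Lprime_seq n C" "eqm n C C'" "cm n C'" shows "Lprime_seq n C'"
proof -
  obtain s E where sE: "cv n s" "Se_seq n E" "eqm n (C + sm 2 (out s s)) (sm 4 E)" using assms(1) unfolding Lprime_seq_def by blast
  have "eqm n (C' + sm 2 (out s s)) (sm 4 E)" using eqm_trans[OF eqm_add[OF eqm_sym[OF assms(2)] eqm_refl] sE(3)] .
  moreover have "Se_seq n C'" using Se_seq_eqm assms Lprime_seq_def by blast
  ultimately show ?thesis unfolding Lprime_seq_def using sE by blast
qed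

lemma detm_congr: "detm n (mm n (mm n (tr W) C) W) = detm n W * detm n W * detm n C"
  by (simp add: detm_mm detm_tr algebra_simps)

lemma nondeg_eqm: assumes "eqm n C C'" "detm n C \<notin> I" shows "detm n C' \<notin> I"
proof
  assume "detm n C' \<in> I"
  moreover have "detm n C - detm n C' \<in> I" using detm_cong[OF assms(1)] .
  ultimately have "(detm n C - detm n C') + detm n C' \<in> I" by (intro I_add)
  then show False using assms(2) by simp
qed

lemma nondeg_congr: assumes "cm n C" "detm n C \<notin> I" "GL_seq n V"
  shows "detm n (mm n (mm n (tr V) C) V) \<notin> I"
proof -
  have u: "unit (detm n V)" using GL_seq_det_unit[OF assms(3)] .
  have "detm n V * detm n C \<notin> I" using val_unit_mult(2)[OF u detm_Coh[OF assms(1)] assms(2)] .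
  moreover have "detm n V * detm n C \<in> Coh" using unit_Coh[OF u] detm_Coh[OF assms(1)] by auto
  ultimately have "detm n V * (detm n V * detm n C) \<notin> I" using val_unit_mult(2)[OF u] by blast
  then show ?thesis unfolding detm_congr by (simp add: mult.assoc)
qed

lemma L0_seq_congr: assumes "L0_seq n C" "GL_seq n V" shows "L0_seq n (mm n (mm n (tr V) C) V)"
proof -
  have C: "Se_seq n C" "detm n C \<notin> I" and cC: "cm n C" using assms(1) unfolding L0_seq_def Se_seq_def by auto
  show ?thesis unfolding L0_seq_def
    using Se_seq_cong[OF C(1) GL_seq_cm[OF assms(2)]] nondeg_congr[OF cC C(2) assms(2)] by simp
qed

lemma L1_seq_congr: assumes "L1_seq n C" "GL_seq n V" shows "L1_seq n (mm n (mm n (tr V) C) V)"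
proof -
  have C: "Lprime_seq n C" "detm n C \<notin> I" and cC: "cm n C"
    using assms(1) unfolding L1_seq_def Lprime_seq_def Se_seq_def by auto
  show ?thesis unfolding L1_seq_def
    using Lprime_seq_cong[OF C(1) GL_seq_cm[OF assms(2)]] nondeg_congr[OF cC C(2) assms(2)] by simp
qed

lemma L0_seq_eqm: "L0_seq n C \<Longrightarrow> eqm n C C' \<Longrightarrow> cm n C' \<Longrightarrow> L0_seq n C'"
  unfolding L0_seq_def using Se_seq_eqm nondeg_eqm by blast

lemma L1_seq_eqm: "L1_seq n C \<Longrightarrow> eqm n C C' \<Longrightarrow> cm n C' \<Longrightarrow> L1_seq n C'"
  unfolding L1_seq_def using Lprime_seq_eqm nondeg_eqm by blast

lemma congr_move: assumes "eqm n T (mm n (mm n (tr W) C) W)" "eqm n (mm n V U) idm"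
  shows "eqm n T (mm n (mm n (tr (mm n U W)) (mm n (mm n (tr V) C) V)) (mm n U W))"
proof -
  have "eqm n (mm n (mm n (tr (mm n U W)) (mm n (mm n (tr V) C) V)) (mm n U W))
     (mm n (mm n (tr W) (mm n (mm n (tr (mm n V U)) C) (mm n V U))) W)"
    by (simp add: tr_mm mm_assoc)
  also have "eqm n \<dots> (mm n (mm n (tr W) (mm n (mm n (tr idm) C) idm)) W)"
    by (intro eqm_mm eqm_tr eqm_refl assms(2))
  also have "eqm n \<dots> (mm n (mm n (tr W) C) W)"
    by (intro eqm_mm eqm_refl) (simp add: eqm_trans[OF eqm_mm_idm_r eqm_mm_idm_l])
  finally show ?thesis using assms(1) eqm_trans eqm_sym by blast
qed

lemma Omega_seq_GL:
  assumes "Omega_seq n P T W" "GL_seq n U"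
    and P: "\<And>C V. P C \<Longrightarrow> GL_seq n V \<Longrightarrow> P (mm n (mm n (tr V) C) V)"
  shows "Omega_seq n P T (mm n U W)"
proof -
  obtain C where C: "P C" "eqm n T (mm n (mm n (tr W) C) W)" using assms(1) unfolding Omega_seq_def by blast
  obtain V where V: "GL_seq n V" "eqm n (mm n V U) idm" using GL_seq_inv[OF assms(2)] by blast
  have cW: "cm n W" "detm n W \<notin> I" using assms(1) unfolding Omega_seq_def by auto
  have "detm n (mm n U W) \<notin> I" unfolding detm_mm
    using val_unit_mult(2)[OF GL_seq_det_unit[OF assms(2)] detm_Coh[OF cW(1)] cW(2)] .
  moreover have "cm n (mm n U W)" using GL_seq_cm[OF assms(2)] cW(1) by auto
  ultimately show ?thesis unfolding Omega_seq_def using P[OF C(1) V(1)] congr_move[OF C(2) V(2)] by blast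
qed

lemma Omega_seq_eqm: assumes "Omega_seq n P T W" "eqm n W W'" "cm n W'" "eqm n T T'"
  shows "Omega_seq n P T' W'"
proof -
  obtain C where C: "P C" "eqm n T (mm n (mm n (tr W) C) W)" using assms(1) unfolding Omega_seq_def by blast
  have "eqm n T' (mm n (mm n (tr W') C) W')"
    using eqm_trans[OF eqm_trans[OF eqm_sym[OF assms(4)] C(2)] eqm_mm[OF eqm_mm[OF eqm_tr[OF assms(2)] eqm_refl] assms(2)]] .
  moreover have "detm n W' \<notin> I" using nondeg_eqm[OF assms(2)] assms(1) unfolding Omega_seq_def by blast
  ultimately show ?thesis unfolding Omega_seq_def using C assms(3) by blast
qed

lemma Omega0_seq_GL: "Omega0_seq n T W \<Longrightarrow> GL_seq n U \<Longrightarrow> Omega0_seq n T (mm n U W)"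
  by (rule Omega_seq_GL) (auto intro: L0_seq_congr)

lemma Omega1_seq_GL: "Omega1_seq n B W \<Longrightarrow> GL_seq n U \<Longrightarrow> Omega1_seq n B (mm n U W)"
  by (rule Omega_seq_GL) (auto intro: L1_seq_congr)

end

section \<open>The bordering construction\<close>

lemma sq_par: assumes "(4::int) dvd a^2 - b^2" shows "2 dvd a - b"
proof (rule ccontr)
  assume a: "\<not> 2 dvd a - b"
  have "a + b = (a - b) + 2 * b" by simp
  have b: "\<not> 2 dvd a + b"
  proof
    assume "2 dvd a + b"
    then have "2 dvd (a + b) - 2 * b" by (rule dvd_diff) simp
    then show False using a by simp
  qed
  have "a^2 - b^2 = (a - b) * (a + b)" by (simp add: power2_eq_square algebra_simps)
  moreover have "2 dvd a^2 - b^2" using assms by (metis dvd_trans dvd_triv_left numeral_Bit0_eq_double mult_2)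
  ultimately have "2 dvd (a - b) * (a + b)" by simp
  then show False using a b by simp
qed

context padic
begin

lemma parity2: assumes "p = 2" "a \<in> Coh" "b \<in> Coh" "cg (a * a - b * b) (4 * y)"
  shows "2 dvd (a - b) 1"
proof -
  have "p^2 dvd (a * a - b * b - 4 * y) 2" using assms(4) unfolding cg_def I_def by blast
  then have "4 dvd (a 2 * a 2 - b 2 * b 2) - 4 * y 2" using assms(1) by simp
  then have "4 dvd a 2 * a 2 - b 2 * b 2" by (rule dvd_diffD1) simp
  then have "4 dvd a 2 ^ 2 - b 2 ^ 2" by (simp add: power2_eq_square)
  then have 1: "2 dvd a 2 - b 2" by (rule sq_par)
  have ab: "a - b \<in> Coh" using Coh_diff[OF assms(2,3)] .
  have "p^1 dvd (a - b) 2 - (a - b) 1" by (rule Coh_le[OF ab]) simp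
  then have "2 dvd (a 2 - b 2) - (a 1 - b 1)" by (simp only: minus_apply power_one_right assms(1))
  then have "2 dvd a 1 - b 1" using 1 by (rule dvd_diffD2)
  then show ?thesis by simp
qed

lemma cancel4_cg: assumes "a \<in> Coh" "b \<in> Coh" "cg (4 * a) (4 * b)" shows "cg a b"
proof -
  have "4 * (a - b) \<in> I" using assms(3) unfolding cg_def by (simp add: algebra_simps)
  then have "a - b \<in> I" using cancel4 assms(1,2) by blast
  then show ?thesis by (simp add: cg_def)
qed

lemma cancel2_cg: assumes "a \<in> Coh" "b \<in> Coh" "cg (2 * a) (2 * b)" shows "cg a b"
proof -
  have "2 * (a - b) \<in> I" using assms(3) unfolding cg_def by (simp add: algebra_simps)
  then have "a - b \<in> I" using cancel2 assms(1,2) by blast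
  then show ?thesis by (simp add: cg_def)
qed

lemma choice_vec: assumes "\<And>j. j < n \<Longrightarrow> \<exists>h\<in>Coh. P j h"
  obtains x where "cv n x" "\<And>j. j < n \<Longrightarrow> P j (x j)"
proof -
  define x where "x = (\<lambda>j. SOME h. h \<in> Coh \<and> P j h)"
  have "x j \<in> Coh \<and> P j (x j)" if "j < n" for j
    using assms[OF that] unfolding x_def by (metis (mono_tags, lifting) someI_ex)
  then show ?thesis using that unfolding cv_def by blast
qed

lemma detm_smidm: "detm n (sm c idm) = c ^ n"
proof -
  have "detm n (sm c idm) = detm n (\<lambda>i j. if i = j then c else 0)"
    by (rule detm_exact) (simp add: idm_def)
  also have "\<dots> = c ^ n" by (simp add: detm_diag)
  finally show ?thesis .
qed

lemma mv_trW: "mv n (tr W) s = vm n s W"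
  unfolding mv_def vm_def by (rule ext) (simp add: mult.commute)

lemma WCW: "mm n (mm n (tr W) (sm 4 E - sm 2 (out s s))) W =
   sm 4 (mm n (mm n (tr W) E) W) - sm 2 (out (vm n s W) (vm n s W))"
  by (simp add: mm_diff_l mm_diff_r mm_sm_l mm_sm_r out_vm)

lemma vm_diff_double:
  assumes "\<And>l. l < n \<Longrightarrow> cg (s2 l - s1 l) (2 * t l)"
  shows "cg (vm n s2 W j - vm n s1 W j) (2 * vm n t W j)"
proof -
  have "vm n s2 W j - vm n s1 W j = (\<Sum>l<n. (s2 l - s1 l) * W l j)" unfolding vm_def
    by (simp add: sum_subtractf[symmetric] algebra_simps)
  moreover have "cg (\<Sum>l<n. (s2 l - s1 l) * W l j) (\<Sum>l<n. (2 * t l) * W l j)"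
    using assms by (intro cg_sum cg_mult cg_refl) auto
  moreover have "(\<Sum>l<n. (2 * t l) * W l j) = 2 * vm n t W j"
    unfolding vm_def by (simp add: sum_distrib_left mult.assoc)
  ultimately show ?thesis by simp
qed

lemma lift_formula: "eqm (Suc n) (mm (Suc n) (mm (Suc n) (tr (bk 1 x zv W)) (bk c s t E)) (bk 1 x zv W))
  (bk c (\<lambda>j. c * x j + vm n s W j) (\<lambda>i. x i * c + mv n (tr W) t i)
     (\<lambda>i j. (x i * c + mv n (tr W) t i) * x j + (x i * vm n s W j + mm n (mm n (tr W) E) W i j)))"
proof -
  have P1: "mm (Suc n) (tr (bk 1 x zv W)) (bk c s t E) =
    bk c s (\<lambda>i. x i * c + mv n (tr W) t i) (out x s + mm n (tr W) E)"
    unfolding tr_bk mm_bk by (rule fmext) (simp add: bk_def)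
  have "mm n (out x s + mm n (tr W) E) W = out x (vm n s W) + mm n (mm n (tr W) E) W"
    by (simp add: mm_add_l mm_out_l)
  then show ?thesis unfolding P1 mm_bk
    by (intro eqm_bk eqv_exact eqm_exact) (simp_all add: fun_eq_iff)
qed

text \<open>4^n det [[2, s], [^t s, E]] = 2 det C when C + 2 ^t s s = 4E (row operations).\<close>
lemma det_trick: assumes "eqm n (C + sm 2 (out s s)) (sm 4 E)"
  shows "cg ((4::R)^n * detm (Suc n) (bk 2 s s E)) (2 * detm n C)"
proof -
  let ?M = "bk 1 zv (\<lambda>i. - 2 * s i) (sm 4 idm)"
  have "detm (Suc n) ?M = detm (Suc n) (tr ?M)" by (simp add: detm_tr)
  also have "\<dots> = detm (Suc n) (bk 1 (\<lambda>i. - 2 * s i) zv (tr (sm 4 idm)))" by (simp add: tr_bk)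
  also have "\<dots> = 4 ^ n" unfolding detm_bk by (simp add: detm_tr detm_smidm)
  finally have dM: "detm (Suc n) ?M = 4 ^ n" .
  have "eqm (Suc n) (mm (Suc n) ?M (bk 2 s s E)) (bk 2 s zv C)"
    unfolding mm_bk
  proof (intro eqm_bk eqv_exact eqm_cgI)
    show "1 * 2 + (\<Sum>l<n. zv l * s l) - 2 \<in> I" by simp
    fix i j assume ij: "i < n" "j < n"
    show "- 2 * s i * 2 + mv n (sm 4 idm) s i = zv i"
      using ij by (simp add: mv_def idm_def if_distrib[of "\<lambda>x. _ * x"] if_distrib[of "\<lambda>x. x * _"] cong: if_cong)
    have m: "mm n (sm 4 idm) E i j = 4 * E i j" using ij by (simp add: mm_sm_l mm_idm_l)
    have "cg (C i j + 2 * (s i * s j)) (4 * E i j)" using eqm_cg[OF assms ij] by simp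
    then have "cg (4 * E i j - 2 * (s i * s j)) (C i j + 2 * (s i * s j) - 2 * (s i * s j))"
      by (rule cg_diff[OF cg_sym cg_refl])
    then show "cg (- 2 * s i * s j + mm n (sm 4 idm) E i j) (C i j)" unfolding m by (simp add: algebra_simps)
  qed (simp_all add: vm_def)
  then have "cg (detm (Suc n) (mm (Suc n) ?M (bk 2 s s E))) (detm (Suc n) (bk 2 s zv C))"
    unfolding cg_def by (rule detm_cong)
  then show ?thesis unfolding detm_mm dM detm_bk .
qed

lemma Se_seq_bk2: assumes "cv n s" "Se_seq n E" shows "Se_seq (Suc n) (bk 2 s s E)"
  unfolding Se_seq_def
proof (intro conjI allI impI)
  have cE: "cm n E" "eqm n (tr E) E" using assms(2) unfolding Se_seq_def by auto
  show "cm (Suc n) (bk 2 s s E)" using assms(1) cE by (intro cm_bk) auto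
  show "eqm (Suc n) (tr (bk 2 s s E)) (bk 2 s s E)" unfolding tr_bk by (intro eqm_bk cE) auto
  fix i assume i: "i < Suc n"
  show "\<exists>y\<in>Coh. cg (bk 2 s s E i i) (2 * y)"
  proof (cases i)
    case 0 then show ?thesis by (intro bexI[of _ 1]) auto
  next
    case (Suc i')
    then show ?thesis using assms(2) i unfolding Se_seq_def by simp
  qed
qed

text \<open>If 8 y1 - 2 a^2 = 8 y2 - 2 b^2 then a - b is divisible by 2.  This is where the
  hypotheses on the diagonals are used: for odd p it is trivial, for p = 2 it follows
  from a^2 = b^2 mod 4.\<close>
lemma half_diff:
  assumes "a \<in> Coh" "b \<in> Coh" "y1 \<in> Coh" "y2 \<in> Coh"
    and "cg (4 * (2 * y1) - 2 * (a * a)) (4 * (2 * y2) - 2 * (b * b))"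
  shows "\<exists>h\<in>Coh. cg (a - b) (2 * h)"
proof -
  have X: "cg (2 * (a * a - b * b)) (2 * (4 * (y1 - y2)))"
    using cg_sym[OF assms(5)] unfolding cg_def by (simp add: algebra_simps)
  have "cg (a * a - b * b) (4 * (y1 - y2))"
    by (rule cancel2_cg[OF _ _ X]) (use assms(1-4) in auto)
  then have "p = 2 \<Longrightarrow> 2 dvd (a - b) 1" using parity2 assms(1,2) by blast
  then have "\<exists>h\<in>Coh. (a - b) - 2 * h \<in> I" using half[of "a - b"] assms(1,2) by auto
  then show ?thesis unfolding cg_def .
qed

lemma Se_seq_border:
  assumes "Se_seq (Suc n) (bk c s t E)"
  shows "Se_seq n E" "eqv n t s"
proof -
  have cC: "cm (Suc n) (bk c s t E)" and tC: "eqm (Suc n) (bk c t s (tr E)) (bk c s t E)"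
    using assms unfolding Se_seq_def tr_bk by auto
  show "eqv n t s" using eqm_bkD(2)[OF tC] .
  show "Se_seq n E" unfolding Se_seq_def
  proof (intro conjI allI impI)
    show "cm n E" using cm_bk_parts(4)[OF cC] by simp
    show "eqm n (tr E) E" using eqm_bkD(4)[OF tC] .
    fix i assume "i < n"
    then show "\<exists>y\<in>Coh. cg (E i i) (2 * y)" using assms unfolding Se_seq_def by fastforce
  qed
qed

lemma Lprime_seq_form: assumes "cv n s" "Se_seq n E" shows "Lprime_seq n (sm 4 E - sm 2 (out s s))"
proof -
  let ?C = "sm 4 E - sm 2 (out s s)"
  have cE: "cm n E" "eqm n (tr E) E" using assms(2) unfolding Se_seq_def by auto
  have SC: "Se_seq n ?C" unfolding Se_seq_def
  proof (intro conjI allI impI)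
    show "cm n ?C" using cE assms(1) by (intro cm_diff cm_sm cm_out) auto
    have "eqm n (tr ?C) (sm 4 (tr E) - sm 2 (out s s))" by (simp add: tr_diff tr_sm tr_out)
    also have "eqm n \<dots> ?C" by (intro eqm_diff eqm_sm cE eqm_refl)
    finally show "eqm n (tr ?C) ?C" .
    fix i assume i: "i < n"
    obtain y where y: "y \<in> Coh" "cg (E i i) (2 * y)" using assms(2) i unfolding Se_seq_def by blast
    have e: "?C i i = 4 * E i i - 2 * (s i * s i)" by simp
    have "cg (?C i i) (4 * (2 * y) - 2 * (s i * s i))"
      unfolding e by (rule cg_diff[OF cg_mult[OF cg_refl y(2)] cg_refl])
    also have "cg \<dots> (2 * (4 * y - s i * s i))" by (rule cg_eq) (simp add: algebra_simps)
    finally have X: "cg (?C i i) (2 * (4 * y - s i * s i))" .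
    have "4 * y - s i * s i \<in> Coh" using y(1) cvD[OF assms(1) i] by auto
    then show "\<exists>y\<in>Coh. cg (?C i i) (2 * y)" using X by blast
  qed
  show ?thesis unfolding Lprime_seq_def using SC assms
    by (intro conjI exI[of _ s] exI[of _ E]) (auto intro!: eqm_exact)
qed

lemma congr_inj:
  assumes "cm n W" "detm n W \<notin> I" "cm n C1" "cm n C2"
    "eqm n B (mm n (mm n (tr W) C1) W)" "eqm n B (mm n (mm n (tr W) C2) W)"
  shows "eqm n C1 C2"
proof -
  have "eqm n (mm n (mm n (tr W) (C1 - C2)) W) (mm n (mm n (tr W) C1) W - mm n (mm n (tr W) C2) W)"
    by (simp add: mm_diff_l mm_diff_r)
  also have "eqm n \<dots> (B - B)" by (rule eqm_diff[OF eqm_sym[OF assms(5)] eqm_sym[OF assms(6)]])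
  finally have "eqm n (mm n (mm n (tr W) (C1 - C2)) W) 0" by simp
  then have "eqm n (C1 - C2) 0" using cancel_mat[OF assms(1,2)] assms(3,4) by blast
  then show ?thesis unfolding eqm_def by simp
qed

text \<open>If 4 E1 - 2 ^t s1 s1 = 4 E2 - 2 ^t s2 s2 with E1, E2 even symmetric, then
  s2 - s1 is divisible by 2 (compare the diagonals with half_diff).\<close>
lemma half_diff_vec:
  assumes "cv n s1" "cv n s2" "Se_seq n E1" "Se_seq n E2"
    and CC: "eqm n (sm 4 E1 - sm 2 (out s1 s1)) (sm 4 E2 - sm 2 (out s2 s2))"
  obtains t where "cv n t" "\<And>j. j < n \<Longrightarrow> cg (s2 j - s1 j) (2 * t j)"
proof -
  have "\<exists>h\<in>Coh. cg (s2 j - s1 j) (2 * h)" if jn: "j < n" for j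
  proof -
    obtain y1 where y1: "y1 \<in> Coh" "cg (E1 j j) (2 * y1)" using assms(3) jn unfolding Se_seq_def by blast
    obtain y2 where y2: "y2 \<in> Coh" "cg (E2 j j) (2 * y2)" using assms(4) jn unfolding Se_seq_def by blast
    have "cg (4 * (2 * y2) - 2 * (s2 j * s2 j)) (4 * E2 j j - 2 * (s2 j * s2 j))"
      by (rule cg_diff[OF cg_mult[OF cg_refl cg_sym[OF y2(2)]] cg_refl])
    also have "cg \<dots> (4 * E1 j j - 2 * (s1 j * s1 j))" using cg_sym[OF eqm_cg[OF CC jn jn]] by simp
    also have "cg \<dots> (4 * (2 * y1) - 2 * (s1 j * s1 j))"
      by (rule cg_diff[OF cg_mult[OF cg_refl y1(2)] cg_refl])
    finally show ?thesis using half_diff cvD[OF assms(2) jn] cvD[OF assms(1) jn] y1(1) y2(1) by blast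
  qed
  then show ?thesis using that choice_vec[of n "\<lambda>j h. cg (s2 j - s1 j) (2 * h)"] by blast
qed

lemma border_L0:
  assumes "cv n s" "Se_seq n E" "eqm n (C + sm 2 (out s s)) (sm 4 E)" "Se_seq n C" "detm n C \<notin> I"
  shows "L0_seq (Suc n) (bk 2 s s E)"
  unfolding L0_seq_def
proof
  show "Se_seq (Suc n) (bk 2 s s E)" by (rule Se_seq_bk2[OF assms(1,2)])
  show "detm (Suc n) (bk 2 s s E) \<notin> I"
  proof
    assume a: "detm (Suc n) (bk 2 s s E) \<in> I"
    have "cg ((4::R)^n * detm (Suc n) (bk 2 s s E)) (2 * detm n C)" by (rule det_trick[OF assms(3)])
    moreover have "cg ((4::R)^n * detm (Suc n) (bk 2 s s E)) 0" using a unfolding cg_def by auto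
    ultimately have "2 * detm n C \<in> I" using cg_trans cg_sym cg_I0 by blast
    moreover have "detm n C \<in> Coh" using detm_Coh assms(4) unfolding Se_seq_def by blast
    ultimately show False using cancel2 assms(5) by blast
  qed
qed

end

text \<open>The data of the theorem at sequence level: B (doubled, of size n = m - 1),
  its vector rho = r_B and the matrix Dm = D with B + 2 ^t rho rho = 4 Dm.  T is the
  bordered matrix 2B^(1) = [[2, rho], [^t rho, Dm]].\<close>
locale lift_setup = padic +
  fixes n :: nat and B Dm :: fm and \<rho> :: "nat \<Rightarrow> R"
  assumes dB: "detm n B \<notin> I" and cr: "cv n \<rho>" and sD: "Se_seq n Dm"
    and hyp: "eqm n (B + sm 2 (out \<rho> \<rho>)) (sm 4 Dm)"
begin

definition T :: fm where "T = bk 2 \<rho> \<rho> Dm"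

lemma B_form: "i < n \<Longrightarrow> j < n \<Longrightarrow> cg (B i j) (4 * Dm i j - 2 * (\<rho> i * \<rho> j))"
proof -
  assume ij: "i < n" "j < n"
  have "cg (B i j + 2 * (\<rho> i * \<rho> j)) (4 * Dm i j)" using eqm_cg[OF hyp ij] by simp
  then have "cg (B i j + 2 * (\<rho> i * \<rho> j) - 2 * (\<rho> i * \<rho> j)) (4 * Dm i j - 2 * (\<rho> i * \<rho> j))"
    by (intro cg_diff) auto
  then show ?thesis by simp
qed

lemma lift_vector_exists:
  assumes "cv n u" "Se_seq n G" "eqm n B (sm 4 G - sm 2 (out u u))"
  obtains x where "cv n x" "\<And>j. j < n \<Longrightarrow> cg (\<rho> j) (2 * x j + u j)"
proof -
  have "\<exists>h\<in>Coh. cg (\<rho> j - u j) (2 * h)" if jn: "j < n" for j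
  proof -
    obtain y1 where y1: "y1 \<in> Coh" "cg (Dm j j) (2 * y1)" using sD jn unfolding Se_seq_def by blast
    obtain y2 where y2: "y2 \<in> Coh" "cg (G j j) (2 * y2)" using assms(2) jn unfolding Se_seq_def by blast
    have "cg (4 * (2 * y1) - 2 * (\<rho> j * \<rho> j)) (4 * Dm j j - 2 * (\<rho> j * \<rho> j))"
      by (intro cg_diff cg_mult cg_refl cg_sym[OF y1(2)])
    also have "cg \<dots> (B j j)" by (rule cg_sym[OF B_form[OF jn jn]])
    also have "cg \<dots> (4 * G j j - 2 * (u j * u j))" using eqm_cg[OF assms(3) jn jn] by simp
    also have "cg \<dots> (4 * (2 * y2) - 2 * (u j * u j))" by (intro cg_diff cg_mult cg_refl y2(2))
    finally show ?thesis using half_diff cvD[OF cr jn] cvD[OF assms(1) jn] y1(1) y2(1) by blast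
  qed
  then obtain x where x: "cv n x" "\<And>j. j < n \<Longrightarrow> cg (\<rho> j - u j) (2 * x j)"
    using choice_vec[of n "\<lambda>j h. cg (\<rho> j - u j) (2 * h)"] by blast
  have "cg (\<rho> j) (2 * x j + u j)" if "j < n" for j
    using x(2)[OF that] unfolding cg_def by (simp add: algebra_simps)
  then show ?thesis using that x(1) by blast
qed

lemma lift_congruence:
  assumes x: "cv n x" and s: "cv n s" and W: "cm n W" and E: "cm n E"
    and rx: "\<And>j. j < n \<Longrightarrow> cg (\<rho> j) (2 * x j + vm n s W j)"
    and BG: "eqm n B (sm 4 (mm n (mm n (tr W) E) W) - sm 2 (out (vm n s W) (vm n s W)))"
  shows "eqm (Suc n) T (mm (Suc n) (mm (Suc n) (tr (bk 1 x zv W)) (bk 2 s s E)) (bk 1 x zv W))"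
proof (rule eqm_trans[OF _ eqm_sym[OF lift_formula]])
  define u where "u = vm n s W"
  define G where "G = mm n (mm n (tr W) E) W"
  have cu: "cv n u" unfolding u_def using s W by auto
  have cG: "cm n G" unfolding G_def using E W by auto
  have cD: "cm n Dm" using sD unfolding Se_seq_def by auto
  show "eqm (Suc n) T (bk 2 (\<lambda>j. 2 * x j + vm n s W j) (\<lambda>i. x i * 2 + mv n (tr W) s i)
     (\<lambda>i j. (x i * 2 + mv n (tr W) s i) * x j + (x i * vm n s W j + mm n (mm n (tr W) E) W i j)))"
    unfolding T_def mv_trW u_def[symmetric] G_def[symmetric]
  proof (intro eqm_bk eqv_cgI eqm_cgI)
    show "2 - 2 \<in> I" by simp
    fix i j assume ij: "i < n" "j < n"
    have rxi: "cg (\<rho> i) (2 * x i + u i)" and rxj: "cg (\<rho> j) (2 * x j + u j)"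
      using rx ij unfolding u_def by auto
    have BGij: "cg (B i j) (4 * G i j - 2 * (u i * u j))"
      using eqm_cg[OF BG ij] unfolding u_def G_def by simp
    show "cg (\<rho> i) (2 * x i + u i)" by (rule rxi)
    show "cg (\<rho> i) (x i * 2 + u i)" using rxi by (simp add: mult.commute)
    have "cg (4 * Dm i j) (B i j + 2 * (\<rho> i * \<rho> j))" using eqm_cg[OF hyp ij] by (simp add: cg_sym)
    also have "cg \<dots> ((4 * G i j - 2 * (u i * u j)) + 2 * ((2 * x i + u i) * (2 * x j + u j)))"
      by (intro cg_add cg_mult cg_refl BGij rxi rxj)
    also have "cg \<dots> (4 * ((x i * 2 + u i) * x j + (x i * u j + G i j)))"
      by (rule cg_eq) (simp add: algebra_simps)
    finally have X4: "cg (4 * Dm i j) (4 * ((x i * 2 + u i) * x j + (x i * u j + G i j)))" .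
    show "cg (Dm i j) ((x i * 2 + u i) * x j + (x i * u j + G i j))"
      by (rule cancel4_cg[OF _ _ X4]) (use cmD[OF cD ij] cvD[OF x] cvD[OF cu] cmD[OF cG ij] ij in auto)
  qed
qed

lemma lift_exists: assumes "Omega1_seq n B W" shows "\<exists>x. cv n x \<and> Omega0_seq (Suc n) T (bk 1 x zv W)"
proof -
  obtain C where C: "L1_seq n C" "eqm n B (mm n (mm n (tr W) C) W)" using assms unfolding Omega_seq_def by blast
  have cW: "cm n W" "detm n W \<notin> I" using assms unfolding Omega_seq_def by auto
  obtain s E where sE: "cv n s" "Se_seq n E" "eqm n (C + sm 2 (out s s)) (sm 4 E)"
    using C(1) unfolding L1_seq_def Lprime_seq_def by blast
  have dC: "Se_seq n C" "detm n C \<notin> I" using C(1) unfolding L1_seq_def Lprime_seq_def by auto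
  have "eqm n (C + sm 2 (out s s) - sm 2 (out s s)) (sm 4 E - sm 2 (out s s))" by (rule eqm_diff[OF sE(3) eqm_refl])
  then have CE: "eqm n C (sm 4 E - sm 2 (out s s))" by simp
  have BG: "eqm n B (sm 4 (mm n (mm n (tr W) E) W) - sm 2 (out (vm n s W) (vm n s W)))"
    using eqm_trans[OF C(2) eqm_mm[OF eqm_mm[OF eqm_refl CE] eqm_refl], unfolded WCW] .
  obtain x where x: "cv n x" "\<And>j. j < n \<Longrightarrow> cg (\<rho> j) (2 * x j + vm n s W j)"
    using lift_vector_exists[OF cv_vm[OF sE(1) cW(1)] Se_seq_cong[OF sE(2) cW(1)] BG] by blast
  have cE: "cm n E" using sE(2) unfolding Se_seq_def by blast
  have "Omega0_seq (Suc n) T (bk 1 x zv W)" unfolding Omega_seq_def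
  proof (intro conjI exI[of _ "bk 2 s s E"])
    show "cm (Suc n) (bk 1 x zv W)" using x(1) cW(1) by (intro cm_bk) auto
    show "detm (Suc n) (bk 1 x zv W) \<notin> I" using cW(2) by (simp add: detm_bk)
    show "L0_seq (Suc n) (bk 2 s s E)" by (rule border_L0[OF sE dC])
    show "eqm (Suc n) T (mm (Suc n) (mm (Suc n) (tr (bk 1 x zv W)) (bk 2 s s E)) (bk 1 x zv W))"
      by (rule lift_congruence[OF x(1) sE(1) cW(1) cE x(2) BG])
  qed
  then show ?thesis using x(1) by blast
qed

lemma lift_equations:
  assumes TC: "eqm (Suc n) T (mm (Suc n) (mm (Suc n) (tr (bk 1 x zv W)) (bk c s t E)) (bk 1 x zv W))"
    and ts: "eqv n t s"
  defines "u \<equiv> vm n s W" and "G \<equiv> mm n (mm n (tr W) E) W"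
  shows "\<And>j. j < n \<Longrightarrow> cg (\<rho> j) (2 * x j + u j)" and "eqm n B (sm 4 G - sm 2 (out u u))"
proof -
  have "eqm (Suc n) T (bk c (\<lambda>j. c * x j + u j) (\<lambda>i. x i * c + mv n (tr W) t i)
     (\<lambda>i j. (x i * c + mv n (tr W) t i) * x j + (x i * u j + G i j)))"
    unfolding u_def G_def using eqm_trans[OF TC lift_formula] .
  note parts = eqm_bkD[OF this[unfolded T_def]]
  have c2: "cg c 2" using parts(1) unfolding cg_def by (simp add: I_sym)
  have tu: "cg (mv n (tr W) t i) (u i)" for i
  proof -
    have "cg (mv n (tr W) t i) (mv n (tr W) s i)" unfolding mv_def
      by (rule cg_sum) (auto intro!: cg_mult eqv_cg[OF ts])
    then show ?thesis by (simp add: mv_trW u_def)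
  qed
  show rx: "cg (\<rho> j) (2 * x j + u j)" if "j < n" for j
  proof -
    have "cg (\<rho> j) (c * x j + u j)" using eqv_cg[OF parts(2) that] by simp
    also have "cg \<dots> (2 * x j + u j)" by (intro cg_add cg_mult c2 cg_refl)
    finally show ?thesis .
  qed
  show "eqm n B (sm 4 G - sm 2 (out u u))"
  proof (rule eqm_cgI)
    fix i j assume ij: "i < n" "j < n"
    have "cg (Dm i j) ((x i * c + mv n (tr W) t i) * x j + (x i * u j + G i j))"
      using eqm_cg[OF parts(4) ij] by simp
    also have "cg \<dots> ((x i * 2 + u i) * x j + (x i * u j + G i j))"
      by (intro cg_add cg_mult cg_refl c2 tu)
    finally have D1: "cg (Dm i j) ((x i * 2 + u i) * x j + (x i * u j + G i j))" .
    have "cg (B i j) (4 * Dm i j - 2 * (\<rho> i * \<rho> j))" by (rule B_form[OF ij])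
    also have "cg \<dots> (4 * ((x i * 2 + u i) * x j + (x i * u j + G i j)) - 2 * ((2 * x i + u i) * (2 * x j + u j)))"
      by (intro cg_diff cg_mult cg_refl D1 rx[OF ij(1)] rx[OF ij(2)])
    also have "cg \<dots> ((sm 4 G - sm 2 (out u u)) i j)" by (rule cg_eq) (simp add: algebra_simps)
    finally show "cg (B i j) ((sm 4 G - sm 2 (out u u)) i j)" .
  qed
qed

lemma lift_decomp: assumes "cv n x" "cm n W" "Omega0_seq (Suc n) T (bk 1 x zv W)"
  shows "\<exists>s E. cv n s \<and> Se_seq n E \<and> (\<forall>j<n. cg (\<rho> j) (2 * x j + vm n s W j)) \<and>
     eqm n B (sm 4 (mm n (mm n (tr W) E) W) - sm 2 (out (vm n s W) (vm n s W)))"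
proof -
  obtain C' where C': "L0_seq (Suc n) C'" "eqm (Suc n) T (mm (Suc n) (mm (Suc n) (tr (bk 1 x zv W)) C') (bk 1 x zv W))"
    using assms(3) unfolding Omega_seq_def by blast
  have sC': "Se_seq (Suc n) C'" using C'(1) unfolding L0_seq_def by auto
  define c where "c = C' 0 0"
  define s where "s = (\<lambda>j. C' 0 (Suc j))"
  define t where "t = (\<lambda>i. C' (Suc i) 0)"
  define E where "E = (\<lambda>i j. C' (Suc i) (Suc j))"
  have C'eq: "C' = bk c s t E" unfolding c_def s_def t_def E_def by (rule bk_decomp)
  have cs: "cv n s" using cm_bk_parts(2)[of n C'] sC' unfolding s_def Se_seq_def by auto
  note border = Se_seq_border[OF sC'[unfolded C'eq]]
  note eqs = lift_equations[OF C'(2)[unfolded C'eq] border(2)]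
  show ?thesis using cs border(1) eqs by blast
qed

lemma lift_reverse: assumes "cv n x" "cm n W" "Omega0_seq (Suc n) T (bk 1 x zv W)" shows "Omega1_seq n B W"
proof -
  obtain s E where sE: "cv n s" "Se_seq n E" "eqm n B (sm 4 (mm n (mm n (tr W) E) W) - sm 2 (out (vm n s W) (vm n s W)))"
    using lift_decomp[OF assms] by blast
  let ?C = "sm 4 E - sm 2 (out s s)"
  have BC: "eqm n B (mm n (mm n (tr W) ?C) W)" using sE(3) unfolding WCW .
  have LC: "Lprime_seq n ?C" by (rule Lprime_seq_form[OF sE(1,2)])
  have dW: "detm n W \<notin> I" using assms(3) unfolding Omega_seq_def by (simp add: detm_bk)
  have dC: "detm n ?C \<notin> I"
  proof
    assume a: "detm n ?C \<in> I"
    have "detm n B - detm n (mm n (mm n (tr W) ?C) W) \<in> I" using detm_cong[OF BC] .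
    moreover have "detm n (mm n (mm n (tr W) ?C) W) \<in> I" unfolding detm_congr using a by auto
    ultimately have "detm n B \<in> I" by (metis I_add diff_add_cancel)
    then show False using dB by simp
  qed
  show ?thesis unfolding Omega_seq_def L1_seq_def using assms(2) dW BC LC dC by blast
qed

lemma lift_unique: assumes "cv n x1" "cv n x2" "cm n W" "detm n W \<notin> I"
  "Omega0_seq (Suc n) T (bk 1 x1 zv W)" "Omega0_seq (Suc n) T (bk 1 x2 zv W)"
  shows "\<exists>U. GL_seq (Suc n) U \<and> eqm (Suc n) (bk 1 x1 zv W) (mm (Suc n) U (bk 1 x2 zv W))"
proof -
  obtain s1 E1 where s1: "cv n s1" "Se_seq n E1" "\<forall>j<n. cg (\<rho> j) (2 * x1 j + vm n s1 W j)"
    "eqm n B (mm n (mm n (tr W) (sm 4 E1 - sm 2 (out s1 s1))) W)"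
    using lift_decomp[OF assms(1,3,5)] unfolding WCW by blast
  obtain s2 E2 where s2: "cv n s2" "Se_seq n E2" "\<forall>j<n. cg (\<rho> j) (2 * x2 j + vm n s2 W j)"
    "eqm n B (mm n (mm n (tr W) (sm 4 E2 - sm 2 (out s2 s2))) W)"
    using lift_decomp[OF assms(2,3,6)] unfolding WCW by blast
  have cE: "cm n E1" "cm n E2" using s1(2) s2(2) unfolding Se_seq_def by auto
  have "cm n (sm 4 E1 - sm 2 (out s1 s1))" "cm n (sm 4 E2 - sm 2 (out s2 s2))"
    using cE s1(1) s2(1) by (auto intro!: cm_diff cm_sm cm_out)
  then have "eqm n (sm 4 E1 - sm 2 (out s1 s1)) (sm 4 E2 - sm 2 (out s2 s2))"
    using congr_inj[OF assms(3,4) _ _ s1(4) s2(4)] by blast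
  then obtain t where t: "cv n t" "\<And>j. j < n \<Longrightarrow> cg (s2 j - s1 j) (2 * t j)"
    using half_diff_vec[OF s1(1) s2(1) s1(2) s2(2)] by blast
  have x12: "cg (x1 j) (x2 j + vm n t W j)" if jn: "j < n" for j
  proof -
    have "cg (2 * x1 j + vm n s1 W j) (\<rho> j)" using s1(3) jn by (simp add: cg_sym)
    also have "cg \<dots> (2 * x2 j + vm n s2 W j)" using s2(3) jn by simp
    finally have "cg (2 * x1 j + vm n s1 W j - vm n s1 W j) (2 * x2 j + vm n s2 W j - vm n s1 W j)"
      by (intro cg_diff cg_refl)
    also have "cg \<dots> (2 * x2 j + (vm n s2 W j - vm n s1 W j))" by (rule cg_eq) (simp add: algebra_simps)
    also have "cg \<dots> (2 * x2 j + 2 * vm n t W j)" by (rule cg_add[OF cg_refl vm_diff_double[OF t(2)]])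
    finally have X: "cg (2 * x1 j) (2 * (x2 j + vm n t W j))" by (simp add: algebra_simps)
    have "x1 j \<in> Coh" "x2 j + vm n t W j \<in> Coh" using cvD[OF assms(1) jn] cvD[OF assms(2) jn]
      cvD[OF cv_vm[OF t(1) assms(3)] jn] by auto
    then show ?thesis by (intro cancel2_cg[OF _ _ X])
  qed
  have "eqm (Suc n) (bk 1 x1 zv W) (mm (Suc n) (bk 1 t zv idm) (bk 1 x2 zv W))"
    unfolding mm_bk
  proof (intro eqm_bk eqv_cgI eqm_exact)
    fix j assume "j < n"
    then show "cg (x1 j) (1 * x2 j + vm n t W j)" using x12 by simp
  qed (simp_all add: mm_idm_l)
  then show ?thesis using GL_seq_unip[OF t(1)] by blast
qed

text \<open>The first column of any W2 in Omega^(0)(T) contains a unit: otherwise p^2 would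
  divide the corner entry 2 of T = ^t W2 C W2.\<close>
lemma first_column_unit: assumes "Omega0_seq (Suc n) T W2" shows "\<exists>a<Suc n. \<not> p dvd W2 a 0 1"
proof (rule ccontr)
  obtain C where C: "L0_seq (Suc n) C" "eqm (Suc n) T (mm (Suc n) (mm (Suc n) (tr W2) C) W2)"
    using assms unfolding Omega_seq_def by blast
  have cW: "cm (Suc n) W2" using assms unfolding Omega_seq_def by auto
  assume "\<not> (\<exists>a<Suc n. \<not> p dvd W2 a 0 1)"
  then have dv: "p dvd W2 a 0 1" if "a < Suc n" for a using that by blast
  have "\<exists>h\<in>Coh. W2 a 0 - of_int p * h \<in> I" if "a < Suc n" for a
    using divp[OF cmD[OF cW that] dv[OF that]] by blast
  then obtain w where w: "cv (Suc n) w" "\<And>a. a < Suc n \<Longrightarrow> W2 a 0 - of_int p * w a \<in> I"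
    using choice_vec[of "Suc n" "\<lambda>a h. W2 a 0 - of_int p * h \<in> I"] by blast
  have wc: "cg (W2 a 0) (of_int p * w a)" if "a < Suc n" for a using w(2)[OF that] by (simp add: cg_def)
  have "cg 2 (mm (Suc n) (mm (Suc n) (tr W2) C) W2 0 0)" using eqm_cg[OF C(2), of 0 0] by (simp add: T_def)
  also have "mm (Suc n) (mm (Suc n) (tr W2) C) W2 0 0 = (\<Sum>l<Suc n. (\<Sum>q<Suc n. W2 q 0 * C q l) * W2 l 0)"
    by (simp add: mm_def)
  also have "cg \<dots> (\<Sum>l<Suc n. (\<Sum>q<Suc n. (of_int p * w q) * C q l) * (of_int p * w l))"
    by (intro cg_sum cg_mult cg_refl wc) auto
  also have "\<dots> = of_int p ^ 2 * (\<Sum>l<Suc n. (\<Sum>q<Suc n. w q * C q l) * w l)"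
    by (simp add: sum_distrib_left sum_distrib_right power2_eq_square algebra_simps)
  finally have X: "cg 2 (of_int p ^ 2 * (\<Sum>l<Suc n. (\<Sum>q<Suc n. w q * C q l) * w l))" .
  define S where "S = (\<Sum>l<Suc n. (\<Sum>q<Suc n. w q * C q l) * w l)"
  have "2 - of_int p ^ 2 * S \<in> I" using X unfolding cg_def S_def .
  then have "p^2 dvd (2 - of_int p ^ 2 * S) 2" unfolding I_def by blast
  then have "p^2 dvd 2 - p^2 * S 2" by (simp add: power_fun_apply)
  then have "p^2 dvd 2" by (rule dvd_diffD1) simp
  then have "p^2 \<le> 2" by (rule zdvd_imp_le) simp
  moreover have "p^2 \<ge> 2^2" using p_gt1 by (intro power_mono) auto
  ultimately show False by simp
qed

lemma surj_lift: assumes "Omega0_seq (Suc n) T W2"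
  shows "\<exists>U x W. GL_seq (Suc n) U \<and> cv n x \<and> cm n W \<and> eqm (Suc n) (mm (Suc n) U W2) (bk 1 x zv W)"
proof -
  have cW: "cm (Suc n) W2" using assms unfolding Omega_seq_def by auto
  obtain a where "a < Suc n" "\<not> p dvd W2 a 0 1" using first_column_unit[OF assms] by blast
  then show ?thesis using pivot_column[OF cW] by metis
qed

lemma first_col: assumes "eqm (Suc n) (mm (Suc n) V (bk 1 x zv W)) (bk 1 x' zv W')"
  shows "cg (V 0 0) 1" "eqv n (\<lambda>i. V (Suc i) 0) zv" "eqm n (mm n (\<lambda>i j. V (Suc i) (Suc j)) W) W'"
proof -
  have "V = bk (V 0 0) (\<lambda>j. V 0 (Suc j)) (\<lambda>i. V (Suc i) 0) (\<lambda>i j. V (Suc i) (Suc j))" by (rule bk_decomp)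
  then have e: "eqm (Suc n) (bk (V 0 0 * 1 + (\<Sum>l<n. V 0 (Suc l) * zv l)) (\<lambda>j. V 0 0 * x j + vm n (\<lambda>j. V 0 (Suc j)) W j)
     (\<lambda>i. V (Suc i) 0 * 1 + mv n (\<lambda>i j. V (Suc i) (Suc j)) zv i)
     (\<lambda>i j. V (Suc i) 0 * x j + mm n (\<lambda>i j. V (Suc i) (Suc j)) W i j)) (bk 1 x' zv W')"
    using assms by (metis mm_bk)
  note d = eqm_bkD[OF e]
  show "cg (V 0 0) 1" using d(1) by (simp add: cg_def)
  show c0: "eqv n (\<lambda>i. V (Suc i) 0) zv" using d(3) by simp
  show "eqm n (mm n (\<lambda>i j. V (Suc i) (Suc j)) W) W'"
  proof (rule eqm_cgI)
    fix i j assume ij: "i < n" "j < n"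
    have "cg (mm n (\<lambda>i j. V (Suc i) (Suc j)) W i j) (V (Suc i) 0 * x j + mm n (\<lambda>i j. V (Suc i) (Suc j)) W i j)"
    proof -
      have "cg (0 * x j + mm n (\<lambda>i j. V (Suc i) (Suc j)) W i j) (V (Suc i) 0 * x j + mm n (\<lambda>i j. V (Suc i) (Suc j)) W i j)"
        using eqv_cg[OF c0 ij(1)] by (intro cg_add cg_mult cg_refl) (simp add: cg_sym)
      then show ?thesis by simp
    qed
    also have "cg \<dots> (W' i j)" using eqm_cg[OF d(4) ij] by simp
    finally show "cg (mm n (\<lambda>i j. V (Suc i) (Suc j)) W i j) (W' i j)" .
  qed
qed

lemma sub_prod: assumes "eqm (Suc n) (mm (Suc n) V1 V2) idm" "eqv n (\<lambda>i. V1 (Suc i) 0) zv"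
  shows "eqm n (mm n (\<lambda>i j. V1 (Suc i) (Suc j)) (\<lambda>i j. V2 (Suc i) (Suc j))) idm"
proof (rule eqm_cgI)
  fix i j assume ij: "i < n" "j < n"
  let ?M = "mm n (\<lambda>i j. V1 (Suc i) (Suc j)) (\<lambda>i j. V2 (Suc i) (Suc j)) i j"
  have e: "mm (Suc n) V1 V2 (Suc i) (Suc j) = V1 (Suc i) 0 * V2 0 (Suc j) + ?M"
    unfolding mm_def sum.lessThan_Suc_shift by simp
  have "cg (0 * V2 0 (Suc j) + ?M) (V1 (Suc i) 0 * V2 0 (Suc j) + ?M)"
    using eqv_cg[OF assms(2) ij(1)] by (intro cg_add cg_mult cg_refl) (simp add: cg_sym)
  also have "cg \<dots> (idm (Suc i) (Suc j))" unfolding e[symmetric] by (rule eqm_cg[OF assms(1)]) (use ij in auto)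
  finally show "cg ?M (idm i j)" by (simp add: idm_def)
qed

lemma inj_lift: assumes "GL_seq (Suc n) V" "eqm (Suc n) (mm (Suc n) V (bk 1 x zv W)) (bk 1 x' zv W')"
  shows "\<exists>U. GL_seq n U \<and> eqm n (mm n U W) W'"
proof -
  obtain Vv where Vv: "GL_seq (Suc n) Vv" "eqm (Suc n) (mm (Suc n) V Vv) idm" "eqm (Suc n) (mm (Suc n) Vv V) idm"
    using GL_seq_inv[OF assms(1)] by blast
  have "eqm (Suc n) (mm (Suc n) Vv (bk 1 x' zv W')) (mm (Suc n) Vv (mm (Suc n) V (bk 1 x zv W)))"
    by (intro eqm_mm eqm_refl eqm_sym[OF assms(2)])
  also have "eqm (Suc n) \<dots> (mm (Suc n) (mm (Suc n) Vv V) (bk 1 x zv W))" by (simp add: mm_assoc)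
  also have "eqm (Suc n) \<dots> (mm (Suc n) idm (bk 1 x zv W))" by (intro eqm_mm Vv(3) eqm_refl)
  also have "eqm (Suc n) \<dots> (bk 1 x zv W)" by (rule eqm_mm_idm_l)
  finally have e2: "eqm (Suc n) (mm (Suc n) Vv (bk 1 x' zv W')) (bk 1 x zv W)" .
  note f1 = first_col[OF assms(2)] and f2 = first_col[OF e2]
  have "eqm n (mm n (\<lambda>i j. V (Suc i) (Suc j)) (\<lambda>i j. Vv (Suc i) (Suc j))) idm" by (rule sub_prod[OF Vv(2) f1(2)])
  moreover have "eqm n (mm n (\<lambda>i j. Vv (Suc i) (Suc j)) (\<lambda>i j. V (Suc i) (Suc j))) idm" by (rule sub_prod[OF Vv(3) f2(2)])
  moreover have "cm n (\<lambda>i j. V (Suc i) (Suc j))" "cm n (\<lambda>i j. Vv (Suc i) (Suc j))"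
    using cm_bk_parts(4)[OF GL_seq_cm[OF assms(1)]] cm_bk_parts(4)[OF GL_seq_cm[OF Vv(1)]] by auto
  ultimately have "GL_seq n (\<lambda>i j. V (Suc i) (Suc j))" unfolding GL_seq_def by blast
  then show ?thesis using f1(3) by blast
qed

lemma equiv_lift: assumes "GL_seq n U" "cv n x" "cm n W" "Omega0_seq (Suc n) T (bk 1 x zv W)"
  shows "Omega0_seq (Suc n) T (bk 1 x zv (mm n U W))"
    "eqm (Suc n) (mm (Suc n) (bk 1 zv zv U) (bk 1 x zv W)) (bk 1 x zv (mm n U W))"
proof -
  show e: "eqm (Suc n) (mm (Suc n) (bk 1 zv zv U) (bk 1 x zv W)) (bk 1 x zv (mm n U W))"
    unfolding mm_bk by (intro eqm_bk eqv_exact eqm_exact) auto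
  have "Omega0_seq (Suc n) T (mm (Suc n) (bk 1 zv zv U) (bk 1 x zv W))" by (rule Omega0_seq_GL[OF assms(4) GL_seq_bk1[OF assms(1)]])
  moreover have "cm (Suc n) (bk 1 x zv (mm n U W))"
    using assms(2) cm_mm[OF GL_seq_cm[OF assms(1)] assms(3)] by (intro cm_bk) auto
  ultimately show "Omega0_seq (Suc n) T (bk 1 x zv (mm n U W))"
    using Omega_seq_eqm[OF _ e _ eqm_refl] by blast
qed

text \<open>Bordering preserves the double coset: W in D_{n,i} iff [[1, x], [0, W]] in D_{n+1,i}.  The reverse direction uses the Smith normal form and uniqueness of i.\<close>
lemma dcoset_lift: assumes "cv n x" "cm n W" "i \<le> n"
  shows "Dcoset_seq n i W \<longleftrightarrow> Dcoset_seq (Suc n) i (bk 1 x zv W)"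
proof
  have e: "eqm (Suc n) (mm (Suc n) (bk 1 zv zv W) (bk 1 x zv idm)) (bk 1 x zv W)"
    unfolding mm_bk by (intro eqm_bk eqv_exact eqm_exact) (auto simp: vm_idm mm_idm_r)
  assume "Dcoset_seq n i W"
  then have "Dcoset_seq (Suc n) i (bk 1 zv zv W)" using Dcoset_seq_bk1 assms(3) by blast
  then have "Dcoset_seq (Suc n) i (mm (Suc n) (bk 1 zv zv W) (bk 1 x zv idm))" using Dcoset_seq_right GL_seq_unip[OF assms(1)] by blast
  then show "Dcoset_seq (Suc n) i (bk 1 x zv W)" using Dcoset_seq_cong e by blast
next
  assume a: "Dcoset_seq (Suc n) i (bk 1 x zv W)"
  then have K: "Dcoset_seq (Suc n) i (bk 1 zv zv W)"
    using Dcoset_seq_cong[OF Dcoset_seq_right[OF GL_seq_unip[OF cv_uminus[OF assms(1)]] a] elim_right] by blast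
  obtain Y where Y: "cm (Suc n) Y" "eqm (Suc n) (mm (Suc n) (bk 1 zv zv W) Y) (sm (of_int p) idm)"
    using Dcoset_seq_inv_p[OF K] by blast
  have "eqm n (mm n W (\<lambda>i j. Y (Suc i) (Suc j))) (sm (of_int p) idm)" by (rule block_p[OF Y(2)])
  then obtain j where j: "j \<le> n" "Dcoset_seq n j W" using smith[OF assms(2) cm_bk_parts(4)[OF Y(1)]] by blast
  have "Dcoset_seq (Suc n) j (bk 1 zv zv W)" using Dcoset_seq_bk1[OF j(2) j(1)] .
  then have "i = j" using Dcoset_seq_unique[OF K] assms(3) j(1) by simp
  then show "Dcoset_seq n i W" using j by simp
qed

end

section \<open>Translation to the concrete definitions\<close>

text \<open>to_Zp n X reduces the n x n block of X to canonical representatives; it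
  identifies the concrete matrices matZp p n with coherent matrices modulo I, and
  turns each concrete operation into the corresponding exact one.\<close>

context padic
begin

definition to_Zp :: "nat \<Rightarrow> fm \<Rightarrow> zmat" where
  "to_Zp n X = (\<lambda>i j. if i < n \<and> j < n then reduce (X i j) else zp_zero)"

lemma zp_zero_Zp[simp]: "zp_zero \<in> Zp p" unfolding Zp_def zp_zero_def by simp

lemma matZpD: "A \<in> matZp p n \<Longrightarrow> A i j \<in> Zp p" unfolding matZp_def by blast
lemma matZpD0: "A \<in> matZp p n \<Longrightarrow> \<not> (i < n \<and> j < n) \<Longrightarrow> A i j = zp_zero" unfolding matZp_def by auto

lemma mmul_to_Zp: "mmul p n A B = to_Zp n (mm n A B)"
  unfolding mmul_def to_Zp_def mm_def reduce_def zp_zero_def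
  by (rule fmext) (auto simp: sum_fun_apply)

lemma to_Zp_id: "A \<in> matZp p n \<Longrightarrow> to_Zp n A = A"
  unfolding to_Zp_def by (rule fmext) (auto simp: Zp_reduce matZpD matZpD0)

lemma to_Zp_eq_iff: "to_Zp n X = to_Zp n Y \<longleftrightarrow> eqm n X Y"
proof
  assume a: "to_Zp n X = to_Zp n Y"
  show "eqm n X Y"
  proof (rule eqmI)
    fix i j assume "i < n" "j < n"
    then have "reduce (X i j) = reduce (Y i j)" using fun_cong[OF fun_cong[OF a, of i], of j] unfolding to_Zp_def by simp
    then show "X i j - Y i j \<in> I" by (simp add: reduce_eq_iff)
  qed
next
  assume "eqm n X Y"
  then show "to_Zp n X = to_Zp n Y" unfolding to_Zp_def by (intro fmext) (auto simp: reduce_eq_iff dest: eqmD)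
qed

lemma to_Zp_mat: "cm n X \<Longrightarrow> to_Zp n X \<in> matZp p n"
  unfolding matZp_def to_Zp_def by (auto intro: reduce_Coh dest: cmD)

lemma to_Zp_eqm: "eqm n (to_Zp n X) X"
  unfolding to_Zp_def by (intro eqmI) (simp add: reduce_I)

lemma mat_cm: "A \<in> matZp p n \<Longrightarrow> cm n A"
  by (intro cmI) (auto intro: Zp_Coh matZpD)

lemma mtrans_tr: "mtrans A = tr A" by (simp add: mtrans_def tr_def)

lemma mdet_reduce: "mdet p n A = reduce (detm n A)"
  unfolding mdet_def reduce_def detm_leibniz
  by (rule ext) (simp add: sum_fun_apply prod_fun_apply atLeast0LessThan)

lemma mdet_nz: "mdet p n A \<noteq> zp_zero \<longleftrightarrow> detm n A \<notin> I"
  by (simp add: mdet_reduce reduce_zero_iff)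

lemma mdet_val: "zp_val (mdet p n A) = val (detm n A)"
  by (simp add: mdet_reduce zp_val_reduce)

lemma madd_to_Zp: "A \<in> matZp p n \<Longrightarrow> B \<in> matZp p n \<Longrightarrow> madd p A B = to_Zp n (A + B)"
  unfolding madd_def to_Zp_def reduce_def
  by (rule fmext) (auto simp: matZpD0 zp_zero_def)

lemma msmul_to_Zp: "A \<in> matZp p n \<Longrightarrow> msmul p c A = to_Zp n (sm (of_int c) A)"
  unfolding msmul_def to_Zp_def reduce_def
  by (rule fmext) (auto simp: matZpD0 zp_zero_def)

lemma outer_to_Zp: "outer p n r = to_Zp n (out r r)"
  unfolding outer_def to_Zp_def reduce_def zp_zero_def by (rule fmext) auto

lemma mid_to_Zp: "mid p n = to_Zp n idm"
  unfolding mid_def to_Zp_def reduce_def zp_zero_def idm_def by (rule fmext) auto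

lemma dmat_to_Zp: "dmat p r i = to_Zp r (dmat_seq r i)"
  unfolding dmat_def to_Zp_def reduce_def zp_zero_def dmat_seq_def by (rule fmext) auto

lemma vecZp_cv: "r \<in> vecZp p n \<Longrightarrow> cv n r"
  unfolding vecZp_def cv_def using Zp_Coh by auto

lemma twoB1_to_Zp: assumes "r \<in> vecZp p n" "D \<in> matZp p n" shows "twoB1 p n r D = to_Zp (Suc n) (bk 2 r r D)"
proof (rule fmext)
  fix i j
  have rr: "reduce (r a) = r a" for a using assms(1) Zp_reduce unfolding vecZp_def by auto
  have DD: "reduce (D a b) = D a b" for a b using assms(2) Zp_reduce matZpD by auto
  show "twoB1 p n r D i j = to_Zp (Suc n) (bk 2 r r D) i j"
    unfolding twoB1_def to_Zp_def
    by (cases i; cases j) (auto simp: bk_def rr[unfolded reduce_def] DD[unfolded reduce_def] reduce_def zp_zero_def fun_eq_iff)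
qed

lemma GLZp_iff: "U \<in> GLZp p n \<longleftrightarrow> U \<in> matZp p n \<and> GL_seq n U"
proof
  assume "U \<in> GLZp p n"
  then obtain V where V: "U \<in> matZp p n" "V \<in> matZp p n" "mmul p n U V = mid p n" "mmul p n V U = mid p n"
    unfolding GLZp_def by blast
  then have "eqm n (mm n U V) idm" "eqm n (mm n V U) idm" unfolding mmul_to_Zp mid_to_Zp to_Zp_eq_iff by auto
  then show "U \<in> matZp p n \<and> GL_seq n U" unfolding GL_seq_def using V mat_cm by blast
next
  assume a: "U \<in> matZp p n \<and> GL_seq n U"
  then obtain V where V: "cm n V" "eqm n (mm n U V) idm" "eqm n (mm n V U) idm" unfolding GL_seq_def by blast
  have "eqm n (mm n U (to_Zp n V)) idm" using eqm_trans[OF eqm_mm[OF eqm_refl to_Zp_eqm] V(2)] .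
  moreover have "eqm n (mm n (to_Zp n V) U) idm" using eqm_trans[OF eqm_mm[OF to_Zp_eqm eqm_refl] V(3)] .
  ultimately have "mmul p n U (to_Zp n V) = mid p n" "mmul p n (to_Zp n V) U = mid p n"
    unfolding mmul_to_Zp mid_to_Zp to_Zp_eq_iff by auto
  then show "U \<in> GLZp p n" unfolding GLZp_def using a to_Zp_mat[OF V(1)] by blast
qed

lemma to_Zp_GL: assumes "GL_seq n U" shows "to_Zp n U \<in> GLZp p n"
proof -
  have c: "cm n (to_Zp n U)" using mat_cm[OF to_Zp_mat[OF GL_seq_cm[OF assms]]] .
  have "GL_seq n (to_Zp n U)" using GL_seq_cong[OF assms eqm_sym[OF to_Zp_eqm] c] .
  then show ?thesis unfolding GLZp_iff using to_Zp_mat[OF GL_seq_cm[OF assms]] by blast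
qed

lemma Se_iff: "A \<in> Se p n \<longleftrightarrow> A \<in> matZp p n \<and> Se_seq n A"
proof
  assume a: "A \<in> Se p n"
  have m: "A \<in> matZp p n" using a unfolding Se_def by blast
  have s: "A i j = A j i" for i j using a unfolding Se_def by blast
  have "Se_seq n A" unfolding Se_seq_def
  proof (intro conjI allI impI)
    show "cm n A" using mat_cm[OF m] .
    show "eqm n (tr A) A" by (rule eqm_exact) (simp add: s)
    fix i assume i: "i < n"
    obtain y where y: "y \<in> Zp p" "A i i = (\<lambda>k. (2 * y k) mod p ^ k)" using a i unfolding Se_def by blast
    have "A i i = reduce (2 * y)" using y(2) by (simp add: reduce_def)
    then have "cg (A i i) (2 * y)" using reduce_I by (simp add: cg_def)
    then show "\<exists>y\<in>Coh. cg (A i i) (2 * y)" using Zp_Coh[OF y(1)] by blast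
  qed
  then show "A \<in> matZp p n \<and> Se_seq n A" using m by blast
next
  assume a: "A \<in> matZp p n \<and> Se_seq n A"
  have sym: "A i j = A j i" for i j
  proof (cases "i < n \<and> j < n")
    case True
    have "tr A i j - A i j \<in> I" using a True unfolding Se_seq_def by (auto dest: eqmD)
    moreover have "A j i \<in> Zp p" "A i j \<in> Zp p" using matZpD a by auto
    ultimately have "A j i = A i j" using Zp_eq_iff by simp
    then show ?thesis by simp
  next
    case False then show ?thesis using matZpD0 a by (metis conj_commute)
  qed
  have "\<exists>y\<in>Zp p. A i i = (\<lambda>k. (2 * y k) mod p ^ k)" if i: "i < n" for i
  proof -
    obtain y where y: "y \<in> Coh" "cg (A i i) (2 * y)" using a i unfolding Se_seq_def by blast
    have "reduce (A i i) = reduce (2 * y)" using y(2) by (simp add: reduce_eq_iff cg_def)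
    then have "A i i = reduce (2 * y)" using Zp_reduce matZpD a by metis
    also have "reduce (2 * y) = (\<lambda>k. (2 * reduce y k) mod p ^ k)" unfolding reduce_def
      by (rule ext) (simp add: mod_mult_right_eq)
    finally show ?thesis using reduce_Coh[OF y(1)] by blast
  qed
  then show "A \<in> Se p n" unfolding Se_def using a sym by blast
qed

lemma to_Zp_Se: assumes "Se_seq n X" shows "to_Zp n X \<in> Se p n"
proof -
  have m: "to_Zp n X \<in> matZp p n" using to_Zp_mat assms unfolding Se_seq_def by blast
  have "Se_seq n (to_Zp n X)" using Se_seq_eqm[OF assms eqm_sym[OF to_Zp_eqm] mat_cm[OF m]] .
  then show ?thesis unfolding Se_iff using m by blast
qed

lemma L0_iff: "A \<in> L0 p n \<longleftrightarrow> A \<in> matZp p n \<and> L0_seq n A"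
  unfolding L0_def L0_seq_def Se_iff mdet_nz by blast

lemma Lprime_equation_iff: assumes "A \<in> matZp p n" "D \<in> matZp p n" "cv n r"
  shows "madd p A (msmul p 2 (outer p n r)) = msmul p 4 D \<longleftrightarrow> eqm n (A + sm 2 (out r r)) (sm 4 D)"
proof -
  have o: "outer p n r \<in> matZp p n" unfolding outer_to_Zp by (rule to_Zp_mat) (use assms(3) in auto)
  have o2: "msmul p 2 (outer p n r) \<in> matZp p n"
    unfolding msmul_to_Zp[OF o] by (rule to_Zp_mat) (use mat_cm[OF o] in auto)
  have e1: "madd p A (msmul p 2 (outer p n r)) = to_Zp n (A + msmul p 2 (outer p n r))" by (rule madd_to_Zp[OF assms(1) o2])
  have e2: "msmul p 2 (outer p n r) = to_Zp n (sm 2 (outer p n r))" using msmul_to_Zp[OF o, of 2] by simp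
  have "madd p A (msmul p 2 (outer p n r)) = to_Zp n (A + to_Zp n (sm 2 (outer p n r)))"
    using e1 e2 by simp
  also have "\<dots> = to_Zp n (A + to_Zp n (sm 2 (to_Zp n (out r r))))" by (simp only: outer_to_Zp)
  finally have L: "madd p A (msmul p 2 (outer p n r)) = to_Zp n (A + to_Zp n (sm 2 (to_Zp n (out r r))))" .
  have R: "msmul p 4 D = to_Zp n (sm 4 D)" unfolding msmul_to_Zp[OF assms(2)] by simp
  have E: "eqm n (A + to_Zp n (sm 2 (to_Zp n (out r r)))) (A + sm 2 (out r r))"
    by (intro eqm_add eqm_refl eqm_trans[OF to_Zp_eqm] eqm_sm to_Zp_eqm)
  show ?thesis unfolding L R to_Zp_eq_iff
  proof
    assume "eqm n (A + to_Zp n (sm 2 (to_Zp n (out r r)))) (sm 4 D)"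
    then show "eqm n (A + sm 2 (out r r)) (sm 4 D)" using eqm_trans[OF eqm_sym[OF E]] by blast
  next
    assume "eqm n (A + sm 2 (out r r)) (sm 4 D)"
    then show "eqm n (A + to_Zp n (sm 2 (to_Zp n (out r r)))) (sm 4 D)" using eqm_trans[OF E] by blast
  qed
qed

lemma mmul_assoc_to_Zp: "mmul p n (mmul p n A B) C = to_Zp n (mm n (mm n A B) C)"
  unfolding mmul_to_Zp to_Zp_eq_iff by (intro eqm_mm to_Zp_eqm eqm_refl)

lemma vec_reduce: assumes "cv n s" defines "r \<equiv> (\<lambda>i. if i < n then reduce (s i) else zp_zero)"
  shows "r \<in> vecZp p n" "eqv n r s" "cv n r"
proof -
  show "r \<in> vecZp p n" unfolding vecZp_def r_def using assms(1) by (auto intro: reduce_Coh dest: cvD)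
  show "eqv n r s" unfolding eqv_def r_def by (simp add: reduce_I)
  then show "cv n r" using vecZp_cv \<open>r \<in> vecZp p n\<close> by blast
qed

lemma eqm_out: "eqv n r s \<Longrightarrow> eqm n (out r r) (out s s)"
  by (intro eqm_cgI) (auto intro!: cg_mult dest: eqv_cg)

lemma Lp_iff: "A \<in> Lprime_dbl p n \<longleftrightarrow> A \<in> matZp p n \<and> Lprime_seq n A"
proof
  assume "A \<in> Lprime_dbl p n"
  then obtain r D where a: "A \<in> Se p n" "r \<in> vecZp p n" "D \<in> Se p n"
    "madd p A (msmul p 2 (outer p n r)) = msmul p 4 D" unfolding Lprime_dbl_def by blast
  have m: "A \<in> matZp p n" "D \<in> matZp p n" "Se_seq n A" "Se_seq n D" using a Se_iff by auto
  have "eqm n (A + sm 2 (out r r)) (sm 4 D)" using a(4) Lprime_equation_iff[OF m(1,2) vecZp_cv[OF a(2)]] by blast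
  then show "A \<in> matZp p n \<and> Lprime_seq n A" unfolding Lprime_seq_def using m vecZp_cv[OF a(2)] by blast
next
  assume a: "A \<in> matZp p n \<and> Lprime_seq n A"
  then obtain s E where sE: "cv n s" "Se_seq n E" "eqm n (A + sm 2 (out s s)) (sm 4 E)" unfolding Lprime_seq_def by blast
  define r where "r = (\<lambda>i. if i < n then reduce (s i) else zp_zero)"
  note rr = vec_reduce[OF sE(1), folded r_def]
  have D: "to_Zp n E \<in> Se p n" using to_Zp_Se[OF sE(2)] .
  have "eqm n (A + sm 2 (out r r)) (sm 4 (to_Zp n E))"
    using eqm_trans[OF eqm_trans[OF eqm_add[OF eqm_refl eqm_sm[OF eqm_out[OF rr(2)]]] sE(3)] eqm_sm[OF eqm_sym[OF to_Zp_eqm]]] .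
  then have "madd p A (msmul p 2 (outer p n r)) = msmul p 4 (to_Zp n E)"
    using Lprime_equation_iff[OF conjunct1[OF a] _ rr(3)] D Se_iff by blast
  moreover have "A \<in> Se p n" using a Se_iff Lprime_seq_def by blast
  ultimately show "A \<in> Lprime_dbl p n" unfolding Lprime_dbl_def using rr(1) D by blast
qed

lemma L1_iff: "A \<in> L1_dbl p n \<longleftrightarrow> A \<in> matZp p n \<and> L1_seq n A"
  unfolding L1_dbl_def L1_seq_def Lp_iff mdet_nz by blast

lemma Omega_seq_iff:
  assumes T': "T' \<in> matZp p n"
    and X: "\<And>A. A \<in> X \<longleftrightarrow> A \<in> matZp p n \<and> P A"
    and P_eqm: "\<And>C C'. P C \<Longrightarrow> eqm n C C' \<Longrightarrow> cm n C' \<Longrightarrow> P C'"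
    and P_cm: "\<And>C. P C \<Longrightarrow> cm n C"
  shows "W \<in> {W \<in> matZp p n. mdet p n W \<noteq> zp_zero \<and> (\<exists>C \<in> X. T' = mmul p n (mmul p n (mtrans W) C) W)}
     \<longleftrightarrow> W \<in> matZp p n \<and> Omega_seq n P T' W"
proof
  assume "W \<in> {W \<in> matZp p n. mdet p n W \<noteq> zp_zero \<and> (\<exists>C \<in> X. T' = mmul p n (mmul p n (mtrans W) C) W)}"
  then obtain C where a: "W \<in> matZp p n" "mdet p n W \<noteq> zp_zero" "C \<in> X"
    "T' = mmul p n (mmul p n (mtrans W) C) W" by blast
  have "to_Zp n T' = to_Zp n (mm n (mm n (tr W) C) W)" using a(4) unfolding mmul_assoc_to_Zp mtrans_tr to_Zp_id[OF T'] .
  then have "eqm n T' (mm n (mm n (tr W) C) W)" unfolding to_Zp_eq_iff .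
  then show "W \<in> matZp p n \<and> Omega_seq n P T' W" unfolding Omega_seq_def using a mat_cm X mdet_nz by blast
next
  assume a: "W \<in> matZp p n \<and> Omega_seq n P T' W"
  then obtain C where C: "P C" "eqm n T' (mm n (mm n (tr W) C) W)" unfolding Omega_seq_def by blast
  have m: "to_Zp n C \<in> matZp p n" using to_Zp_mat[OF P_cm[OF C(1)]] .
  have "to_Zp n C \<in> X" using P_eqm[OF C(1) eqm_sym[OF to_Zp_eqm] mat_cm[OF m]] X m by blast
  moreover have "eqm n T' (mm n (mm n (tr W) (to_Zp n C)) W)"
    using eqm_trans[OF C(2) eqm_mm[OF eqm_mm[OF eqm_refl eqm_sym[OF to_Zp_eqm]] eqm_refl]] .
  then have "T' = mmul p n (mmul p n (mtrans W) (to_Zp n C)) W"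
    unfolding to_Zp_eq_iff[symmetric] mmul_assoc_to_Zp mtrans_tr to_Zp_id[OF T'] .
  ultimately show "W \<in> {W \<in> matZp p n. mdet p n W \<noteq> zp_zero \<and> (\<exists>C \<in> X. T' = mmul p n (mmul p n (mtrans W) C) W)}"
    using a mdet_nz Omega_seq_def by blast
qed

lemma Omega0_seq_iff: "T' \<in> matZp p n \<Longrightarrow> W \<in> Omega0 p n T' \<longleftrightarrow> W \<in> matZp p n \<and> Omega0_seq n T' W"
  unfolding Omega0_def by (rule Omega_seq_iff[OF _ L0_iff L0_seq_eqm]) (auto simp: L0_seq_def Se_seq_def)

lemma Omega1_seq_iff: "B' \<in> matZp p n \<Longrightarrow> W \<in> Omega1 p n B' \<longleftrightarrow> W \<in> matZp p n \<and> Omega1_seq n B' W"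
  unfolding Omega1_def by (rule Omega_seq_iff[OF _ L1_iff L1_seq_eqm]) (auto simp: L1_seq_def Lprime_seq_def Se_seq_def)

lemma Dcoset_iff: "X \<in> Dcoset p n i \<longleftrightarrow> X \<in> matZp p n \<and> Dcoset_seq n i X"
proof
  assume "X \<in> Dcoset p n i"
  then obtain U V where a: "U \<in> GLZp p n" "V \<in> GLZp p n" "X = mmul p n (mmul p n U (dmat p n i)) V"
    unfolding Dcoset_def by blast
  have X: "X = to_Zp n (mm n (mm n U (dmat_seq n i)) V)" unfolding a(3) mmul_assoc_to_Zp dmat_to_Zp to_Zp_eq_iff
    by (intro eqm_mm to_Zp_eqm eqm_refl)
  have cd: "cm n (dmat_seq n i)" unfolding dmat_seq_def by (intro cmI) auto
  have "X \<in> matZp p n" unfolding X using a GLZp_iff mat_cm cd by (intro to_Zp_mat cm_mm) auto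
  moreover have "Dcoset_seq n i X" unfolding Dcoset_seq_def
  proof (intro exI conjI)
    show "GL_seq n U" "GL_seq n V" using a(1,2) GLZp_iff by auto
    show "eqm n X (mm n (mm n U (dmat_seq n i)) V)" unfolding X by (rule to_Zp_eqm)
  qed
  ultimately show "X \<in> matZp p n \<and> Dcoset_seq n i X" by blast
next
  assume a: "X \<in> matZp p n \<and> Dcoset_seq n i X"
  then obtain U V where UV: "GL_seq n U" "GL_seq n V" "eqm n X (mm n (mm n U (dmat_seq n i)) V)" unfolding Dcoset_seq_def by blast
  have "X = mmul p n (mmul p n (to_Zp n U) (dmat p n i)) (to_Zp n V)"
  proof -
    have "eqm n X (mm n (mm n (to_Zp n U) (to_Zp n (dmat_seq n i))) (to_Zp n V))"
      using eqm_trans[OF UV(3) eqm_mm[OF eqm_mm[OF eqm_sym[OF to_Zp_eqm] eqm_sym[OF to_Zp_eqm]] eqm_sym[OF to_Zp_eqm]]] .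
    then have "to_Zp n X = to_Zp n (mm n (mm n (to_Zp n U) (to_Zp n (dmat_seq n i))) (to_Zp n V))" unfolding to_Zp_eq_iff .
    then show ?thesis unfolding mmul_assoc_to_Zp dmat_to_Zp to_Zp_id[OF conjunct1[OF a]] .
  qed
  then show "X \<in> Dcoset p n i" unfolding Dcoset_def using to_Zp_GL UV by blast
qed

lemma orbit_iff: assumes "W \<in> matZp p n"
  shows "W' \<in> GLorbit p n W \<longleftrightarrow> W' \<in> matZp p n \<and> (\<exists>U. GL_seq n U \<and> eqm n W' (mm n U W))"
proof
  assume "W' \<in> GLorbit p n W"
  then obtain U where a: "U \<in> GLZp p n" "W' = mmul p n U W" unfolding GLorbit_def by blast
  have "W' \<in> matZp p n" unfolding a(2) mmul_to_Zp using a(1) GLZp_iff mat_cm assms by (intro to_Zp_mat cm_mm) auto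
  moreover have "eqm n W' (mm n U W)" unfolding a(2) mmul_to_Zp by (rule to_Zp_eqm)
  ultimately show "W' \<in> matZp p n \<and> (\<exists>U. GL_seq n U \<and> eqm n W' (mm n U W))" using a(1) GLZp_iff by blast
next
  assume a: "W' \<in> matZp p n \<and> (\<exists>U. GL_seq n U \<and> eqm n W' (mm n U W))"
  then obtain U where U: "GL_seq n U" "eqm n W' (mm n U W)" by blast
  have "W' = mmul p n (to_Zp n U) W"
  proof -
    have "eqm n W' (mm n (to_Zp n U) W)" using eqm_trans[OF U(2) eqm_mm[OF eqm_sym[OF to_Zp_eqm] eqm_refl]] .
    then have "to_Zp n W' = to_Zp n (mm n (to_Zp n U) W)" unfolding to_Zp_eq_iff .
    then show ?thesis unfolding mmul_to_Zp to_Zp_id[OF conjunct1[OF a]] .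
  qed
  then show "W' \<in> GLorbit p n W" unfolding GLorbit_def using to_Zp_GL[OF U(1)] by blast
qed

end

section \<open>GL-orbits\<close>

context padic
begin

definition same_orbit :: "nat \<Rightarrow> fm \<Rightarrow> fm \<Rightarrow> bool" where
  "same_orbit n W W' \<longleftrightarrow> (\<exists>U. GL_seq n U \<and> eqm n W' (mm n U W))"

lemma same_orbit_refl: "same_orbit n W W"
  unfolding same_orbit_def using GL_seq_idm eqm_sym[OF eqm_mm_idm_l] by blast

lemma same_orbit_eqm: "eqm n W' W'' \<Longrightarrow> same_orbit n W W' \<Longrightarrow> same_orbit n W W''"
  unfolding same_orbit_def using eqm_trans eqm_sym by blast

lemma same_orbit_trans: assumes "same_orbit n W1 W2" "same_orbit n W2 W3" shows "same_orbit n W1 W3"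
proof -
  obtain U1 where U1: "GL_seq n U1" "eqm n W2 (mm n U1 W1)" using assms(1) unfolding same_orbit_def by blast
  obtain U2 where U2: "GL_seq n U2" "eqm n W3 (mm n U2 W2)" using assms(2) unfolding same_orbit_def by blast
  have "eqm n W3 (mm n (mm n U2 U1) W1)"
    using eqm_trans[OF U2(2) eqm_mm[OF eqm_refl U1(2)]] by (simp add: mm_assoc)
  then show ?thesis unfolding same_orbit_def using GL_seq_mm[OF U2(1) U1(1)] by blast
qed

lemma same_orbit_sym: assumes "same_orbit n W1 W2" shows "same_orbit n W2 W1"
proof -
  obtain U where U: "GL_seq n U" "eqm n W2 (mm n U W1)" using assms unfolding same_orbit_def by blast
  obtain V where V: "GL_seq n V" "eqm n (mm n V U) idm" using GL_seq_inv[OF U(1)] by blast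
  have "eqm n (mm n V W2) (mm n (mm n V U) W1)" using eqm_mm[OF eqm_refl U(2), of V] by (simp add: mm_assoc)
  also have "eqm n \<dots> (mm n idm W1)" by (intro eqm_mm V(2) eqm_refl)
  also have "eqm n \<dots> W1" by (rule eqm_mm_idm_l)
  finally show ?thesis unfolding same_orbit_def using V(1) eqm_sym by blast
qed

lemma orbit_set: assumes "W \<in> matZp p n" shows "GLorbit p n W = {W'. W' \<in> matZp p n \<and> same_orbit n W W'}"
  using orbit_iff[OF assms] unfolding same_orbit_def by blast

lemma orbit_eq_iff: assumes "W1 \<in> matZp p n" "W2 \<in> matZp p n"
  shows "GLorbit p n W1 = GLorbit p n W2 \<longleftrightarrow> same_orbit n W1 W2"
proof
  assume "GLorbit p n W1 = GLorbit p n W2"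
  then have "W2 \<in> GLorbit p n W1" using orbit_set[OF assms(2)] assms(2) same_orbit_refl by auto
  then show "same_orbit n W1 W2" using orbit_set[OF assms(1)] by auto
next
  assume "same_orbit n W1 W2"
  then show "GLorbit p n W1 = GLorbit p n W2" unfolding orbit_set[OF assms(1)] orbit_set[OF assms(2)]
    using same_orbit_trans same_orbit_sym by blast
qed

lemma orbit_mem: "W \<in> matZp p n \<Longrightarrow> W \<in> GLorbit p n W"
  using orbit_set same_orbit_refl by blast

lemma same_orbit_det: assumes "same_orbit n W W'" "cm n W" "detm n W \<notin> I"
  shows "detm n W' \<notin> I" "val (detm n W') = val (detm n W)"
proof -
  obtain U where U: "GL_seq n U" "eqm n W' (mm n U W)" using assms(1) unfolding same_orbit_def by blast
  have d: "detm n W' - detm n U * detm n W \<in> I" using detm_cong[OF U(2)] by (simp add: detm_mm)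
  note v = val_unit_mult[OF GL_seq_det_unit[OF U(1)] detm_Coh[OF assms(2)] assms(3)]
  show "detm n W' \<notin> I"
  proof
    assume "detm n W' \<in> I"
    then have "detm n W' - (detm n W' - detm n U * detm n W) \<in> I" using d by (rule I_diff)
    then show False using v(2) by simp
  qed
  show "val (detm n W') = val (detm n W)" using val_cong[OF d] v(1) by simp
qed

lemma same_orbit_Dcoset: "same_orbit n W W' \<Longrightarrow> Dcoset_seq n i W \<Longrightarrow> Dcoset_seq n i W'"
  unfolding same_orbit_def using Dcoset_seq_left Dcoset_seq_cong eqm_sym by blast

end

context lift_setup
begin

definition lift_vec :: "fm \<Rightarrow> nat \<Rightarrow> R" where
  "lift_vec W = (SOME x. cv n x \<and> Omega0_seq (Suc n) T (bk 1 x zv W))"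

lemma lift_vec_props: assumes "Omega1_seq n B W" shows "cv n (lift_vec W)" "Omega0_seq (Suc n) T (bk 1 (lift_vec W) zv W)"
  using someI_ex[OF lift_exists[OF assms]] unfolding lift_vec_def by auto

lemma same_orbit_lift: assumes "Omega1_seq n B W1" "Omega1_seq n B W2" "same_orbit n W1 W2"
  shows "same_orbit (Suc n) (bk 1 (lift_vec W1) zv W1) (bk 1 (lift_vec W2) zv W2)"
proof -
  obtain U where U: "GL_seq n U" "eqm n W2 (mm n U W1)" using assms(3) unfolding same_orbit_def by blast
  note l1 = lift_vec_props[OF assms(1)] and l2 = lift_vec_props[OF assms(2)]
  have c1: "cm n W1" "detm n W1 \<notin> I" and c2: "cm n W2" "detm n W2 \<notin> I" using Omega_seq_cm assms by auto
  note el = equiv_lift[OF U(1) l1(1) c1(1) l1(2)]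
  have e12: "eqm (Suc n) (bk 1 (lift_vec W1) zv (mm n U W1)) (bk 1 (lift_vec W1) zv W2)"
    by (intro eqm_bk eqm_sym[OF U(2)]) auto
  have cb: "cm (Suc n) (bk 1 (lift_vec W1) zv W2)" using l1(1) c2(1) by (intro cm_bk) auto
  have "Omega0_seq (Suc n) T (bk 1 (lift_vec W1) zv W2)" using Omega_seq_eqm[OF el(1) e12 cb eqm_refl] .
  then obtain U' where U': "GL_seq (Suc n) U'"
    "eqm (Suc n) (bk 1 (lift_vec W2) zv W2) (mm (Suc n) U' (bk 1 (lift_vec W1) zv W2))"
    using lift_unique[OF l2(1) l1(1) c2 l2(2)] by blast
  have "eqm (Suc n) (bk 1 (lift_vec W2) zv W2) (mm (Suc n) U' (mm (Suc n) (bk 1 zv zv U) (bk 1 (lift_vec W1) zv W1)))"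
    using eqm_trans[OF U'(2) eqm_mm[OF eqm_refl eqm_trans[OF eqm_sym[OF e12] eqm_sym[OF el(2)]]]] .
  then have "eqm (Suc n) (bk 1 (lift_vec W2) zv W2) (mm (Suc n) (mm (Suc n) U' (bk 1 zv zv U)) (bk 1 (lift_vec W1) zv W1))"
    by (simp add: mm_assoc)
  then show ?thesis unfolding same_orbit_def using GL_seq_mm[OF U'(1) GL_seq_bk1[OF U(1)]] by blast
qed

lemma same_orbit_unlift: assumes "same_orbit (Suc n) (bk 1 x1 zv W1) (bk 1 x2 zv W2)" shows "same_orbit n W1 W2"
proof -
  obtain V where V: "GL_seq (Suc n) V" "eqm (Suc n) (bk 1 x2 zv W2) (mm (Suc n) V (bk 1 x1 zv W1))"
    using assms unfolding same_orbit_def by blast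
  obtain U where "GL_seq n U" "eqm n (mm n U W1) W2" using inj_lift[OF V(1) eqm_sym[OF V(2)]] by blast
  then show ?thesis unfolding same_orbit_def using eqm_sym by blast
qed

lemma surj_same_orbit: assumes "Omega0_seq (Suc n) T W2" "W2 \<in> matZp p (Suc n)"
  shows "\<exists>W. W \<in> matZp p n \<and> Omega1_seq n B W \<and> same_orbit (Suc n) (bk 1 (lift_vec W) zv W) W2"
proof -
  obtain U x W0 where a: "GL_seq (Suc n) U" "cv n x" "cm n W0" "eqm (Suc n) (mm (Suc n) U W2) (bk 1 x zv W0)"
    using surj_lift[OF assms(1)] by blast
  define W where "W = to_Zp n W0"
  have Wm: "W \<in> matZp p n" unfolding W_def using to_Zp_mat[OF a(3)] .
  have e: "eqm (Suc n) (bk 1 x zv W0) (bk 1 x zv W)" unfolding W_def by (intro eqm_bk eqm_sym[OF to_Zp_eqm]) auto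
  have cb: "cm (Suc n) (bk 1 x zv W)" using a(2) mat_cm[OF Wm] by (intro cm_bk) auto
  have O: "Omega0_seq (Suc n) T (bk 1 x zv W)"
    using Omega_seq_eqm[OF Omega0_seq_GL[OF assms(1) a(1)] eqm_trans[OF a(4) e] cb eqm_refl] .
  have O1: "Omega1_seq n B W" by (rule lift_reverse[OF a(2) mat_cm[OF Wm] O])
  note l = lift_vec_props[OF O1]
  obtain U' where U': "GL_seq (Suc n) U'" "eqm (Suc n) (bk 1 (lift_vec W) zv W) (mm (Suc n) U' (bk 1 x zv W))"
    using lift_unique[OF l(1) a(2) mat_cm[OF Wm] conjunct2[OF Omega_seq_cm[OF O1]] l(2) O] by blast
  have "same_orbit (Suc n) W2 (bk 1 x zv W)" unfolding same_orbit_def using a(1) eqm_trans[OF eqm_sym[OF e] eqm_sym[OF a(4)]] by blast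
  moreover have "same_orbit (Suc n) (bk 1 x zv W) (bk 1 (lift_vec W) zv W)" unfolding same_orbit_def using U' by blast
  ultimately have "same_orbit (Suc n) W2 (bk 1 (lift_vec W) zv W)" by (rule same_orbit_trans)
  then show ?thesis using Wm O1 same_orbit_sym by blast
qed

end

section \<open>The orbit map psi\<close>

locale lift_setup_Zp = lift_setup +
  assumes Bm: "B \<in> matZp p n" and Dmm: "Dm \<in> matZp p n" and rv: "\<rho> \<in> vecZp p n"
begin

abbreviation "T' \<equiv> twoB1 p n \<rho> Dm"
abbreviation "Q1 \<equiv> GLquot p n (Omega1 p n B)"
abbreviation "Q0 \<equiv> GLquot p (Suc n) (Omega0 p (Suc n) T')"

lemma T_coh: "cm (Suc n) T" unfolding T_def using cr sD unfolding Se_seq_def by (intro cm_bk) auto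
lemma T'_eq: "T' = to_Zp (Suc n) T" unfolding T_def by (rule twoB1_to_Zp[OF rv Dmm])
lemma T'_mat: "T' \<in> matZp p (Suc n)" unfolding T'_eq by (rule to_Zp_mat[OF T_coh])
lemma T'_T: "eqm (Suc n) T' T" unfolding T'_eq by (rule to_Zp_eqm)

lemma Omega0_T_iff: "W \<in> Omega0 p (Suc n) T' \<longleftrightarrow> W \<in> matZp p (Suc n) \<and> Omega0_seq (Suc n) T W"
proof -
  have "Omega0_seq (Suc n) T' W \<longleftrightarrow> Omega0_seq (Suc n) T W"
    using Omega_seq_eqm[OF _ eqm_refl _ T'_T] Omega_seq_eqm[OF _ eqm_refl _ eqm_sym[OF T'_T]] Omega_seq_def by blast
  then show ?thesis using Omega0_seq_iff[OF T'_mat] by blast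
qed

lemma Omega1_B_iff: "W \<in> Omega1 p n B \<longleftrightarrow> W \<in> matZp p n \<and> Omega1_seq n B W"
  using Omega1_seq_iff[OF Bm] .

lemma Omega1_seq_same_orbit: "Omega1_seq n B W \<Longrightarrow> same_orbit n W W' \<Longrightarrow> cm n W' \<Longrightarrow> Omega1_seq n B W'"
  unfolding same_orbit_def using Omega1_seq_GL Omega_seq_eqm eqm_sym eqm_refl by blast

lemma orbit_rep: assumes "c \<in> GLquot p k S" "S \<subseteq> matZp p k"
  "\<And>W W'. W \<in> S \<Longrightarrow> W' \<in> matZp p k \<Longrightarrow> same_orbit k W W' \<Longrightarrow> W' \<in> S"
  shows "(SOME W. W \<in> c) \<in> S" "c = GLorbit p k (SOME W. W \<in> c)"
proof -
  obtain W0 where W0: "W0 \<in> S" "c = GLorbit p k W0" using assms(1) unfolding GLquot_def by blast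
  have m0: "W0 \<in> matZp p k" using W0 assms(2) by blast
  have "W0 \<in> c" using W0 orbit_mem[OF m0] by simp
  then have "(SOME W. W \<in> c) \<in> c" by (rule someI[of "\<lambda>W. W \<in> c"])
  then have "(SOME W. W \<in> c) \<in> matZp p k" "same_orbit k W0 (SOME W. W \<in> c)" using W0(2) orbit_set[OF m0] by auto
  then show "(SOME W. W \<in> c) \<in> S" "c = GLorbit p k (SOME W. W \<in> c)"
    using assms(3)[OF W0(1)] W0(2) orbit_eq_iff[OF m0] by auto
qed

definition lift_mat :: "fm \<Rightarrow> zmat" where "lift_mat W = to_Zp (Suc n) (bk 1 (lift_vec W) zv W)"

lemma lift_mat_props: assumes "Omega1_seq n B W" "W \<in> matZp p n"
  shows "lift_mat W \<in> Omega0 p (Suc n) T'" "eqm (Suc n) (lift_mat W) (bk 1 (lift_vec W) zv W)"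
proof -
  note l = lift_vec_props[OF assms(1)]
  have cb: "cm (Suc n) (bk 1 (lift_vec W) zv W)" using l(1) mat_cm[OF assms(2)] by (intro cm_bk) auto
  show e: "eqm (Suc n) (lift_mat W) (bk 1 (lift_vec W) zv W)" unfolding lift_mat_def by (rule to_Zp_eqm)
  have m: "lift_mat W \<in> matZp p (Suc n)" unfolding lift_mat_def by (rule to_Zp_mat[OF cb])
  have "Omega0_seq (Suc n) T (lift_mat W)" using Omega_seq_eqm[OF l(2) eqm_sym[OF e] mat_cm[OF m] eqm_refl] .
  then show "lift_mat W \<in> Omega0 p (Suc n) T'" using Omega0_T_iff m by blast
qed

definition \<psi> :: "zmat set \<Rightarrow> zmat set" where "\<psi> c = GLorbit p (Suc n) (lift_mat (SOME W. W \<in> c))"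

lemma Omega1_closed: "W \<in> Omega1 p n B \<Longrightarrow> W' \<in> matZp p n \<Longrightarrow> same_orbit n W W' \<Longrightarrow> W' \<in> Omega1 p n B"
  unfolding Omega1_B_iff using Omega1_seq_same_orbit mat_cm by blast
lemma Omega1_sub: "Omega1 p n B \<subseteq> matZp p n" using Omega1_B_iff by blast

lemma orbit_rep_Omega1: assumes "c \<in> Q1"
  shows "(SOME W. W \<in> c) \<in> Omega1 p n B" "c = GLorbit p n (SOME W. W \<in> c)"
  using orbit_rep[OF assms Omega1_sub Omega1_closed] by auto

lemma psi_in: assumes "c \<in> Q1" shows "\<psi> c \<in> Q0"
proof -
  have "(SOME W. W \<in> c) \<in> Omega1 p n B" using orbit_rep_Omega1[OF assms] by simp
  then have "lift_mat (SOME W. W \<in> c) \<in> Omega0 p (Suc n) T'" using lift_mat_props Omega1_B_iff by blast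
  then show ?thesis unfolding \<psi>_def GLquot_def by blast
qed

lemma lift_mat_same_orbit: assumes "Omega1_seq n B W" "W \<in> matZp p n"
  shows "same_orbit (Suc n) (lift_mat W) (bk 1 (lift_vec W) zv W)" "same_orbit (Suc n) (bk 1 (lift_vec W) zv W) (lift_mat W)"
  using same_orbit_eqm[OF lift_mat_props(2)[OF assms] same_orbit_refl] same_orbit_eqm[OF eqm_sym[OF lift_mat_props(2)[OF assms]] same_orbit_refl] by auto

text \<open>psi is injective, because borderings determine W up to equivalence.\<close>
lemma psi_inj: "inj_on \<psi> Q1"
proof (rule inj_onI)
  fix c1 c2 assume c: "c1 \<in> Q1" "c2 \<in> Q1" "\<psi> c1 = \<psi> c2"
  define W1 where "W1 = (SOME W. W \<in> c1)"
  define W2 where "W2 = (SOME W. W \<in> c2)"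
  have W1: "W1 \<in> matZp p n" "Omega1_seq n B W1" "c1 = GLorbit p n W1" using orbit_rep_Omega1[OF c(1)] Omega1_B_iff unfolding W1_def by auto
  have W2: "W2 \<in> matZp p n" "Omega1_seq n B W2" "c2 = GLorbit p n W2" using orbit_rep_Omega1[OF c(2)] Omega1_B_iff unfolding W2_def by auto
  have mL: "lift_mat W1 \<in> matZp p (Suc n)" "lift_mat W2 \<in> matZp p (Suc n)" using lift_mat_props W1 W2 Omega0_T_iff by blast+
  have "same_orbit (Suc n) (lift_mat W1) (lift_mat W2)" using c(3) orbit_eq_iff[OF mL] unfolding \<psi>_def W1_def[symmetric] W2_def[symmetric] by blast
  then have "same_orbit (Suc n) (bk 1 (lift_vec W1) zv W1) (bk 1 (lift_vec W2) zv W2)"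
    using same_orbit_trans[OF same_orbit_trans[OF lift_mat_same_orbit(2)[OF W1(2,1)]] lift_mat_same_orbit(1)[OF W2(2,1)]] by blast
  then have "same_orbit n W1 W2" by (rule same_orbit_unlift)
  then show "c1 = c2" using W1(3) W2(3) orbit_eq_iff[OF W1(1) W2(1)] by simp
qed

lemma psi_char: assumes "W \<in> matZp p n" "Omega1_seq n B W"
  shows "\<psi> (GLorbit p n W) = GLorbit p (Suc n) (lift_mat W)"
proof -
  have c: "GLorbit p n W \<in> Q1" unfolding GLquot_def using assms Omega1_B_iff by blast
  define W' where "W' = (SOME V. V \<in> GLorbit p n W)"
  have W': "W' \<in> matZp p n" "Omega1_seq n B W'" "GLorbit p n W = GLorbit p n W'" using orbit_rep_Omega1[OF c] Omega1_B_iff unfolding W'_def by auto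
  have o: "same_orbit n W W'" using W'(3) orbit_eq_iff[OF assms(1) W'(1)] by simp
  have "same_orbit (Suc n) (bk 1 (lift_vec W) zv W) (bk 1 (lift_vec W') zv W')" by (rule same_orbit_lift[OF assms(2) W'(2) o])
  then have "same_orbit (Suc n) (lift_mat W') (lift_mat W)"
    using same_orbit_sym same_orbit_trans lift_mat_same_orbit[OF assms(2,1)] lift_mat_same_orbit[OF W'(2,1)] by meson
  moreover have mL: "lift_mat W \<in> matZp p (Suc n)" "lift_mat W' \<in> matZp p (Suc n)" using lift_mat_props assms W' Omega0_T_iff by blast+
  ultimately show ?thesis unfolding \<psi>_def W'_def[symmetric] using orbit_eq_iff[OF mL(2,1)] by simp
qed

lemma psi_surj: assumes "W2 \<in> Omega0 p (Suc n) T'"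
  shows "\<exists>W. W \<in> Omega1 p n B \<and> \<psi> (GLorbit p n W) = GLorbit p (Suc n) W2 \<and> same_orbit (Suc n) (bk 1 (lift_vec W) zv W) W2"
proof -
  have a: "W2 \<in> matZp p (Suc n)" "Omega0_seq (Suc n) T W2" using assms Omega0_T_iff by auto
  obtain W where W: "W \<in> matZp p n" "Omega1_seq n B W" "same_orbit (Suc n) (bk 1 (lift_vec W) zv W) W2"
    using surj_same_orbit[OF a(2,1)] by blast
  have "same_orbit (Suc n) (lift_mat W) W2" using same_orbit_trans[OF lift_mat_same_orbit(1)[OF W(2,1)] W(3)] .
  moreover have "lift_mat W \<in> matZp p (Suc n)" using lift_mat_props W Omega0_T_iff by blast
  ultimately have "GLorbit p (Suc n) (lift_mat W) = GLorbit p (Suc n) W2" using orbit_eq_iff a(1) by blast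
  then show ?thesis using psi_char[OF W(1,2)] W Omega1_B_iff by auto
qed

lemma psi_bij: "bij_betw \<psi> Q1 Q0"
  unfolding bij_betw_def
proof (intro conjI psi_inj)
  show "\<psi> ` Q1 = Q0"
  proof
    show "\<psi> ` Q1 \<subseteq> Q0" using psi_in by blast
    show "Q0 \<subseteq> \<psi> ` Q1"
    proof
      fix d assume "d \<in> Q0"
      then obtain W2 where W2: "W2 \<in> Omega0 p (Suc n) T'" "d = GLorbit p (Suc n) W2" unfolding GLquot_def by blast
      obtain W where "W \<in> Omega1 p n B" "\<psi> (GLorbit p n W) = d" using psi_surj[OF W2(1)] W2(2) by blast
      then show "d \<in> \<psi> ` Q1" unfolding GLquot_def by blast
    qed
  qed
qed

lemma psi_val: assumes "c \<in> Q1" "W \<in> c" "W' \<in> \<psi> c"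
  shows "zp_val (mdet p (Suc n) W') = zp_val (mdet p n W)"
proof -
  define Ws where "Ws = (SOME W. W \<in> c)"
  have Ws: "Ws \<in> matZp p n" "Omega1_seq n B Ws" "c = GLorbit p n Ws" using orbit_rep_Omega1[OF assms(1)] Omega1_B_iff unfolding Ws_def by auto
  have cW: "cm n Ws" "detm n Ws \<notin> I" using Omega_seq_cm[OF Ws(2)] by auto
  have "same_orbit n Ws W" using assms(2) Ws(3) orbit_set[OF Ws(1)] by auto
  then have v1: "val (detm n W) = val (detm n Ws)" using same_orbit_det cW by blast
  have mL: "lift_mat Ws \<in> matZp p (Suc n)" using lift_mat_props Ws Omega0_T_iff by blast
  have "same_orbit (Suc n) (lift_mat Ws) W'" using assms(3) unfolding \<psi>_def Ws_def[symmetric] using orbit_set[OF mL] by auto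
  then have o: "same_orbit (Suc n) (bk 1 (lift_vec Ws) zv Ws) W'" using same_orbit_trans[OF lift_mat_same_orbit(2)[OF Ws(2,1)]] by blast
  have db: "detm (Suc n) (bk 1 (lift_vec Ws) zv Ws) = detm n Ws" by (simp add: detm_bk)
  have cb: "cm (Suc n) (bk 1 (lift_vec Ws) zv Ws)" using lift_vec_props(1)[OF Ws(2)] cW(1) by (intro cm_bk) auto
  have "val (detm (Suc n) W') = val (detm n Ws)" using same_orbit_det[OF o cb] cW db by simp
  then show ?thesis using v1 by (simp add: mdet_val)
qed

lemma Dcoset_closed: "W \<in> Omega1 p n B \<inter> Dcoset p n i \<Longrightarrow> W' \<in> matZp p n \<Longrightarrow> same_orbit n W W' \<Longrightarrow> W' \<in> Omega1 p n B \<inter> Dcoset p n i"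
  using Omega1_closed Dcoset_iff same_orbit_Dcoset by blast

text \<open>psi also matches the orbits inside the double cosets D_{.,i}, since bordering
  preserves the double coset (dcoset_lift) and double cosets are unions of orbits.\<close>
lemma psi_Dcoset_into: assumes "i \<le> n" "c \<in> GLquot p n (Omega1 p n B \<inter> Dcoset p n i)"
  shows "\<psi> c \<in> GLquot p (Suc n) (Omega0 p (Suc n) T' \<inter> Dcoset p (Suc n) i)"
proof -
  define Ws where "Ws = (SOME W. W \<in> c)"
  have sub: "Omega1 p n B \<inter> Dcoset p n i \<subseteq> matZp p n" using Omega1_sub by blast
  have Ws: "Ws \<in> Omega1 p n B \<inter> Dcoset p n i"
    unfolding Ws_def by (rule orbit_rep(1)[OF assms(2) sub Dcoset_closed])
  have m: "Ws \<in> matZp p n" "Omega1_seq n B Ws" "Dcoset_seq n i Ws" using Ws Omega1_B_iff Dcoset_iff by auto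
  have "Dcoset_seq (Suc n) i (bk 1 (lift_vec Ws) zv Ws)"
    using dcoset_lift[OF lift_vec_props(1)[OF m(2)] mat_cm[OF m(1)] assms(1)] m(3) by blast
  then have "Dcoset_seq (Suc n) i (lift_mat Ws)"
    using Dcoset_seq_cong eqm_sym[OF lift_mat_props(2)[OF m(2,1)]] by blast
  then have "lift_mat Ws \<in> Omega0 p (Suc n) T' \<inter> Dcoset p (Suc n) i"
    using lift_mat_props[OF m(2,1)] Dcoset_iff Omega0_T_iff by blast
  then show ?thesis unfolding \<psi>_def Ws_def[symmetric] GLquot_def by blast
qed

lemma psi_Dcoset_onto: assumes "i \<le> n" "d \<in> GLquot p (Suc n) (Omega0 p (Suc n) T' \<inter> Dcoset p (Suc n) i)"
  shows "d \<in> \<psi> ` GLquot p n (Omega1 p n B \<inter> Dcoset p n i)"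
proof -
  obtain W2 where W2: "W2 \<in> Omega0 p (Suc n) T'" "W2 \<in> Dcoset p (Suc n) i" "d = GLorbit p (Suc n) W2"
    using assms(2) unfolding GLquot_def by blast
  obtain W where W: "W \<in> Omega1 p n B" "\<psi> (GLorbit p n W) = GLorbit p (Suc n) W2"
    "same_orbit (Suc n) (bk 1 (lift_vec W) zv W) W2" using psi_surj[OF W2(1)] by blast
  have m: "W \<in> matZp p n" "Omega1_seq n B W" using W(1) Omega1_B_iff by auto
  have "Dcoset_seq (Suc n) i W2" using W2(2) Dcoset_iff by blast
  then have "Dcoset_seq (Suc n) i (bk 1 (lift_vec W) zv W)" using same_orbit_Dcoset same_orbit_sym W(3) by blast
  then have "Dcoset_seq n i W" using dcoset_lift[OF lift_vec_props(1)[OF m(2)] mat_cm[OF m(1)] assms(1)] by blast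
  then have "W \<in> Omega1 p n B \<inter> Dcoset p n i" using W(1) m Dcoset_iff by blast
  then show ?thesis using W(2) W2(3) unfolding GLquot_def by blast
qed

lemma psi_Dcoset: assumes "i \<le> n"
  shows "bij_betw \<psi> (GLquot p n (Omega1 p n B \<inter> Dcoset p n i)) (GLquot p (Suc n) (Omega0 p (Suc n) T' \<inter> Dcoset p (Suc n) i))"
proof -
  have "GLquot p n (Omega1 p n B \<inter> Dcoset p n i) \<subseteq> Q1" unfolding GLquot_def by blast
  then have "inj_on \<psi> (GLquot p n (Omega1 p n B \<inter> Dcoset p n i))" using inj_on_subset[OF psi_inj] by blast
  then show ?thesis unfolding bij_betw_def using psi_Dcoset_into[OF assms] psi_Dcoset_onto[OF assms] by blast
qed

end

lemma lift_setup_Zp_intro: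
  assumes "prime p" "B \<in> L1_dbl p n" "\<rho> \<in> vecZp p n" "D \<in> Se p n"
    and "madd p B (msmul p 2 (outer p n \<rho>)) = msmul p 4 D"
  shows "lift_setup_Zp p n B D \<rho>"
proof -
  interpret padic p by standard (rule assms(1))
  have B: "B \<in> matZp p n" "detm n B \<notin> I" using assms(2) L1_iff unfolding L1_seq_def by auto
  have D: "D \<in> matZp p n" "Se_seq n D" using assms(4) Se_iff by auto
  have r: "cv n \<rho>" using vecZp_cv[OF assms(3)] .
  have hyp: "eqm n (B + sm 2 (out \<rho> \<rho>)) (sm 4 D)"
    using assms(5) Lprime_equation_iff[OF B(1) D(1) r] by simp
  show ?thesis by unfold_locales (use assms(1,3) B D r hyp in auto)
qed

theorem mainTheorem12:
  fixes p :: int and m :: nat and B2 D :: zmat and r :: zvec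
  assumes "prime p"
    and "m > 0" and "even m"
    and "B2 \<in> L1_dbl p (m - 1)"
    and "r \<in> vecZp p (m - 1)" and "D \<in> Se p (m - 1)"
    and "madd p B2 (msmul p 2 (outer p (m - 1) r)) = msmul p 4 D"
  shows "\<exists>\<psi>. bij_betw \<psi> (GLquot p (m - 1) (Omega1 p (m - 1) B2))
                        (GLquot p m (Omega0 p m (twoB1 p (m - 1) r D)))
          \<and> (\<forall>c \<in> GLquot p (m - 1) (Omega1 p (m - 1) B2). \<forall>W \<in> c. \<forall>W' \<in> \<psi> c.
                zp_val (mdet p m W') = zp_val (mdet p (m - 1) W))
          \<and> (\<forall>i \<le> m - 1.
               bij_betw \<psi> (GLquot p (m - 1) (Omega1 p (m - 1) B2 \<inter> Dcoset p (m - 1) i))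
                          (GLquot p m (Omega0 p m (twoB1 p (m - 1) r D) \<inter> Dcoset p m i)))"
proof -
  obtain n where mn: "m = Suc n" using assms(2) gr0_implies_Suc by blast
  interpret lift_setup_Zp p n B2 D r
    by (rule lift_setup_Zp_intro) (use assms mn in auto)
  have "bij_betw \<psi> Q1 Q0 \<and> (\<forall>c \<in> Q1. \<forall>W \<in> c. \<forall>W' \<in> \<psi> c. zp_val (mdet p (Suc n) W') = zp_val (mdet p n W))
    \<and> (\<forall>i \<le> n. bij_betw \<psi> (GLquot p n (Omega1 p n B2 \<inter> Dcoset p n i))
                       (GLquot p (Suc n) (Omega0 p (Suc n) T' \<inter> Dcoset p (Suc n) i)))"
    using psi_bij psi_val psi_Dcoset by blast
  then show ?thesis unfolding mn by auto
qed

end
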